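(* Assume the following two statements hold. (C1) For every $\boldsymbol\omega\in\mathcal P_{\mathbb A}^{++}$ and every $\ell$-highest-weight generator $v$ of $W^0(\boldsymbol\omega)$, $(U(\tilde{\mathfrak g})_{\mathbb A}v)\otimes_{\mathbb A}\mathbb F\cong W(\overline{\boldsymbol\omega})$ as $U(\tilde{\mathfrak g})_{\mathbb F}$-modules. (C2) Whenever $\lambda_1,\dots,\lambda_m\in P^+$ and $a_1,\dots,a_m\in\mathbb A^\times$ have pairwise distinct residues in $\mathbb F$, and $v_j$ is an $\ell$-highest-weight generator of $W^0(\boldsymbol\omega_{\lambda_j,a_j})$, one has $U(\tilde{\mathfrak g})_{\mathbb A}(v_1\otimes\cdots\otimes v_m)=U(\tilde{\mathfrak g})_{\mathbb A}v_1\otimes_{\mathbb A}\cdots\otimes_{\mathbb A}U(\tilde{\mathfrak g})_{\mathbb A}v_m$ inside $\bigotimes_jW^0(\boldsymbol\omega_{\lambda_j,a_j})\cong W^0(\prod_j\boldsymbol\omega_{\lambda_j,a_j})$. Let $\lambda_j\in P^+$, $b_j\in\mathbb F^\times$, $j=1,\dots,k$, be such that $b_i\ne b_j$ for $i\neq j$, and let $\overline{\boldsymbol\omega}=\prod_j\boldsymbol\omega_{\lambda_j,b_j}\in\mathcal P^+_{\mathbb F}$. Then: (a) $W(\overline{\boldsymbol\omega})\cong\bigotimes_jW(\boldsymbol\omega_{\lambda_j,b_j})$. (b) If $M_j$ is a quotient of $W(\boldsymbol\omega_{\lambda_j,b_j})$ for each $j$, then $M=\bigotimes_jM_j$ is a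 quotient of $W(\overline{\boldsymbol\omega})$.
   Context: Let $\mathfrak g$ be a finite-dimensional simple complex Lie algebra with Cartan subalgebra $\mathfrak h$, positive roots $R^+$, simple roots $\alpha_i$ ($i\in I$), weight lattice $P$, dominant integral weights $P^+$. Fix a Chevalley basis $\{x^\pm_\alpha,h_{\alpha_i}\}$ of $\mathfrak g$; $h_\alpha=[x_\alpha^+,x_\alpha^-]$, $h_i=h_{\alpha_i}$. Let $\tilde{\mathfrak g}=\mathfrak g\otimes\mathbb C[t,t^{-1}]$ with $[x\otimes t^r,y\otimes t^s]=[x,y]\otimes t^{r+s}$; $x^\pm_{\alpha,r}=x^\pm_\alpha\otimes t^r$, $h_{\alpha,r}=h_\alpha\otimes t^r$. Put $a^{(k)}=a^k/k!$, $\binom ak=a(a-1)\cdots(a-k+1)/k!$. Define $\Lambda_{\alpha,r}\in U(\tilde{\mathfrak h})$ by $\sum_{r\ge0}\Lambda_{\alpha,\pm r}u^r=\exp\bigl(-\sum_{s\ge1}\frac{h_{\alpha,\pm s}}{s}u^s\bigr)$, $\Lambda_{i,r}=\Lambda_{\alpha_i,r}$. $U(\tilde{\mathfrak g})_{\mathbb Z}$ is the $\mathbb Z$-subalgebra of $U(\tilde{\mathfrak g})$ generated by all $(x^\pm_{\alpha,r})^{(k)}$, $k\ge0$. For a commutative ring $\mathbb K$, $U(\tilde{\mathfrak g})_{\mathbb K}=U(\tilde{\mathfrak g})_{\mathbb Z}\otimes_{\mathbb Z}\mathbb K$, with Hopf structure induced from $U(\tilde{\mathfrak g})$ (used for tensor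 products; $\Delta((x^\pm_{\alpha,r})^{(k)})=\sum_{l+m=k}(x^\pm_{\alpha,r})^{(l)}\otimes(x^\pm_{\alpha,r})^{(m)}$). $\mathbb F$ is an algebraically closed field of characteristic $p>0$; $\mathbb A$ is a fixed discrete valuation ring, torsion free (as a $\mathbb Z$-module), with residue field $\mathbb F$; $\mathbb F^0$ is the algebraic closure of the fraction field of $\mathbb A$. Note $U(\tilde{\mathfrak g})_{\mathbb A}\otimes_{\mathbb A}\mathbb F\cong U(\tilde{\mathfrak g})_{\mathbb F}$. For $\mathbb K\in\{\mathbb F,\mathbb F^0,\mathbb A\}$, $\mathcal P^+_{\mathbb K}$ is the monoid of tuples $\boldsymbol\omega=(\boldsymbol\omega_i)_{i\in I}$ of polynomials in $\mathbb K[u]$ with constant term $1$; $\mathrm{wt}(\boldsymbol\omega)(h_i)=\deg\boldsymbol\omega_i$ defines $\mathrm{wt}(\boldsymbol\omega)\in P$; $\mathcal P_{\mathbb A}^{++}$ is the set of $\boldsymbol\omega\in\mathcal P^+_{\mathbb A}$ such that the leading coefficient of each $\boldsymbol\omega_i$ lies in $\mathbb A^\times$; $\overline{\boldsymbol\omega}\in\mathcal P^+_{\mathbb F}$ is the image of $\boldsymbol\omega\in\mathcal P_{\mathbb A}^+$. $\boldsymbol\omega_{\lambda,a}$ is the tuple with entries $(1-au)^{\lambda(h_i)}$. Over a field, for $f=\prod_j(1-a_ju)$ with $a_j\neq0$ put $f^+=f$, $f^-=\prod_j(1-a_j^{-1}u)$; $(\cdot)_s$ denotes the coefficient of $u^s$.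 For $\mathbb K\in\{\mathbb F,\mathbb F^0\}$ and $\boldsymbol\omega\in\mathcal P_{\mathbb K}^+$, the Weyl module ($W(\boldsymbol\omega)$ over $\mathbb F$, $W^0(\boldsymbol\omega)$ over $\mathbb F^0$) is the $U(\tilde{\mathfrak g})_{\mathbb K}$-module generated by a vector $v$ (its $\ell$-highest-weight generator, determined up to nonzero scalar) with defining relations $(x^+_{\alpha,r})^{(k)}v=0$ ($k>0$), $\binom{h_i}{k}v=\binom{\mathrm{wt}(\boldsymbol\omega)(h_i)}{k}v$ ($k\ge0$), $\Lambda_{i,\pm s}v=(\boldsymbol\omega_i^\pm)_sv$ ($s\ge0$), $(x^-_{\alpha,r})^{(l)}v=0$ ($l>\mathrm{wt}(\boldsymbol\omega)(h_\alpha)$), for all $\alpha\in R^+,r\in\mathbb Z,i\in I$. *)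

theory Defs
  imports Complex_Main "HOL-Library.Poly_Mapping" "HOL-Library.FuncSet"
    "HOL-Algebra.QuotRing" "HOL-Algebra.Module" "HOL-Algebra.Algebraic_Closure_Type"
begin

section \<open>Complex Lie algebras\<close>

class complex_lie_algebra = ab_group_add +
  fixes scaleC :: "complex \<Rightarrow> 'a \<Rightarrow> 'a"
    and lie :: "'a \<Rightarrow> 'a \<Rightarrow> 'a"
  assumes scaleC_add_right: "scaleC c (x + y) = scaleC c x + scaleC c y"
    and scaleC_add_left: "scaleC (c + d) x = scaleC c x + scaleC d x"
    and scaleC_scaleC: "scaleC c (scaleC d x) = scaleC (c * d) x"
    and scaleC_one: "scaleC 1 x = x"
    and lie_add_left: "lie (x + y) z = lie x z + lie y z"
    and lie_add_right: "lie z (x + y) = lie z x + lie z y"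
    and lie_scaleC_left: "lie (scaleC c x) y = scaleC c (lie x y)"
    and lie_scaleC_right: "lie x (scaleC c y) = scaleC c (lie x y)"
    and lie_self: "lie x x = 0"
    and jacobi: "lie x (lie y z) + lie y (lie z x) + lie z (lie x y) = 0"

global_interpretation cvs: vector_space "scaleC :: complex \<Rightarrow> 'a \<Rightarrow> 'a::complex_lie_algebra"
  by unfold_locales (simp_all add: scaleC_add_right scaleC_add_left scaleC_scaleC scaleC_one)

lemma lie_zero_left [simp]: "lie (0::'a::complex_lie_algebra) x = 0"
  using lie_add_left[of 0 0 x] by simp

lemma lie_zero_right [simp]: "lie x (0::'a::complex_lie_algebra) = 0"
  using lie_add_right[of x 0 0] by simp

lemma lie_anti: "lie x y + lie y x = (0::'a::complex_lie_algebra)"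
proof -
  have "lie (x + y) (x + y) = lie x x + (lie x y + lie y x) + lie y y"
    by (simp only: lie_add_left lie_add_right ac_simps)
  then show ?thesis by (simp only: lie_self add_0_left add_0_right)
qed

definition lie_ideal :: "'a::complex_lie_algebra set \<Rightarrow> bool" where
  "lie_ideal S \<longleftrightarrow> cvs.subspace S \<and> (\<forall>x. \<forall>y\<in>S. lie x y \<in> S)"

definition fd_simple_lie_algebra :: "'g::complex_lie_algebra itself \<Rightarrow> bool" where
  "fd_simple_lie_algebra _ \<longleftrightarrow>
     (\<exists>B::'g set. finite B \<and> cvs.span B = UNIV) \<and>
     (\<exists>x y::'g. lie x y \<noteq> 0) \<and>
     (\<forall>S::'g set. lie_ideal S \<longrightarrow> S = {0} \<or> S = UNIV)"

lemma poly_mapping_add_induct [case_names zero single add]: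
  fixes f :: "'a \<Rightarrow>\<^sub>0 'b::comm_monoid_add"
  assumes "P 0" "\<And>r x. P (Poly_Mapping.single r x)" "\<And>f g. P f \<Longrightarrow> P g \<Longrightarrow> P (f + g)"
  shows "P f"
proof -
  have "P (\<Sum>r\<in>A. Poly_Mapping.single r (Poly_Mapping.lookup f r))" if "finite A" for A
    using that by induction (auto intro: assms)
  from this[of "Poly_Mapping.keys f"] show ?thesis
    by (rule back_subst[of P]) (auto intro!: poly_mapping_eqI
        simp: lookup_sum lookup_single when_def in_keys_iff)
qed

text \<open>\<open>'m \<Rightarrow>\<^sub>0 'g\<close> is the Lie algebra of \<open>'g\<close> tensored with the monoid algebra of \<open>'m\<close>;
  in particular \<open>int \<Rightarrow>\<^sub>0 'g\<close> is the loop algebra, with \<open>Poly_Mapping.single r x\<close> in the role of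
  \<open>x\<close> tensored with \<open>t^r\<close>.\<close>

instantiation poly_mapping :: (comm_monoid_add, complex_lie_algebra) complex_lie_algebra
begin

definition scaleC_poly_mapping :: "complex \<Rightarrow> ('a \<Rightarrow>\<^sub>0 'b) \<Rightarrow> ('a \<Rightarrow>\<^sub>0 'b)" where
  "scaleC_poly_mapping c f = Poly_Mapping.map (scaleC c) f"

definition lie_poly_mapping :: "('a \<Rightarrow>\<^sub>0 'b) \<Rightarrow> ('a \<Rightarrow>\<^sub>0 'b) \<Rightarrow> ('a \<Rightarrow>\<^sub>0 'b)" where
  "lie_poly_mapping f g = (\<Sum>r\<in>Poly_Mapping.keys f. \<Sum>s\<in>Poly_Mapping.keys g.
     Poly_Mapping.single (r + s) (lie (Poly_Mapping.lookup f r) (Poly_Mapping.lookup g s)))"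

lemma lookup_scaleC: "Poly_Mapping.lookup (scaleC c f) r = scaleC c (Poly_Mapping.lookup f r)"
  for f :: "'a \<Rightarrow>\<^sub>0 'b"
  by (simp add: scaleC_poly_mapping_def map.rep_eq when_def)

lemma lie_poly_mapping_superset:
  fixes f g :: "'a \<Rightarrow>\<^sub>0 'b"
  assumes "finite A" "finite B" "Poly_Mapping.keys f \<subseteq> A" "Poly_Mapping.keys g \<subseteq> B"
  shows "lie f g = (\<Sum>r\<in>A. \<Sum>s\<in>B. Poly_Mapping.single (r + s) (lie (Poly_Mapping.lookup f r) (Poly_Mapping.lookup g s)))"
proof -
  have "(\<Sum>r\<in>A. \<Sum>s\<in>B. Poly_Mapping.single (r + s) (lie (Poly_Mapping.lookup f r) (Poly_Mapping.lookup g s))) =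
        (\<Sum>r\<in>Poly_Mapping.keys f. \<Sum>s\<in>B. Poly_Mapping.single (r + s) (lie (Poly_Mapping.lookup f r) (Poly_Mapping.lookup g s)))"
    using assms by (intro sum.mono_neutral_right) (auto simp: in_keys_iff)
  also have "\<dots> = (\<Sum>r\<in>Poly_Mapping.keys f. \<Sum>s\<in>Poly_Mapping.keys g. Poly_Mapping.single (r + s) (lie (Poly_Mapping.lookup f r) (Poly_Mapping.lookup g s)))"
    using assms by (intro sum.cong refl sum.mono_neutral_right) (auto simp: in_keys_iff)
  finally show ?thesis by (simp add: lie_poly_mapping_def)
qed

lemma lie_single:
  "lie (Poly_Mapping.single r x) (Poly_Mapping.single s y) = Poly_Mapping.single (r + s) (lie x y)"
  for r s :: 'a and x y :: 'b
  by (subst lie_poly_mapping_superset[of "{r}" "{s}"]) (auto split: if_splits)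

lemma lie_add_left_aux: "lie (f + g) h = lie f h + lie g h" for f g h :: "'a \<Rightarrow>\<^sub>0 'b"
proof -
  let ?A = "Poly_Mapping.keys f \<union> Poly_Mapping.keys g"
  have "Poly_Mapping.keys (f + g) \<subseteq> ?A" by (rule Poly_Mapping.keys_add)
  then show ?thesis
    by (simp add: lie_poly_mapping_superset[where A = ?A and B = "Poly_Mapping.keys h"] lookup_add lie_add_left
        single_add sum.distrib)
qed

lemma lie_add_right_aux: "lie h (f + g) = lie h f + lie h g" for f g h :: "'a \<Rightarrow>\<^sub>0 'b"
proof -
  let ?A = "Poly_Mapping.keys f \<union> Poly_Mapping.keys g"
  have "Poly_Mapping.keys (f + g) \<subseteq> ?A" by (rule Poly_Mapping.keys_add)
  then show ?thesis
    by (simp add: lie_poly_mapping_superset[where B = ?A and A = "Poly_Mapping.keys h"] lookup_add lie_add_right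
        single_add sum.distrib)
qed

lemma scaleC_single: "scaleC c (Poly_Mapping.single r x) = Poly_Mapping.single r (scaleC c x)"
  for r :: 'a and x :: 'b
  by (rule poly_mapping_eqI) (simp add: lookup_scaleC lookup_single when_def)

lemma scaleC_add_aux: "scaleC c (f + g) = scaleC c f + scaleC c g" for f g :: "'a \<Rightarrow>\<^sub>0 'b"
  by (rule poly_mapping_eqI) (simp add: lookup_scaleC lookup_add scaleC_add_right)

lemma scaleC_zero_aux: "scaleC c (0 :: 'a \<Rightarrow>\<^sub>0 'b) = 0"
  by (rule poly_mapping_eqI) (simp add: lookup_scaleC)

lemma lie_zero_aux: "lie (0 :: 'a \<Rightarrow>\<^sub>0 'b) f = 0" "lie f (0 :: 'a \<Rightarrow>\<^sub>0 'b) = 0"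
  by (simp_all add: lie_poly_mapping_def)

lemma lie_scaleC_aux:
  fixes f g :: "'a \<Rightarrow>\<^sub>0 'b"
  shows "lie (scaleC c f) g = scaleC c (lie f g)" "lie f (scaleC c g) = scaleC c (lie f g)"
proof -
  have "lie (scaleC c f) (Poly_Mapping.single s y) = scaleC c (lie f (Poly_Mapping.single s y)) \<and>
        lie f (scaleC c (Poly_Mapping.single s y)) = scaleC c (lie f (Poly_Mapping.single s y))" for s y
    by (induction f rule: poly_mapping_add_induct)
      (auto simp: lie_zero_aux scaleC_zero_aux scaleC_add_aux lie_add_left_aux scaleC_single lie_single
        lie_scaleC_left lie_scaleC_right)
  then have "lie (scaleC c f) g = scaleC c (lie f g) \<and> lie f (scaleC c g) = scaleC c (lie f g)"
    by (induction g rule: poly_mapping_add_induct)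
      (auto simp: lie_zero_aux scaleC_zero_aux scaleC_add_aux lie_add_right_aux)
  then show "lie (scaleC c f) g = scaleC c (lie f g)" "lie f (scaleC c g) = scaleC c (lie f g)"
    by auto
qed

lemma lie_anti_aux: "lie f g + lie g f = 0" for f g :: "'a \<Rightarrow>\<^sub>0 'b"
proof -
  have "lie f (Poly_Mapping.single s y) + lie (Poly_Mapping.single s y) f = 0" for s y
  proof (induction f rule: poly_mapping_add_induct)
    case (single r x)
    then show ?case by (simp add: lie_single add.commute[of s] flip: single_add) (simp add: lie_anti)
  next
    case (add f g)
    have "lie (f + g) (Poly_Mapping.single s y) + lie (Poly_Mapping.single s y) (f + g) =
      (lie f (Poly_Mapping.single s y) + lie (Poly_Mapping.single s y) f) +
      (lie g (Poly_Mapping.single s y) + lie (Poly_Mapping.single s y) g)"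
      by (simp add: lie_add_left_aux lie_add_right_aux algebra_simps)
    with add show ?case by simp
  qed (simp add: lie_zero_aux)
  note s = this
  show ?thesis
  proof (induction g rule: poly_mapping_add_induct)
    case (add g h)
    have "lie f (g + h) + lie (g + h) f = (lie f g + lie g f) + (lie f h + lie h f)"
      by (simp add: lie_add_left_aux lie_add_right_aux algebra_simps)
    with add show ?case by simp
  qed (simp_all add: lie_zero_aux s)
qed

lemma lie_self_aux: "lie f f = 0" for f :: "'a \<Rightarrow>\<^sub>0 'b"
proof (induction f rule: poly_mapping_add_induct)
  case (add f g)
  then show ?case using lie_anti_aux[of f g] by (simp add: lie_add_left_aux lie_add_right_aux add.commute)
qed (simp_all add: lie_zero_aux lie_single lie_self)

lemma jacobi_aux: "lie f (lie g h) + lie g (lie h f) + lie h (lie f g) = 0"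
  for f g h :: "'a \<Rightarrow>\<^sub>0 'b"
proof -
  define J where "J f g h = lie f (lie g h) + lie g (lie h f) + lie h (lie f g)"
    for f g h :: "'a \<Rightarrow>\<^sub>0 'b"
  have cyc: "J f g h = J g h f" for f g h by (simp add: J_def algebra_simps)
  have add: "J (f + f') g h = J f g h + J f' g h" for f f' g h
    by (simp add: J_def lie_add_left_aux lie_add_right_aux algebra_simps)
  have zero: "J 0 g h = 0" for g h by (simp add: J_def lie_zero_aux)
  have 1: "J (Poly_Mapping.single r x) (Poly_Mapping.single s y) (Poly_Mapping.single t z) = 0"
    for r s t x y z
  proof -
    have "s + (t + r) = r + (s + t)" "t + (r + s) = r + (s + t)" by (simp_all add: ac_simps)
    then show ?thesis by (simp add: J_def lie_single jacobi flip: single_add)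
  qed
  have 2: "J f (Poly_Mapping.single s y) (Poly_Mapping.single t z) = 0" for f s t y z
    by (induction f rule: poly_mapping_add_induct) (simp_all add: zero add 1)
  have "J (Poly_Mapping.single s y) (Poly_Mapping.single t z) f = 0" for f s t y z
    using 2 cyc by metis
  then have 3: "J g (Poly_Mapping.single t z) f = 0" for f g t z
    by (induction g rule: poly_mapping_add_induct) (simp_all add: zero add)
  have "J (Poly_Mapping.single t z) f g = 0" for f g t z
    using 3 cyc by metis
  then have "J f g h = 0"
    by (induction f rule: poly_mapping_add_induct) (simp_all add: zero add)
  then show ?thesis by (simp add: J_def)
qed

instance
  by standard (auto simp: scaleC_add_aux lie_add_left_aux lie_add_right_aux lie_scaleC_aux
      lie_self_aux jacobi_aux lookup_scaleC lookup_add scaleC_add_left scaleC_scaleC scaleC_one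
      intro!: poly_mapping_eqI)

end

section \<open>Universal enveloping algebra\<close>

text \<open>Free monoid written additively, so that \<open>'l fmon \<Rightarrow>\<^sub>0 complex\<close> is the free associative
  algebra on the set \<open>'l\<close>.\<close>

datatype 'l fmon = FMon "'l list"

instantiation fmon :: (type) monoid_add
begin

definition zero_fmon :: "'a fmon" where "zero_fmon = FMon []"

fun plus_fmon :: "'a fmon \<Rightarrow> 'a fmon \<Rightarrow> 'a fmon" where "plus_fmon (FMon xs) (FMon ys) = FMon (xs @ ys)"

instance
proof
  fix a b c :: "'a fmon"
  show "a + b + c = a + (b + c)" by (cases a; cases b; cases c) simp
  show "0 + a = a" "a + 0 = a" by (cases a; simp add: zero_fmon_def)+
qed

end

inductive_set uea_ideal :: "('l::complex_lie_algebra fmon \<Rightarrow>\<^sub>0 complex) set" where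
  rel_add: "Poly_Mapping.single (FMon [x + y]) 1
      - Poly_Mapping.single (FMon [x]) 1 - Poly_Mapping.single (FMon [y]) 1 \<in> uea_ideal"
| rel_scale: "Poly_Mapping.single (FMon [scaleC c x]) 1 - Poly_Mapping.single (FMon [x]) c \<in> uea_ideal"
| rel_lie: "Poly_Mapping.single (FMon [x, y]) 1 - Poly_Mapping.single (FMon [y, x]) 1
      - Poly_Mapping.single (FMon [lie x y]) 1 \<in> uea_ideal"
| add: "a \<in> uea_ideal \<Longrightarrow> b \<in> uea_ideal \<Longrightarrow> a + b \<in> uea_ideal"
| mult_left: "a \<in> uea_ideal \<Longrightarrow> b * a \<in> uea_ideal"
| mult_right: "a \<in> uea_ideal \<Longrightarrow> a * b \<in> uea_ideal"

lemma uea_ideal_zero: "0 \<in> uea_ideal"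
  using uea_ideal.mult_left[OF uea_ideal.rel_add, of 0] by simp

lemma uea_ideal_uminus: "a \<in> uea_ideal \<Longrightarrow> - a \<in> uea_ideal"
  using uea_ideal.mult_left[of a "- 1"] by simp

lemma uea_ideal_diff: "a \<in> uea_ideal \<Longrightarrow> b \<in> uea_ideal \<Longrightarrow> a - b \<in> uea_ideal"
  using uea_ideal.add[OF _ uea_ideal_uminus] by fastforce

definition uea_rel :: "('l::complex_lie_algebra fmon \<Rightarrow>\<^sub>0 complex) \<Rightarrow> ('l fmon \<Rightarrow>\<^sub>0 complex) \<Rightarrow> bool" where
  "uea_rel a b \<longleftrightarrow> a - b \<in> uea_ideal"

lemma equivp_uea_rel: "equivp uea_rel"
proof (rule equivpI)
  show "reflp uea_rel" by (auto simp: reflp_def uea_rel_def uea_ideal_zero)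
  show "symp uea_rel" using uea_ideal_uminus by (force simp: symp_def uea_rel_def)
  show "transp uea_rel" using uea_ideal.add by (force simp: transp_def uea_rel_def)
qed

quotient_type (overloaded) 'l uea = "'l::complex_lie_algebra fmon \<Rightarrow>\<^sub>0 complex" / uea_rel
  by (rule equivp_uea_rel)

instantiation uea :: (complex_lie_algebra) ring
begin

lift_definition zero_uea :: "'a uea" is 0 .

lift_definition plus_uea :: "'a uea \<Rightarrow> 'a uea \<Rightarrow> 'a uea" is "(+)"
  using uea_ideal.add by (force simp: uea_rel_def add_diff_add)

lift_definition uminus_uea :: "'a uea \<Rightarrow> 'a uea" is uminus
  using uea_ideal_uminus by (force simp: uea_rel_def)

lift_definition minus_uea :: "'a uea \<Rightarrow> 'a uea \<Rightarrow> 'a uea" is "(-)"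
  using uea_ideal_diff by (force simp: uea_rel_def diff_diff_eq2 algebra_simps)

lift_definition times_uea :: "'a uea \<Rightarrow> 'a uea \<Rightarrow> 'a uea" is "(*)"
proof -
  fix a a' b b' :: "'a fmon \<Rightarrow>\<^sub>0 complex"
  assume "uea_rel a a'" "uea_rel b b'"
  then have "(a - a') * b + a' * (b - b') \<in> uea_ideal"
    unfolding uea_rel_def by (intro uea_ideal.add uea_ideal.mult_left uea_ideal.mult_right)
  then show "uea_rel (a * b) (a' * b')" by (simp add: uea_rel_def algebra_simps)
qed

instance
  by standard (transfer, simp add: uea_rel_def uea_ideal_zero algebra_simps)+

end

lemma fmon_add_eq_zero: "a + b = 0 \<longleftrightarrow> a = 0 \<and> b = (0 :: 'a fmon)"
  by (cases a; cases b) (auto simp: zero_fmon_def)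

lemma lookup_mult_zero:
  fixes a b :: "'l fmon \<Rightarrow>\<^sub>0 complex"
  shows "Poly_Mapping.lookup (a * b) 0 = Poly_Mapping.lookup a 0 * Poly_Mapping.lookup b 0"
proof (induction a rule: poly_mapping_add_induct)
  case (single r x)
  show ?case
    by (induction b rule: poly_mapping_add_induct)
      (auto simp: mult_single lookup_single lookup_add fmon_add_eq_zero when_def distrib_left)
qed (simp_all add: distrib_right lookup_add)

lemma FMon_Cons_neq_zero [simp]: "FMon (x # xs) \<noteq> 0"
  by (simp add: zero_fmon_def)

lemma uea_ideal_lookup_zero: "a \<in> uea_ideal \<Longrightarrow> Poly_Mapping.lookup a 0 = 0"
  by (induction rule: uea_ideal.induct)
    (auto simp: lookup_add lookup_minus lookup_single lookup_mult_zero)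

instantiation uea :: (complex_lie_algebra) ring_1
begin

lift_definition one_uea :: "'a uea" is 1 .

instance
proof
  show "(0 :: 'a uea) \<noteq> 1"
    by transfer (auto simp: uea_rel_def dest: uea_ideal_lookup_zero)
qed (transfer, simp add: uea_rel_def uea_ideal_zero)+

end

lift_definition uea_of :: "'l::complex_lie_algebra \<Rightarrow> 'l uea" is
  "\<lambda>x. Poly_Mapping.single (FMon [x]) 1" .

lift_definition uea_const :: "complex \<Rightarrow> 'l::complex_lie_algebra uea" is
  "\<lambda>c. Poly_Mapping.single 0 c" .


definition uea_scale :: "complex \<Rightarrow> 'l::complex_lie_algebra uea \<Rightarrow> 'l uea" where
  "uea_scale c u = uea_const c * u"

definition uea_binom :: "'l::complex_lie_algebra uea \<Rightarrow> nat \<Rightarrow> 'l uea" where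
  "uea_binom u k = uea_scale (1 / fact k) (prod_list (map (\<lambda>j. u - of_nat j) [0..<k]))"


section \<open>Cartan subalgebras, roots and Chevalley bases\<close>

definition lie_subalgebra :: "'g::complex_lie_algebra set \<Rightarrow> bool" where
  "lie_subalgebra H \<longleftrightarrow> cvs.subspace H \<and> (\<forall>x\<in>H. \<forall>y\<in>H. lie x y \<in> H)"

primrec lower_central :: "'g::complex_lie_algebra set \<Rightarrow> nat \<Rightarrow> 'g set" where
  "lower_central H 0 = H"
| "lower_central H (Suc n) = cvs.span {lie x y |x y. x \<in> H \<and> y \<in> lower_central H n}"

definition cartan_subalgebra :: "'g::complex_lie_algebra set \<Rightarrow> bool" where
  "cartan_subalgebra H \<longleftrightarrow> lie_subalgebra H \<and> (\<exists>n. lower_central H n = {0}) \<and>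
     {x. \<forall>h\<in>H. lie x h \<in> H} = H"

text \<open>Linear functionals on the subspace \<open>H\<close> are represented by functions vanishing outside \<open>H\<close>.\<close>

definition dual_space :: "'g::complex_lie_algebra set \<Rightarrow> ('g \<Rightarrow> complex) set" where
  "dual_space H = {\<mu>. (\<forall>x\<in>H. \<forall>y\<in>H. \<mu> (x + y) = \<mu> x + \<mu> y) \<and>
     (\<forall>c. \<forall>x\<in>H. \<mu> (scaleC c x) = c * \<mu> x) \<and> (\<forall>x. x \<notin> H \<longrightarrow> \<mu> x = 0)}"

definition root_space :: "'g::complex_lie_algebra set \<Rightarrow> ('g \<Rightarrow> complex) \<Rightarrow> 'g set" where
  "root_space H \<mu> = {x. \<forall>h\<in>H. lie h x = scaleC (\<mu> h) x}"

definition roots :: "'g::complex_lie_algebra set \<Rightarrow> ('g \<Rightarrow> complex) set" where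
  "roots H = {\<beta> \<in> dual_space H. \<beta> \<noteq> (\<lambda>_. 0) \<and> root_space H \<beta> \<noteq> {0}}"

text \<open>For a positive root \<open>\<alpha>\<close>, \<open>root_vector \<alpha>\<close> is \<open>x\<^sup>+\<^sub>\<alpha>\<close> and \<open>root_vector (- \<alpha>)\<close> is \<open>x\<^sup>-\<^sub>\<alpha>\<close>.\<close>

record ('g, 'i) chevalley_data =
  cartan :: "'g set"
  simple_root :: "'i \<Rightarrow> 'g \<Rightarrow> complex"
  root_vector :: "('g \<Rightarrow> complex) \<Rightarrow> 'g"

definition neg_root :: "('g \<Rightarrow> complex) \<Rightarrow> 'g \<Rightarrow> complex" where
  "neg_root \<beta> = (\<lambda>h. - \<beta> h)"

definition positive_roots :: "('g::complex_lie_algebra, 'i::finite) chevalley_data \<Rightarrow> ('g \<Rightarrow> complex) set" where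
  "positive_roots D = {\<beta> \<in> roots (cartan D).
     \<exists>n::'i \<Rightarrow> nat. \<beta> = (\<lambda>h. \<Sum>i\<in>UNIV. of_nat (n i) * simple_root D i h)}"

definition is_root_base :: "('g::complex_lie_algebra, 'i::finite) chevalley_data \<Rightarrow> bool" where
  "is_root_base D \<longleftrightarrow> range (simple_root D) \<subseteq> roots (cartan D) \<and>
     (\<forall>c::'i \<Rightarrow> complex. (\<lambda>h. \<Sum>i\<in>UNIV. c i * simple_root D i h) = (\<lambda>_. 0) \<longrightarrow> (\<forall>i. c i = 0)) \<and>
     (\<forall>\<beta>\<in>roots (cartan D). \<beta> \<in> positive_roots D \<or> neg_root \<beta> \<in> positive_roots D)"

definition coroot :: "('g::complex_lie_algebra, 'i) chevalley_data \<Rightarrow> ('g \<Rightarrow> complex) \<Rightarrow> 'g" where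
  "coroot D \<beta> = lie (root_vector D \<beta>) (root_vector D (neg_root \<beta>))"

definition simple_coroot :: "('g::complex_lie_algebra, 'i) chevalley_data \<Rightarrow> 'i \<Rightarrow> 'g" where
  "simple_coroot D i = coroot D (simple_root D i)"

text \<open>Since \<open>coroot D \<beta>\<close> lies in the line spanned by brackets of the root spaces of \<open>\<beta>\<close> and
  \<open>- \<beta>\<close>, the normalisation \<open>\<beta> (coroot D \<beta>) = 2\<close> says that it is the coroot of \<open>\<beta>\<close>.\<close>

definition is_chevalley_basis :: "('g::complex_lie_algebra, 'i::finite) chevalley_data \<Rightarrow> bool" where
  "is_chevalley_basis D \<longleftrightarrow>
     (let R = roots (cartan D); B = root_vector D ` R \<union> range (simple_coroot D) in
       \<not> cvs.dependent B \<and> cvs.span B = UNIV \<and>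
       (\<forall>\<beta>\<in>R. root_vector D \<beta> \<in> root_space (cartan D) \<beta> \<and> \<beta> (coroot D \<beta>) = 2) \<and>
       (\<forall>\<beta>\<in>R. \<forall>\<gamma>\<in>R. (\<lambda>h. \<beta> h + \<gamma> h) \<in> R \<longrightarrow>
         (\<exists>c. lie (root_vector D \<beta>) (root_vector D \<gamma>) =
                scaleC c (root_vector D (\<lambda>h. \<beta> h + \<gamma> h)) \<and>
              lie (root_vector D (neg_root \<beta>)) (root_vector D (neg_root \<gamma>)) =
                scaleC (- c) (root_vector D (neg_root (\<lambda>h. \<beta> h + \<gamma> h))))))"

definition chevalley_setup :: "('g::complex_lie_algebra, 'i::finite) chevalley_data \<Rightarrow> bool" where
  "chevalley_setup D \<longleftrightarrow> cartan_subalgebra (cartan D) \<and> is_root_base D \<and> is_chevalley_basis D"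

definition dominant_weights :: "('g::complex_lie_algebra, 'i) chevalley_data \<Rightarrow> ('g \<Rightarrow> complex) set" where
  "dominant_weights D = {\<mu> \<in> dual_space (cartan D). \<forall>i. \<mu> (simple_coroot D i) \<in> \<nat>}"


section \<open>The integral form of the enveloping algebra of the loop algebra\<close>

type_synonym 'g loop = "int \<Rightarrow>\<^sub>0 'g"

definition uloop :: "'g::complex_lie_algebra \<Rightarrow> int \<Rightarrow> 'g loop uea" where
  "uloop x r = uea_of (Poly_Mapping.single r x)"

definition divpow ::
    "('g::complex_lie_algebra, 'i) chevalley_data \<Rightarrow> ('g \<Rightarrow> complex) \<Rightarrow> int \<Rightarrow> nat \<Rightarrow> 'g loop uea" where
  "divpow D \<beta> r k = uea_scale (1 / fact k) (uloop (root_vector D \<beta>) r ^ k)"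

text \<open>\<open>big_lambda D i e s\<close> with \<open>e = 1\<close> or \<open>e = -1\<close> is \<open>\<Lambda>\<close> with index \<open>(i, e * s)\<close>.  The series
  inside the exponential has zero constant term, so only its powers up to the \<open>s\<close>-th contribute
  to the coefficient of \<open>u^s\<close>.\<close>

definition big_lambda ::
    "('g::complex_lie_algebra, 'i) chevalley_data \<Rightarrow> 'i \<Rightarrow> int \<Rightarrow> nat \<Rightarrow> 'g loop uea" where
  "big_lambda D i e s =
     (let F = Abs_fps (\<lambda>m. if m = 0 then 0
            else uea_scale (- 1 / of_nat m) (uloop (simple_coroot D i) (e * int m)))
      in \<Sum>n\<le>s. uea_scale (1 / fact n) (fps_nth (F ^ n) s))"

inductive_set UZ :: "('g::complex_lie_algebra, 'i) chevalley_data \<Rightarrow> 'g loop uea set"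
  for D :: "('g, 'i) chevalley_data" where
  gen: "\<beta> \<in> roots (cartan D) \<Longrightarrow> divpow D \<beta> r k \<in> UZ D"
| zero: "0 \<in> UZ D"
| one: "1 \<in> UZ D"
| add: "u \<in> UZ D \<Longrightarrow> w \<in> UZ D \<Longrightarrow> u + w \<in> UZ D"
| uminus: "u \<in> UZ D \<Longrightarrow> - u \<in> UZ D"
| mult: "u \<in> UZ D \<Longrightarrow> w \<in> UZ D \<Longrightarrow> u * w \<in> UZ D"


section \<open>Modules and tensor products\<close>

text \<open>Left modules over a possibly noncommutative ring; the locale \<^locale>\<open>module\<close> requires a
  commutative one.\<close>

locale lmodule = R?: ring R + M?: abelian_group M
  for R :: "('r, 'c) ring_scheme" (structure) and M :: "('r, 'm, 'd) module_scheme" (structure) +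
  assumes smult_closed: "\<lbrakk>a \<in> carrier R; x \<in> carrier M\<rbrakk> \<Longrightarrow> a \<odot>\<^bsub>M\<^esub> x \<in> carrier M"
    and smult_l_distr: "\<lbrakk>a \<in> carrier R; b \<in> carrier R; x \<in> carrier M\<rbrakk> \<Longrightarrow>
      (a \<oplus> b) \<odot>\<^bsub>M\<^esub> x = a \<odot>\<^bsub>M\<^esub> x \<oplus>\<^bsub>M\<^esub> b \<odot>\<^bsub>M\<^esub> x"
    and smult_r_distr: "\<lbrakk>a \<in> carrier R; x \<in> carrier M; y \<in> carrier M\<rbrakk> \<Longrightarrow>
      a \<odot>\<^bsub>M\<^esub> (x \<oplus>\<^bsub>M\<^esub> y) = a \<odot>\<^bsub>M\<^esub> x \<oplus>\<^bsub>M\<^esub> a \<odot>\<^bsub>M\<^esub> y"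
    and smult_assoc: "\<lbrakk>a \<in> carrier R; b \<in> carrier R; x \<in> carrier M\<rbrakk> \<Longrightarrow>
      (a \<otimes> b) \<odot>\<^bsub>M\<^esub> x = a \<odot>\<^bsub>M\<^esub> (b \<odot>\<^bsub>M\<^esub> x)"
    and smult_one: "x \<in> carrier M \<Longrightarrow> \<one> \<odot>\<^bsub>M\<^esub> x = x"

definition lmod_hom :: "('r, 'c) ring_scheme \<Rightarrow> ('r, 'm) module \<Rightarrow> ('r, 'n) module \<Rightarrow> ('m \<Rightarrow> 'n) set" where
  "lmod_hom R M N = {\<phi> \<in> carrier M \<rightarrow> carrier N.
     (\<forall>x\<in>carrier M. \<forall>y\<in>carrier M. \<phi> (x \<oplus>\<^bsub>M\<^esub> y) = \<phi> x \<oplus>\<^bsub>N\<^esub> \<phi> y) \<and>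
     (\<forall>a\<in>carrier R. \<forall>x\<in>carrier M. \<phi> (a \<odot>\<^bsub>M\<^esub> x) = a \<odot>\<^bsub>N\<^esub> \<phi> x)}"

definition lmod_iso :: "('r, 'c) ring_scheme \<Rightarrow> ('r, 'm) module \<Rightarrow> ('r, 'n) module \<Rightarrow> ('m \<Rightarrow> 'n) set" where
  "lmod_iso R M N = {\<phi> \<in> lmod_hom R M N. bij_betw \<phi> (carrier M) (carrier N)}"

definition lmod_isomorphic :: "('r, 'c) ring_scheme \<Rightarrow> ('r, 'm) module \<Rightarrow> ('r, 'n) module \<Rightarrow> bool" where
  "lmod_isomorphic R M N \<longleftrightarrow> lmod_iso R M N \<noteq> {}"

definition is_quotient_of :: "('r, 'c) ring_scheme \<Rightarrow> ('r, 'n) module \<Rightarrow> ('r, 'm) module \<Rightarrow> bool" where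
  "is_quotient_of R N M \<longleftrightarrow> (\<exists>\<phi>\<in>lmod_hom R M N. \<phi> ` carrier M = carrier N)"

text \<open>Elements of \<open>G\<close> outside the carrier are ignored.  In the applications below there are none:
  for the Weyl relations this is the theorem of Kostant and Garland that \<open>binomial h\<^sub>i k\<close> and
  \<open>\<Lambda>\<^sub>i\<^sub>,\<^sub>r\<close> lie in the integral form.\<close>

definition submodule_generated :: "('r, 'c) ring_scheme \<Rightarrow> ('r, 'm) module \<Rightarrow> 'm set \<Rightarrow> 'm set" where
  "submodule_generated R M G = \<Inter>{N. submodule N R M \<and> G \<inter> carrier M \<subseteq> N}"

definition quotient_module :: "('r, 'm) module \<Rightarrow> 'm set \<Rightarrow> ('r, 'm set) module" where
  "quotient_module M N = \<lparr>carrier = a_rcosets\<^bsub>M\<^esub> N, monoid.mult = undefined, one = undefined,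
     ring.zero = N, add = set_add M, module.smult = (\<lambda>r A. \<Union>x\<in>A. N +>\<^bsub>M\<^esub> (r \<odot>\<^bsub>M\<^esub> x))\<rparr>"

definition cyclic_submodule :: "('r, 'c) ring_scheme \<Rightarrow> ('r, 'm) module \<Rightarrow> 'm \<Rightarrow> ('r, 'm) module" where
  "cyclic_submodule R M v = M\<lparr>carrier := (\<lambda>u. u \<odot>\<^bsub>M\<^esub> v) ` carrier R\<rparr>"

definition restrict_scalars :: "('s \<Rightarrow> 'r) \<Rightarrow> ('r, 'm) module \<Rightarrow> ('s, 'm) module" where
  "restrict_scalars \<phi> M = \<lparr>carrier = carrier M, monoid.mult = monoid.mult M, one = one M,
     ring.zero = zero M, add = add M, module.smult = (\<lambda>s. module.smult M (\<phi> s))\<rparr>"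

definition regular_module :: "'r ring \<Rightarrow> ('r, 'r) module" where
  "regular_module R = \<lparr>carrier = carrier R, monoid.mult = monoid.mult R, one = one R,
     ring.zero = zero R, add = add R, module.smult = monoid.mult R\<rparr>"

definition module_via :: "('r \<Rightarrow> 's) \<Rightarrow> 's set \<Rightarrow> ('r, 's::ring_1) module" where
  "module_via \<phi> S = \<lparr>carrier = S, monoid.mult = (*), one = 1, ring.zero = 0, add = (+),
     module.smult = (\<lambda>r x. \<phi> r * x)\<rparr>"

definition free_module :: "'b set \<Rightarrow> ('r::comm_ring_1, 'b \<Rightarrow>\<^sub>0 'r) module" where
  "free_module B = \<lparr>carrier = {f. Poly_Mapping.keys f \<subseteq> B}, monoid.mult = undefined,
     one = undefined, ring.zero = 0, add = (+), module.smult = (\<lambda>c. Poly_Mapping.map ((*) c))\<rparr>"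

text \<open>Tensor product of two modules over the commutative ring \<open>'r\<close>: the free module on pairs modulo
  the bilinearity relations.\<close>

definition bilinear_relations ::
    "('r::comm_ring_1, 'm) module \<Rightarrow> ('r, 'n) module \<Rightarrow> (('m \<times> 'n) \<Rightarrow>\<^sub>0 'r) set" where
  "bilinear_relations M N = submodule_generated (ring_of_type_algebra :: 'r ring)
     (free_module (carrier M \<times> carrier N))
     ({Poly_Mapping.single (x \<oplus>\<^bsub>M\<^esub> x', y) 1 - Poly_Mapping.single (x, y) 1
         - Poly_Mapping.single (x', y) 1 |x x' y.
         x \<in> carrier M \<and> x' \<in> carrier M \<and> y \<in> carrier N} \<union>
      {Poly_Mapping.single (x, y \<oplus>\<^bsub>N\<^esub> y') 1 - Poly_Mapping.single (x, y) 1
         - Poly_Mapping.single (x, y') 1 |x y y'.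
         x \<in> carrier M \<and> y \<in> carrier N \<and> y' \<in> carrier N} \<union>
      {Poly_Mapping.single (c \<odot>\<^bsub>M\<^esub> x, y) 1 - Poly_Mapping.single (x, y) c |c x y.
         x \<in> carrier M \<and> y \<in> carrier N} \<union>
      {Poly_Mapping.single (x, c \<odot>\<^bsub>N\<^esub> y) 1 - Poly_Mapping.single (x, y) c |c x y.
         x \<in> carrier M \<and> y \<in> carrier N})"

definition tensor2 ::
    "('r::comm_ring_1, 'm) module \<Rightarrow> ('r, 'n) module \<Rightarrow> ('r, (('m \<times> 'n) \<Rightarrow>\<^sub>0 'r) set) module" where
  "tensor2 M N = quotient_module (free_module (carrier M \<times> carrier N)) (bilinear_relations M N)"

definition tensor2_class ::
    "('r::comm_ring_1, 'm) module \<Rightarrow> ('r, 'n) module \<Rightarrow> (('m \<times> 'n) \<Rightarrow>\<^sub>0 'r) \<Rightarrow> (('m \<times> 'n) \<Rightarrow>\<^sub>0 'r) set" where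
  "tensor2_class M N f = bilinear_relations M N +>\<^bsub>free_module (carrier M \<times> carrier N)\<^esub> f"

text \<open>Tensor product of the family \<open>Ms 0, \<dots>, Ms (k - 1)\<close> over \<open>'r\<close>; for \<open>k = 0\<close> it is \<open>'r\<close>.\<close>

definition tuples :: "nat \<Rightarrow> (nat \<Rightarrow> ('r, 'm) module) \<Rightarrow> (nat \<Rightarrow> 'm) set" where
  "tuples k Ms = (\<Pi>\<^sub>E j\<in>{..<k}. carrier (Ms j))"

definition multilinear_relations ::
    "nat \<Rightarrow> (nat \<Rightarrow> ('r::comm_ring_1, 'm) module) \<Rightarrow> ((nat \<Rightarrow> 'm) \<Rightarrow>\<^sub>0 'r) set" where
  "multilinear_relations k Ms = submodule_generated (ring_of_type_algebra :: 'r ring)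
     (free_module (tuples k Ms))
     ({Poly_Mapping.single (w(j := x \<oplus>\<^bsub>Ms j\<^esub> y)) 1 - Poly_Mapping.single (w(j := x)) 1
         - Poly_Mapping.single (w(j := y)) 1 |w j x y.
         w \<in> tuples k Ms \<and> j < k \<and> x \<in> carrier (Ms j) \<and> y \<in> carrier (Ms j)} \<union>
      {Poly_Mapping.single (w(j := c \<odot>\<^bsub>Ms j\<^esub> x)) 1 - Poly_Mapping.single (w(j := x)) c |w j c x.
         w \<in> tuples k Ms \<and> j < k \<and> x \<in> carrier (Ms j)})"

definition tensor ::
    "nat \<Rightarrow> (nat \<Rightarrow> ('r::comm_ring_1, 'm) module) \<Rightarrow> ('r, ((nat \<Rightarrow> 'm) \<Rightarrow>\<^sub>0 'r) set) module" where
  "tensor k Ms = quotient_module (free_module (tuples k Ms)) (multilinear_relations k Ms)"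

definition tensor_class ::
    "nat \<Rightarrow> (nat \<Rightarrow> ('r::comm_ring_1, 'm) module) \<Rightarrow> ((nat \<Rightarrow> 'm) \<Rightarrow>\<^sub>0 'r) \<Rightarrow> ((nat \<Rightarrow> 'm) \<Rightarrow>\<^sub>0 'r) set" where
  "tensor_class k Ms f = multilinear_relations k Ms +>\<^bsub>free_module (tuples k Ms)\<^esub> f"

definition pure_tensor ::
    "nat \<Rightarrow> (nat \<Rightarrow> ('r::comm_ring_1, 'm) module) \<Rightarrow> (nat \<Rightarrow> 'm) \<Rightarrow> ((nat \<Rightarrow> 'm) \<Rightarrow>\<^sub>0 'r) set" where
  "pure_tensor k Ms w = tensor_class k Ms (Poly_Mapping.single (restrict w {..<k}) 1)"


section \<open>The algebras \<open>U\<^sub>K\<close> and their modules\<close>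

type_synonym ('g, 'k) hyp = "('g loop uea \<times> 'k \<Rightarrow>\<^sub>0 int) set"

definition UZ_module :: "('g::complex_lie_algebra, 'i) chevalley_data \<Rightarrow> (int, 'g loop uea) module" where
  "UZ_module D = module_via of_int (UZ D)"

definition Z_module :: "(int, 'k::comm_ring_1) module" where
  "Z_module = module_via of_int UNIV"

text \<open>Product in the monoid ring over \<open>\<int>\<close> of the multiplicative monoid of pairs; it induces
  \<open>(u \<otimes> c) (u' \<otimes> c') = u u' \<otimes> c c'\<close>.\<close>

definition pair_mult :: "('a::times \<times> 'b::times \<Rightarrow>\<^sub>0 int) \<Rightarrow> ('a \<times> 'b \<Rightarrow>\<^sub>0 int) \<Rightarrow> ('a \<times> 'b \<Rightarrow>\<^sub>0 int)" where
  "pair_mult f g = (\<Sum>p\<in>Poly_Mapping.keys f. \<Sum>q\<in>Poly_Mapping.keys g.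
     Poly_Mapping.single (fst p * fst q, snd p * snd q)
       (Poly_Mapping.lookup f p * Poly_Mapping.lookup g q))"

definition UK :: "('g::complex_lie_algebra, 'i) chevalley_data \<Rightarrow> ('g, 'k::comm_ring_1) hyp ring" where
  "UK D = \<lparr>carrier = {f. Poly_Mapping.keys f \<subseteq> UZ D \<times> UNIV}, monoid.mult = pair_mult,
       one = Poly_Mapping.single (1, 1) 1, ring.zero = 0, add = (+)\<rparr>
     Quot bilinear_relations (UZ_module D) Z_module"

definition UK_class ::
    "('g::complex_lie_algebra, 'i) chevalley_data \<Rightarrow> ('g loop uea \<times> 'k::comm_ring_1 \<Rightarrow>\<^sub>0 int) \<Rightarrow> ('g, 'k) hyp" where
  "UK_class D = tensor2_class (UZ_module D) Z_module"

definition UK_of :: "('g::complex_lie_algebra, 'i) chevalley_data \<Rightarrow> 'g loop uea \<Rightarrow> ('g, 'k::comm_ring_1) hyp" where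
  "UK_of D u = UK_class D (Poly_Mapping.single (u, 1) 1)"

definition UK_scalar :: "('g::complex_lie_algebra, 'i) chevalley_data \<Rightarrow> 'k::comm_ring_1 \<Rightarrow> ('g, 'k) hyp" where
  "UK_scalar D c = UK_class D (Poly_Mapping.single (1, c) 1)"

definition UK_map ::
    "('g::complex_lie_algebra, 'i) chevalley_data \<Rightarrow> ('k::comm_ring_1 \<Rightarrow> 'l::comm_ring_1) \<Rightarrow>
     ('g, 'k) hyp \<Rightarrow> ('g, 'l) hyp" where
  "UK_map D \<phi> A = (\<Union>f\<in>A. UK_class D (\<Sum>p\<in>Poly_Mapping.keys f.
     Poly_Mapping.single (fst p, \<phi> (snd p)) (Poly_Mapping.lookup f p)))"

definition scalars :: "('g::complex_lie_algebra, 'i) chevalley_data \<Rightarrow>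
    (('g, 'k::comm_ring_1) hyp, 'm) module \<Rightarrow> ('k, 'm) module" where
  "scalars D M = restrict_scalars (UK_scalar D) M"

text \<open>\<open>T\<close> is the tensor product over \<open>'k\<close> of the \<open>U\<^sub>K\<close>-modules \<open>Ms 0, \<dots>, Ms (k - 1)\<close>, acted upon
  through the comultiplication.  As divided powers of the root vectors generate \<open>U\<^sub>K\<close> as a
  \<open>'k\<close>-algebra, their iterated comultiplication determines the action.\<close>

definition is_tensor_module ::
    "('g::complex_lie_algebra, 'i) chevalley_data \<Rightarrow> nat \<Rightarrow>
     (nat \<Rightarrow> (('g, 'k::comm_ring_1) hyp, 'm) module) \<Rightarrow>
     (('g, 'k) hyp, ((nat \<Rightarrow> 'm) \<Rightarrow>\<^sub>0 'k) set) module \<Rightarrow> bool" where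
  "is_tensor_module D k Ms T \<longleftrightarrow>
     (let V = tensor k (\<lambda>j. scalars D (Ms j)); pt = pure_tensor k (\<lambda>j. scalars D (Ms j)) in
       lmodule (UK D) T \<and> carrier T = carrier V \<and> zero T = zero V \<and> add T = add V \<and>
       (\<forall>c. \<forall>t\<in>carrier T. UK_scalar D c \<odot>\<^bsub>T\<^esub> t = c \<odot>\<^bsub>V\<^esub> t) \<and>
       (\<forall>\<beta>\<in>roots (cartan D). \<forall>r n. \<forall>w\<in>tuples k Ms.
         UK_of D (divpow D \<beta> r n) \<odot>\<^bsub>T\<^esub> pt w =
           (\<Oplus>\<^bsub>T\<^esub> l \<in> {l \<in> {..<k} \<rightarrow>\<^sub>E UNIV. (\<Sum>j<k. l j) = n}.
             pt (\<lambda>j. UK_of D (divpow D \<beta> r (l j)) \<odot>\<^bsub>Ms j\<^esub> w j))))"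

text \<open>For \<open>\<phi> : A \<rightarrow> F\<close> and a \<open>U\<^sub>A\<close>-module \<open>L\<close>, the \<open>U\<^sub>F\<close>-module \<open>L \<otimes>\<^sub>A F\<close>, in which
  \<open>(u \<otimes> c) (x \<otimes> d) = u x \<otimes> c d\<close>.\<close>

definition base_change ::
    "('g::complex_lie_algebra, 'i) chevalley_data \<Rightarrow> ('a::comm_ring_1 \<Rightarrow> 'f::comm_ring_1) \<Rightarrow>
     (('g, 'a) hyp, 'm) module \<Rightarrow> (('g, 'f) hyp, (('m \<times> 'f) \<Rightarrow>\<^sub>0 'a) set) module" where
  "base_change D \<phi> L = (let F = module_via \<phi> UNIV; V = tensor2 (scalars D L) F in
     \<lparr>carrier = carrier V, monoid.mult = undefined, one = undefined, ring.zero = zero V,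
      add = add V,
      module.smult = (\<lambda>A B. \<Union>f\<in>A. \<Union>g\<in>B. tensor2_class (scalars D L) F
        (\<Sum>p\<in>Poly_Mapping.keys f. \<Sum>q\<in>Poly_Mapping.keys g.
          Poly_Mapping.single (UK_of D (fst p) \<odot>\<^bsub>L\<^esub> fst q, snd p * snd q)
            (of_int (Poly_Mapping.lookup f p) * Poly_Mapping.lookup g q)))\<rparr>)"


section \<open>Weyl modules\<close>

definition P_plus :: "('i \<Rightarrow> 'k::comm_ring_1 poly) set" where
  "P_plus = {\<omega>. \<forall>i. Polynomial.coeff (\<omega> i) 0 = 1}"

definition P_plus_plus :: "('i \<Rightarrow> 'k::comm_ring_1 poly) set" where
  "P_plus_plus = {\<omega> \<in> P_plus. \<forall>i. lead_coeff (\<omega> i) dvd 1}"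

text \<open>\<open>f\<^sup>-\<close>, for \<open>f\<close> a product of factors \<open>1 - a u\<close> with \<open>a \<noteq> 0\<close>.\<close>

definition poly_minus :: "'k::field poly \<Rightarrow> 'k poly" where
  "poly_minus f = (THE g. \<exists>as. 0 \<notin> set as \<and> f = (\<Prod>a\<leftarrow>as. [:1, - a:]) \<and>
     g = (\<Prod>a\<leftarrow>as. [:1, - inverse a:]))"

definition wt :: "('g::complex_lie_algebra, 'i) chevalley_data \<Rightarrow> ('i \<Rightarrow> 'k::comm_ring_1 poly) \<Rightarrow> 'g \<Rightarrow> complex" where
  "wt D \<omega> = (THE \<mu>. \<mu> \<in> dual_space (cartan D) \<and>
     (\<forall>i. \<mu> (simple_coroot D i) = of_nat (Polynomial.degree (\<omega> i))))"

text \<open>The values of dominant weights on coroots are natural numbers, read off by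
  \<open>nat \<lfloor>Re _\<rfloor>\<close> and compared by means of \<open>Re\<close>.\<close>

definition omega_weight ::
    "('g::complex_lie_algebra, 'i) chevalley_data \<Rightarrow> ('g \<Rightarrow> complex) \<Rightarrow> 'k::comm_ring_1 \<Rightarrow> 'i \<Rightarrow> 'k poly" where
  "omega_weight D \<mu> a i = [:1, - a:] ^ nat \<lfloor>Re (\<mu> (simple_coroot D i))\<rfloor>"

definition weyl_relations ::
    "('g::complex_lie_algebra, 'i::finite) chevalley_data \<Rightarrow> ('i \<Rightarrow> 'k::field poly) \<Rightarrow> ('g, 'k) hyp set" where
  "weyl_relations D \<omega> =
     {UK_of D (divpow D \<alpha> r k) |\<alpha> r k. \<alpha> \<in> positive_roots D \<and> k > 0} \<union>
     {UK_of D (uea_binom (uloop (simple_coroot D i) 0) k)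
        \<ominus>\<^bsub>UK D\<^esub> UK_scalar D (of_nat (Polynomial.degree (\<omega> i) choose k)) |i k. True} \<union>
     {UK_of D (big_lambda D i 1 s) \<ominus>\<^bsub>UK D\<^esub> UK_scalar D (Polynomial.coeff (\<omega> i) s) |i s. True} \<union>
     {UK_of D (big_lambda D i (- 1) s)
        \<ominus>\<^bsub>UK D\<^esub> UK_scalar D (Polynomial.coeff (poly_minus (\<omega> i)) s) |i s. True} \<union>
     {UK_of D (divpow D (neg_root \<alpha>) r l) |\<alpha> r l.
        \<alpha> \<in> positive_roots D \<and> real l > Re (wt D \<omega> (coroot D \<alpha>))}"

definition weyl_ideal ::
    "('g::complex_lie_algebra, 'i::finite) chevalley_data \<Rightarrow> ('i \<Rightarrow> 'k::field poly) \<Rightarrow> ('g, 'k) hyp set" where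
  "weyl_ideal D \<omega> = submodule_generated (UK D) (regular_module (UK D)) (weyl_relations D \<omega>)"

definition weyl ::
    "('g::complex_lie_algebra, 'i::finite) chevalley_data \<Rightarrow> ('i \<Rightarrow> 'k::field poly) \<Rightarrow>
     (('g, 'k) hyp, ('g, 'k) hyp set) module" where
  "weyl D \<omega> = quotient_module (regular_module (UK D)) (weyl_ideal D \<omega>)"

text \<open>The \<open>\<ell>\<close>-highest-weight generators: nonzero multiples of the class of \<open>1\<close>.\<close>

definition weyl_generators ::
    "('g::complex_lie_algebra, 'i::finite) chevalley_data \<Rightarrow> ('i \<Rightarrow> 'k::field poly) \<Rightarrow> ('g, 'k) hyp set set" where
  "weyl_generators D \<omega> = {UK_scalar D c \<odot>\<^bsub>weyl D \<omega>\<^esub>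
     (weyl_ideal D \<omega> +>\<^bsub>regular_module (UK D)\<^esub> \<one>\<^bsub>UK D\<^esub>) |c. c \<noteq> 0}"


section \<open>Discrete valuation rings\<close>

definition is_dvr :: "'a::idom itself \<Rightarrow> bool" where
  "is_dvr _ \<longleftrightarrow> (\<exists>\<nu> :: 'a fract \<Rightarrow> int.
     (\<forall>x y. x \<noteq> 0 \<and> y \<noteq> 0 \<longrightarrow> \<nu> (x * y) = \<nu> x + \<nu> y) \<and>
     (\<forall>x y. x \<noteq> 0 \<and> y \<noteq> 0 \<and> x + y \<noteq> 0 \<longrightarrow> \<nu> (x + y) \<ge> min (\<nu> x) (\<nu> y)) \<and>
     \<nu> ` (UNIV - {0}) = UNIV \<and>
     range (\<lambda>a. Fract a 1) = {x. x = 0 \<or> \<nu> x \<ge> 0})"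

text \<open>The nonunits form the maximal ideal.\<close>

definition is_residue_map :: "('a::idom \<Rightarrow> 'f::field) \<Rightarrow> bool" where
  "is_residue_map \<rho> \<longleftrightarrow> (\<forall>a b. \<rho> (a + b) = \<rho> a + \<rho> b) \<and> (\<forall>a b. \<rho> (a * b) = \<rho> a * \<rho> b) \<and>
     \<rho> 1 = 1 \<and> surj \<rho> \<and> (\<forall>a. \<rho> a = 0 \<longleftrightarrow> \<not> a dvd 1)"

definition emb :: "'a::idom \<Rightarrow> 'a fract alg_closure" where
  "emb a = to_ac (Fract a 1)"

definition integral_lattice ::
    "('g::complex_lie_algebra, 'i) chevalley_data \<Rightarrow> (('g, 'a::idom fract alg_closure) hyp, 'm) module \<Rightarrow>
     'm \<Rightarrow> (('g, 'a) hyp, 'm) module" where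
  "integral_lattice D M v = cyclic_submodule (UK D) (restrict_scalars (UK_map D emb) M) v"

text \<open>The canonical map from the tensor product over \<open>'a\<close> of \<open>'a\<close>-submodules of the \<open>Ms j\<close> to the
  tensor product of the \<open>Ms j\<close> over the field.\<close>

definition lattice_tensor_map ::
    "nat \<Rightarrow> (nat \<Rightarrow> ('a::idom fract alg_closure, 'm) module) \<Rightarrow>
     ((nat \<Rightarrow> 'm) \<Rightarrow>\<^sub>0 'a) set \<Rightarrow> ((nat \<Rightarrow> 'm) \<Rightarrow>\<^sub>0 'a fract alg_closure) set" where
  "lattice_tensor_map k Ms A = (\<Union>f\<in>A. tensor_class k Ms (Poly_Mapping.map emb f))"

end

theory Submission
  imports Defs
begin

text \<open>For lifts \<open>a\<^sub>j\<close> of the \<open>b\<^sub>j\<close> to \<open>A\<close>, let \<open>L\<^sub>j\<close> be the lattice over \<open>A\<close> that is spanned by a generator \<open>v\<^sub>j\<close> of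
  the Weyl module \<open>W\<^sup>0\<^sub>j\<close> of weight \<open>\<lambda>\<^sub>j\<close> at \<open>a\<^sub>j\<close>, and let \<open>M\<close> be the lattice spanned by the generator corresponding
  to \<open>v\<^sub>1 \<otimes> \<dots> \<otimes> v\<^sub>k\<close> in the Weyl module of the product.  By (C1), the Weyl modules over \<open>F\<close> of the
  factors and of the product are \<open>L\<^sub>j \<otimes> F\<close> and \<open>M \<otimes> F\<close>, and by (C2), \<open>M\<close> is \<open>L\<^sub>1 \<otimes> \<dots> \<otimes> L\<^sub>k\<close>.  Tensor
  products commute with \<open>- \<otimes> F\<close>, so the Weyl module of the product is the tensor product of the
  Weyl modules of its factors, first of all as a vector space over \<open>F\<close>.

  Since the residue map \<open>\<rho>\<close> is onto, \<open>L \<otimes> F\<close> is \<open>L\<close> modulo \<open>(ker \<rho>) L\<close>, and its elements are all of the form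
  \<open>x \<otimes> 1\<close>.  The argument is therefore carried out with \<^emph>\<open>reductions\<close>: semilinear surjections
  \<open>\<pi> : L \<rightarrow> W\<close> with kernel \<open>(ker \<rho>) L\<close>.  Lemma \<open>base_change_iso_reduction\<close> obtains them from (C1), and
  \<open>tensor_reduction_iso\<close> compares the two reductions of \<open>L\<^sub>1 \<otimes> \<dots> \<otimes> L\<^sub>k \<cong> M\<close>.

  The action of \<open>U\<^sub>F\<close> on the tensor product of the Weyl modules is transported from the Weyl module of
  the product.  It is the right one because it is so on divided powers of root vectors: these act by
  the comultiplication formula on the tensor product over \<open>F\<^sup>0\<close>, hence on the lattice
  (\<open>lattice_tensor_divpow\<close>), hence on its reduction (\<open>tensor_reduction\<close>).

  For quotients \<open>Q\<^sub>j\<close> of the factors, the same formula defines operators on \<open>Q\<^sub>1 \<otimes> \<dots> \<otimes> Q\<^sub>k\<close> by the universal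
  property.  The kernel of the map between the two tensor products is thus stable under the
  divided powers, which together with the scalars generate \<open>U\<^sub>F\<close>, and the action passes to
  the quotient (\<open>tensor_module_quotient\<close>).\<close>

section \<open>Left modules, submodules and quotients\<close>

lemma (in abelian_group) minus_eq_zero_iff:
  assumes "x \<in> carrier G" "y \<in> carrier G"
  shows "x \<ominus> y = \<zero> \<longleftrightarrow> x = y"
  using assms minus_equality[of x "\<ominus> y"] by (auto simp: a_minus_def r_neg)

context lmodule
begin

lemma smult_zero_left: "x \<in> carrier M \<Longrightarrow> \<zero> \<odot>\<^bsub>M\<^esub> x = \<zero>\<^bsub>M\<^esub>"
  using smult_l_distr[of \<zero> \<zero> x] smult_closed[of \<zero> x] M.add.r_cancel_one'[of "\<zero> \<odot>\<^bsub>M\<^esub> x" "\<zero> \<odot>\<^bsub>M\<^esub> x"] by simp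

lemma smult_zero_right: "a \<in> carrier R \<Longrightarrow> a \<odot>\<^bsub>M\<^esub> \<zero>\<^bsub>M\<^esub> = \<zero>\<^bsub>M\<^esub>"
  using smult_r_distr[of a "\<zero>\<^bsub>M\<^esub>" "\<zero>\<^bsub>M\<^esub>"] smult_closed[of a "\<zero>\<^bsub>M\<^esub>"]
    M.add.r_cancel_one'[of "a \<odot>\<^bsub>M\<^esub> \<zero>\<^bsub>M\<^esub>" "a \<odot>\<^bsub>M\<^esub> \<zero>\<^bsub>M\<^esub>"] by simp

lemma smult_minus_right:
  assumes "a \<in> carrier R" "x \<in> carrier M"
  shows "a \<odot>\<^bsub>M\<^esub> (\<ominus>\<^bsub>M\<^esub> x) = \<ominus>\<^bsub>M\<^esub> (a \<odot>\<^bsub>M\<^esub> x)"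
proof -
  have "a \<odot>\<^bsub>M\<^esub> (\<ominus>\<^bsub>M\<^esub> x) \<oplus>\<^bsub>M\<^esub> a \<odot>\<^bsub>M\<^esub> x = \<zero>\<^bsub>M\<^esub>"
    using assms smult_r_distr[of a "\<ominus>\<^bsub>M\<^esub> x" x] by (simp add: M.l_neg smult_zero_right)
  then show ?thesis using assms by (intro M.minus_equality[symmetric]) (auto simp: smult_closed)
qed

lemma smult_uminus_one: "x \<in> carrier M \<Longrightarrow> (\<ominus> \<one>) \<odot>\<^bsub>M\<^esub> x = \<ominus>\<^bsub>M\<^esub> x"
proof -
  assume x: "x \<in> carrier M"
  have "(\<ominus> \<one>) \<odot>\<^bsub>M\<^esub> x \<oplus>\<^bsub>M\<^esub> x = \<zero>\<^bsub>M\<^esub>"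
    using x smult_l_distr[of "\<ominus> \<one>" \<one> x] by (simp add: R.l_neg smult_zero_left smult_one)
  then show ?thesis using x by (intro M.minus_equality[symmetric]) (auto simp: smult_closed)
qed

lemma submoduleI:
  assumes "N \<subseteq> carrier M" "\<zero>\<^bsub>M\<^esub> \<in> N" "\<And>x y. x \<in> N \<Longrightarrow> y \<in> N \<Longrightarrow> x \<oplus>\<^bsub>M\<^esub> y \<in> N"
    "\<And>a x. a \<in> carrier R \<Longrightarrow> x \<in> N \<Longrightarrow> a \<odot>\<^bsub>M\<^esub> x \<in> N"
  shows "submodule N R M"
proof (intro submodule.intro submodule_axioms.intro subgroup.intro)
  fix x assume x: "x \<in> N"
  then have "(\<ominus> \<one>) \<odot>\<^bsub>M\<^esub> x \<in> N" using assms by simp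
  then show "inv\<^bsub>add_monoid M\<^esub> x \<in> N"
    using x assms(1) smult_uminus_one by (auto simp flip: a_inv_def)
qed (use assms in auto)

lemma submodule_imp_abelian_subgroup: "submodule N R M \<Longrightarrow> abelian_subgroup N M"
  by (intro abelian_subgroupI3 additive_subgroup.intro submodule.axioms(1) M.abelian_group_axioms)

end

lemma submodule_generated_submodule:
  assumes "lmodule R M"
  shows "submodule (submodule_generated R M G) R M"
proof -
  interpret lmodule R M by fact
  show ?thesis
  proof (rule submoduleI)
    have top: "submodule (carrier M) R M" by (rule submoduleI) (auto simp: smult_closed)
    then show "submodule_generated R M G \<subseteq> carrier M"
      by (auto simp: submodule_generated_def)
    have z: "\<zero>\<^bsub>M\<^esub> \<in> N" if "submodule N R M" for N
      using subgroup.one_closed[OF submodule.axioms(1)[OF that]] by simp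
    have p: "x \<oplus>\<^bsub>M\<^esub> y \<in> N" if "submodule N R M" "x \<in> N" "y \<in> N" for N x y
      using subgroup.m_closed[OF submodule.axioms(1)[OF that(1)] that(2,3)] by simp
    show "\<zero>\<^bsub>M\<^esub> \<in> submodule_generated R M G" by (auto simp: submodule_generated_def z)
    show "x \<oplus>\<^bsub>M\<^esub> y \<in> submodule_generated R M G"
      if "x \<in> submodule_generated R M G" "y \<in> submodule_generated R M G" for x y
      using that by (auto simp: submodule_generated_def p)
    show "a \<odot>\<^bsub>M\<^esub> x \<in> submodule_generated R M G"
      if "a \<in> carrier R" "x \<in> submodule_generated R M G" for a x
      using that by (auto simp: submodule_generated_def submodule.smult_closed)
  qed
qed

lemma submodule_generated_least:
  "submodule N R M \<Longrightarrow> G \<inter> carrier M \<subseteq> N \<Longrightarrow> submodule_generated R M G \<subseteq> N"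
  by (auto simp: submodule_generated_def)

lemma submodule_generated_base: "x \<in> G \<Longrightarrow> x \<in> carrier M \<Longrightarrow> x \<in> submodule_generated R M G"
  by (auto simp: submodule_generated_def)

lemma submodule_subset: "submodule N R M \<Longrightarrow> N \<subseteq> carrier M"
  using subgroup.subset[OF submodule.axioms(1)] by fastforce

lemma submodule_zero: "submodule N R M \<Longrightarrow> \<zero>\<^bsub>M\<^esub> \<in> N"
  using subgroup.one_closed[OF submodule.axioms(1)] by fastforce

lemma submodule_add: "submodule N R M \<Longrightarrow> x \<in> N \<Longrightarrow> y \<in> N \<Longrightarrow> x \<oplus>\<^bsub>M\<^esub> y \<in> N"
  using subgroup.m_closed[OF submodule.axioms(1)] by fastforce

lemma submodule_smult: "submodule N R M \<Longrightarrow> a \<in> carrier R \<Longrightarrow> x \<in> N \<Longrightarrow> a \<odot>\<^bsub>M\<^esub> x \<in> N"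
  by (rule submodule.smult_closed)

lemma lmod_homI:
  assumes "\<And>x. x \<in> carrier M \<Longrightarrow> \<phi> x \<in> carrier N"
    "\<And>x y. x \<in> carrier M \<Longrightarrow> y \<in> carrier M \<Longrightarrow> \<phi> (x \<oplus>\<^bsub>M\<^esub> y) = \<phi> x \<oplus>\<^bsub>N\<^esub> \<phi> y"
    "\<And>a x. a \<in> carrier R \<Longrightarrow> x \<in> carrier M \<Longrightarrow> \<phi> (a \<odot>\<^bsub>M\<^esub> x) = a \<odot>\<^bsub>N\<^esub> \<phi> x"
  shows "\<phi> \<in> lmod_hom R M N"
  using assms by (auto simp: lmod_hom_def)

lemma lmod_homD:
  assumes "\<phi> \<in> lmod_hom R M N"
  shows "x \<in> carrier M \<Longrightarrow> \<phi> x \<in> carrier N"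
    "x \<in> carrier M \<Longrightarrow> y \<in> carrier M \<Longrightarrow> \<phi> (x \<oplus>\<^bsub>M\<^esub> y) = \<phi> x \<oplus>\<^bsub>N\<^esub> \<phi> y"
    "a \<in> carrier R \<Longrightarrow> x \<in> carrier M \<Longrightarrow> \<phi> (a \<odot>\<^bsub>M\<^esub> x) = a \<odot>\<^bsub>N\<^esub> \<phi> x"
  using assms by (auto simp: lmod_hom_def)

lemma lmod_hom_comp:
  assumes "\<phi> \<in> lmod_hom R M N" "\<psi> \<in> lmod_hom R N P"
  shows "(\<lambda>x. \<psi> (\<phi> x)) \<in> lmod_hom R M P"
  by (rule lmod_homI) (simp_all add: lmod_homD[OF assms(1)] lmod_homD[OF assms(2)])

lemma lmod_hom_cong:
  assumes "lmodule R M" "\<phi> \<in> lmod_hom R M N" "\<And>x. x \<in> carrier M \<Longrightarrow> \<phi> x = \<psi> x"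
  shows "\<psi> \<in> lmod_hom R M N"
proof -
  interpret lmodule R M by fact
  show ?thesis
    by (rule lmod_homI)
      (metis assms(2,3) lmod_homD smult_closed M.add.m_closed)+
qed

lemma lmod_hom_zero:
  assumes "lmodule R M" "lmodule R N" "\<phi> \<in> lmod_hom R M N"
  shows "\<phi> \<zero>\<^bsub>M\<^esub> = \<zero>\<^bsub>N\<^esub>"
proof -
  interpret M: lmodule R M by fact
  interpret N: lmodule R N by fact
  have "\<phi> \<zero>\<^bsub>M\<^esub> \<oplus>\<^bsub>N\<^esub> \<phi> \<zero>\<^bsub>M\<^esub> = \<phi> \<zero>\<^bsub>M\<^esub>" "\<phi> \<zero>\<^bsub>M\<^esub> \<in> carrier N"
    using lmod_homD[OF assms(3)] by (metis M.zero_closed M.l_zero, simp)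
  then show ?thesis using N.add.r_cancel_one'[of "\<phi> \<zero>\<^bsub>M\<^esub>" "\<phi> \<zero>\<^bsub>M\<^esub>"] by simp
qed

lemma lmod_hom_uminus:
  assumes "lmodule R M" "lmodule R N" "\<phi> \<in> lmod_hom R M N" "x \<in> carrier M"
  shows "\<phi> (\<ominus>\<^bsub>M\<^esub> x) = \<ominus>\<^bsub>N\<^esub> \<phi> x"
proof -
  interpret M: lmodule R M by fact
  interpret N: lmodule R N by fact
  have "\<phi> (\<ominus>\<^bsub>M\<^esub> x) \<oplus>\<^bsub>N\<^esub> \<phi> x = \<zero>\<^bsub>N\<^esub>"
    using lmod_homD(2)[OF assms(3), of "\<ominus>\<^bsub>M\<^esub> x" x] assms(4) lmod_hom_zero[OF assms(1-3)]
    by (simp add: M.l_neg)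
  then show ?thesis
    using lmod_homD(1)[OF assms(3)] assms(4) by (intro N.minus_equality[symmetric]) auto
qed

lemma lmod_hom_diff:
  assumes "lmodule R M" "lmodule R N" "\<phi> \<in> lmod_hom R M N" "x \<in> carrier M" "y \<in> carrier M"
  shows "\<phi> (x \<ominus>\<^bsub>M\<^esub> y) = \<phi> x \<ominus>\<^bsub>N\<^esub> \<phi> y"
proof -
  interpret M: lmodule R M by fact
  show ?thesis
    using lmod_hom_uminus[OF assms(1-3,5)] lmod_homD(2)[OF assms(3), of x "\<ominus>\<^bsub>M\<^esub> y"] assms(4,5)
    by (simp add: a_minus_def)
qed

lemma lmod_hom_kernel_submodule:
  assumes "lmodule R M" "lmodule R N" "\<phi> \<in> lmod_hom R M N"
  shows "submodule {x \<in> carrier M. \<phi> x = \<zero>\<^bsub>N\<^esub>} R M"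
proof -
  interpret M: lmodule R M by fact
  interpret N: lmodule R N by fact
  show ?thesis
    by (rule M.submoduleI)
      (auto simp: lmod_homD[OF assms(3)] lmod_hom_zero[OF assms] M.smult_closed N.smult_zero_right)
qed

text \<open>The kernel is a submodule, so it is enough to look at the generators.  All maps out of a module
  given by relations are constructed with this lemma.\<close>

lemma lmod_hom_kills_generated:
  assumes "lmodule R M" "lmodule R N" "\<phi> \<in> lmod_hom R M N"
    and "\<And>x. x \<in> G \<Longrightarrow> x \<in> carrier M \<Longrightarrow> \<phi> x = \<zero>\<^bsub>N\<^esub>" and "x \<in> submodule_generated R M G"
  shows "\<phi> x = \<zero>\<^bsub>N\<^esub>"
  using submodule_generated_least[OF lmod_hom_kernel_submodule[OF assms(1-3)], of G] assms(4,5) by auto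

lemma lmod_hom_finsum:
  assumes "lmodule R M" "lmodule R N" "\<phi> \<in> lmod_hom R M N" "finite A" "f \<in> A \<rightarrow> carrier M"
  shows "\<phi> (\<Oplus>\<^bsub>M\<^esub>x\<in>A. f x) = (\<Oplus>\<^bsub>N\<^esub>x\<in>A. \<phi> (f x))"
proof -
  interpret M: lmodule R M by fact
  interpret N: lmodule R N by fact
  show ?thesis using assms(4,5)
  proof (induction A)
    case (insert a A)
    then have "(\<Oplus>\<^bsub>M\<^esub>x\<in>A. f x) \<in> carrier M" by (intro M.finsum_closed) auto
    with insert show ?case
      by (subst M.finsum_insert, simp, simp, simp, simp, subst N.finsum_insert)
        (auto simp: Pi_iff lmod_homD[OF assms(3)])
  qed (simp add: lmod_hom_zero[OF assms(1-3)])
qed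

lemma coset_eq_iff:
  assumes "lmodule R M" "submodule N R M" "x \<in> carrier M" "y \<in> carrier M"
  shows "N +>\<^bsub>M\<^esub> x = N +>\<^bsub>M\<^esub> y \<longleftrightarrow> x \<ominus>\<^bsub>M\<^esub> y \<in> N"
proof -
  interpret lmodule R M by fact
  interpret N: abelian_subgroup N M using assms(2) by (rule submodule_imp_abelian_subgroup)
  have "N +>\<^bsub>M\<^esub> x = N +>\<^bsub>M\<^esub> y \<longleftrightarrow> x \<in> N +>\<^bsub>M\<^esub> y"
    using N.a_repr_independence' N.a_rcos_self assms(3,4) by blast
  also have "\<dots> \<longleftrightarrow> x \<ominus>\<^bsub>M\<^esub> y \<in> N"
    using assms(3,4) by (simp add: N.a_rcos_module a_minus_def)
  finally show ?thesis .
qed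

lemma coset_zero_iff:
  assumes "lmodule R M" "submodule N R M" "x \<in> carrier M"
  shows "N +>\<^bsub>M\<^esub> x = N \<longleftrightarrow> x \<in> N"
proof -
  interpret lmodule R M by fact
  interpret N: abelian_subgroup N M using assms(2) by (rule submodule_imp_abelian_subgroup)
  show ?thesis using assms(3) N.a_rcos_self N.a_rcos_const by metis
qed

lemma coset_member:
  assumes "lmodule R M" "submodule N R M" "x \<in> carrier M"
  shows "x \<in> N +>\<^bsub>M\<^esub> x"
    and "y \<in> N +>\<^bsub>M\<^esub> x \<Longrightarrow> y \<in> carrier M"
    and "y \<in> N +>\<^bsub>M\<^esub> x \<Longrightarrow> N +>\<^bsub>M\<^esub> y = N +>\<^bsub>M\<^esub> x"
proof -
  interpret lmodule R M by fact
  interpret N: abelian_subgroup N M using assms(2) by (rule submodule_imp_abelian_subgroup)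
  show "x \<in> N +>\<^bsub>M\<^esub> x" by (rule N.a_rcos_self[OF assms(3)])
  show "y \<in> carrier M" "N +>\<^bsub>M\<^esub> y = N +>\<^bsub>M\<^esub> x" if "y \<in> N +>\<^bsub>M\<^esub> x"
    using that assms(3) N.a_elemrcos_carrier N.a_repr_independence' by blast+
qed

lemma lmod_hom_constant_on_coset:
  assumes M: "lmodule R M" and N: "submodule N R M" and P: "lmodule R P" and g: "g \<in> lmod_hom R M P"
    and kills: "\<And>x. x \<in> N \<Longrightarrow> g x = \<zero>\<^bsub>P\<^esub>" and x: "x \<in> carrier M" and y: "y \<in> N +>\<^bsub>M\<^esub> x"
  shows "g y = g x"
proof -
  interpret P: lmodule R P by fact
  note y = coset_member(2,3)[OF M N x y]
  have "g (y \<ominus>\<^bsub>M\<^esub> x) = \<zero>\<^bsub>P\<^esub>" using kills y coset_eq_iff[OF M N y(1) x] by simp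
  then have "g y \<ominus>\<^bsub>P\<^esub> g x = \<zero>\<^bsub>P\<^esub>" using lmod_hom_diff[OF M P g y(1) x] by simp
  then show ?thesis using x y lmod_homD(1)[OF g] by (simp add: P.minus_eq_zero_iff)
qed

lemma quotient_carrier: "carrier (quotient_module M N) = (\<lambda>x. N +>\<^bsub>M\<^esub> x) ` carrier M"
  by (auto simp: quotient_module_def A_RCOSETS_def RCOSETS_def a_r_coset_def)

lemma quotient_zero: "\<zero>\<^bsub>quotient_module M N\<^esub> = N"
  by (simp add: quotient_module_def)

lemma quotient_add:
  assumes "lmodule R M" "submodule N R M" "x \<in> carrier M" "y \<in> carrier M"
  shows "(N +>\<^bsub>M\<^esub> x) \<oplus>\<^bsub>quotient_module M N\<^esub> (N +>\<^bsub>M\<^esub> y) = N +>\<^bsub>M\<^esub> (x \<oplus>\<^bsub>M\<^esub> y)"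
proof -
  interpret lmodule R M by fact
  interpret N: abelian_subgroup N M using assms(2) by (rule submodule_imp_abelian_subgroup)
  show ?thesis using assms(3,4) by (simp add: quotient_module_def N.a_rcos_sum)
qed

lemma quotient_smult:
  assumes "lmodule R M" "submodule N R M" "a \<in> carrier R" "x \<in> carrier M"
  shows "a \<odot>\<^bsub>quotient_module M N\<^esub> (N +>\<^bsub>M\<^esub> x) = N +>\<^bsub>M\<^esub> (a \<odot>\<^bsub>M\<^esub> x)"
proof -
  interpret lmodule R M by fact
  interpret N: abelian_subgroup N M using assms(2) by (rule submodule_imp_abelian_subgroup)
  have "N +>\<^bsub>M\<^esub> (a \<odot>\<^bsub>M\<^esub> y) = N +>\<^bsub>M\<^esub> (a \<odot>\<^bsub>M\<^esub> x)" if "y \<in> N +>\<^bsub>M\<^esub> x" for y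
  proof -
    have y: "y \<in> carrier M" using that assms(4) N.a_elemrcos_carrier by blast
    have "y \<ominus>\<^bsub>M\<^esub> x \<in> N" using that y assms(4) N.a_rcos_module[of x y] by (simp add: a_minus_def)
    then have "a \<odot>\<^bsub>M\<^esub> (y \<ominus>\<^bsub>M\<^esub> x) \<in> N" using assms(2,3) by (intro submodule_smult)
    then have "a \<odot>\<^bsub>M\<^esub> y \<ominus>\<^bsub>M\<^esub> a \<odot>\<^bsub>M\<^esub> x \<in> N"
      using y assms(3,4) by (simp add: a_minus_def smult_r_distr smult_minus_right)
    then show ?thesis
      using coset_eq_iff[OF assms(1,2)] y assms(3,4) by (simp add: smult_closed)
  qed
  moreover have "x \<in> N +>\<^bsub>M\<^esub> x" using N.a_rcos_self assms(4) .
  ultimately have "(\<Union>y\<in>N +>\<^bsub>M\<^esub> x. N +>\<^bsub>M\<^esub> (a \<odot>\<^bsub>M\<^esub> y)) = N +>\<^bsub>M\<^esub> (a \<odot>\<^bsub>M\<^esub> x)"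
    by (intro SUP_eq_const) blast+
  then show ?thesis by (simp add: quotient_module_def)
qed

lemma quotient_proj_hom:
  assumes "lmodule R M" "submodule N R M"
  shows "(\<lambda>x. N +>\<^bsub>M\<^esub> x) \<in> lmod_hom R M (quotient_module M N)"
  by (rule lmod_homI) (auto simp: quotient_carrier quotient_add[OF assms] quotient_smult[OF assms])

text \<open>The module laws are equations and therefore pass to every surjective image that respects the
  operations; quotients, cyclic submodules and transported structures are modules for this reason.\<close>

lemma lmodule_image:
  assumes "lmodule R M" "\<phi> \<in> lmod_hom R M N" "\<phi> ` carrier M = carrier N" "\<phi> \<zero>\<^bsub>M\<^esub> = \<zero>\<^bsub>N\<^esub>"
  shows "lmodule R N"
proof -
  interpret lmodule R M by fact
  note h = lmod_homD[OF assms(2)]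
  have ex: "\<exists>x\<in>carrier M. y = \<phi> x" if "y \<in> carrier N" for y using that assms(3) by blast
  have "abelian_group N"
  proof (rule abelian_groupI)
    fix x y assume "x \<in> carrier N" "y \<in> carrier N"
    then show "x \<oplus>\<^bsub>N\<^esub> y \<in> carrier N" "x \<oplus>\<^bsub>N\<^esub> y = y \<oplus>\<^bsub>N\<^esub> x"
      using ex h(1,2) by (metis M.add.m_closed, metis M.a_comm)
  next
    fix x y z assume "x \<in> carrier N" "y \<in> carrier N" "z \<in> carrier N"
    then obtain x' y' z' where "x' \<in> carrier M" "y' \<in> carrier M" "z' \<in> carrier M"
      "x = \<phi> x'" "y = \<phi> y'" "z = \<phi> z'" using ex by metis
    then show "x \<oplus>\<^bsub>N\<^esub> y \<oplus>\<^bsub>N\<^esub> z = x \<oplus>\<^bsub>N\<^esub> (y \<oplus>\<^bsub>N\<^esub> z)"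
      by (simp add: M.a_assoc flip: h(2))
  next
    fix x assume "x \<in> carrier N"
    then obtain x' where x': "x' \<in> carrier M" "x = \<phi> x'" using ex by metis
    then show "\<zero>\<^bsub>N\<^esub> \<oplus>\<^bsub>N\<^esub> x = x" by (simp flip: h(2) assms(4))
    have "\<phi> (\<ominus>\<^bsub>M\<^esub> x') \<oplus>\<^bsub>N\<^esub> x = \<zero>\<^bsub>N\<^esub>" using x' by (simp add: M.l_neg flip: h(2) assms(4))
    then show "\<exists>y\<in>carrier N. y \<oplus>\<^bsub>N\<^esub> x = \<zero>\<^bsub>N\<^esub>" using x' h(1) by blast
  qed (use h(1) assms(4) in force)
  then show ?thesis
  proof (intro lmodule.intro lmodule_axioms.intro R.ring_axioms)
    fix a b x y assume "a \<in> carrier R" "b \<in> carrier R" "x \<in> carrier N" "y \<in> carrier N"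
    then obtain x' y' where "a \<in> carrier R" "b \<in> carrier R" "x' \<in> carrier M" "y' \<in> carrier M"
      "x = \<phi> x'" "y = \<phi> y'" using ex by metis
    note * = this
    show "(a \<oplus>\<^bsub>R\<^esub> b) \<odot>\<^bsub>N\<^esub> x = a \<odot>\<^bsub>N\<^esub> x \<oplus>\<^bsub>N\<^esub> b \<odot>\<^bsub>N\<^esub> x"
      using * by (simp add: smult_l_distr smult_closed flip: h(2,3))
    show "a \<odot>\<^bsub>N\<^esub> (x \<oplus>\<^bsub>N\<^esub> y) = a \<odot>\<^bsub>N\<^esub> x \<oplus>\<^bsub>N\<^esub> a \<odot>\<^bsub>N\<^esub> y"
      using * by (simp add: smult_r_distr smult_closed flip: h(2,3))
    show "(a \<otimes>\<^bsub>R\<^esub> b) \<odot>\<^bsub>N\<^esub> x = a \<odot>\<^bsub>N\<^esub> (b \<odot>\<^bsub>N\<^esub> x)"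
      using * by (simp add: smult_assoc smult_closed flip: h(2,3))
    show "a \<odot>\<^bsub>N\<^esub> x \<in> carrier N" using * h(1,3) smult_closed by metis
  next
    fix x assume "x \<in> carrier N"
    then obtain x' where "x' \<in> carrier M" "x = \<phi> x'" using ex by metis
    then show "\<one>\<^bsub>R\<^esub> \<odot>\<^bsub>N\<^esub> x = x" by (simp add: smult_one flip: h(3))
  qed
qed

lemma quotient_lmodule:
  assumes "lmodule R M" "submodule N R M"
  shows "lmodule R (quotient_module M N)"
proof (rule lmodule_image[OF assms(1) quotient_proj_hom[OF assms]])
  interpret lmodule R M by fact
  show "N +>\<^bsub>M\<^esub> \<zero>\<^bsub>M\<^esub> = \<zero>\<^bsub>quotient_module M N\<^esub>"
    using coset_zero_iff[OF assms] submodule_zero[OF assms(2)] by (simp add: quotient_zero)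
qed (simp add: quotient_carrier)

text \<open>The first isomorphism theorem, for surjections other than the projection to a set of cosets.\<close>

lemma lmod_hom_factor:
  assumes M: "lmodule R M" and \<pi>: "\<pi> \<in> lmod_hom R M N" "\<pi> ` carrier M = carrier N"
    and g: "g \<in> lmod_hom R M P"
    and const: "\<And>x y. x \<in> carrier M \<Longrightarrow> y \<in> carrier M \<Longrightarrow> \<pi> x = \<pi> y \<Longrightarrow> g x = g y"
  shows "\<exists>g' \<in> lmod_hom R N P. \<forall>x\<in>carrier M. g' (\<pi> x) = g x"
proof -
  interpret lmodule R M by fact
  define g' where "g' y = g (inv_into (carrier M) \<pi> y)" for y
  have g': "g' (\<pi> x) = g x" if "x \<in> carrier M" for x
    unfolding g'_def using that by (intro const) (auto simp: inv_into_into f_inv_into_f)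
  have "g' \<in> lmod_hom R N P"
  proof (rule lmod_homI)
    fix x assume "x \<in> carrier N"
    then obtain x' where x': "x' \<in> carrier M" "x = \<pi> x'" using \<pi>(2) by blast
    then show "g' x \<in> carrier P" using g' lmod_homD(1)[OF g] by simp
    fix a assume "a \<in> carrier R"
    with x' have "g' (\<pi> (a \<odot>\<^bsub>M\<^esub> x')) = a \<odot>\<^bsub>P\<^esub> g' (\<pi> x')"
      by (simp add: g' lmod_homD(3)[OF g] smult_closed)
    then show "g' (a \<odot>\<^bsub>N\<^esub> x) = a \<odot>\<^bsub>P\<^esub> g' x"
      using x' \<open>a \<in> carrier R\<close> by (simp add: lmod_homD(3)[OF \<pi>(1)])
  next
    fix x y assume "x \<in> carrier N" "y \<in> carrier N"
    then obtain x' y' where *: "x' \<in> carrier M" "y' \<in> carrier M" "x = \<pi> x'" "y = \<pi> y'"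
      using \<pi>(2) by blast
    then have "g' (\<pi> (x' \<oplus>\<^bsub>M\<^esub> y')) = g' (\<pi> x') \<oplus>\<^bsub>P\<^esub> g' (\<pi> y')"
      by (simp add: g' lmod_homD(2)[OF g])
    then show "g' (x \<oplus>\<^bsub>N\<^esub> y) = g' x \<oplus>\<^bsub>P\<^esub> g' y" using * by (simp add: lmod_homD(2)[OF \<pi>(1)])
  qed
  with g' show ?thesis by blast
qed

lemma quotient_factor:
  assumes "lmodule R M" "submodule N R M" "lmodule R P" "g \<in> lmod_hom R M P"
    and "\<And>x. x \<in> N \<Longrightarrow> g x = \<zero>\<^bsub>P\<^esub>"
  shows "\<exists>g' \<in> lmod_hom R (quotient_module M N) P. \<forall>x\<in>carrier M. g' (N +>\<^bsub>M\<^esub> x) = g x"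
proof (rule lmod_hom_factor[OF assms(1) quotient_proj_hom[OF assms(1,2)] _ assms(4)])
  interpret P: lmodule R P by fact
  fix x y assume "x \<in> carrier M" "y \<in> carrier M" "N +>\<^bsub>M\<^esub> x = N +>\<^bsub>M\<^esub> y"
  then show "g x = g y"
    using coset_member(1)[OF assms(1,2)] by (intro lmod_hom_constant_on_coset[OF assms]) auto
qed (simp add: quotient_carrier)

text \<open>This puts module structures on tensor products of vector spaces: along a bijection for the
  tensor product of Weyl modules, along a map with stable kernel for that of their quotients.\<close>

lemma lmodule_transport:
  assumes M: "lmodule R M" and onto: "\<gamma> ` carrier M = carrier V"
    and add: "\<And>x y. x \<in> carrier M \<Longrightarrow> y \<in> carrier M \<Longrightarrow> \<gamma> (x \<oplus>\<^bsub>M\<^esub> y) = \<gamma> x \<oplus>\<^bsub>V\<^esub> \<gamma> y"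
    and at_zero: "\<gamma> \<zero>\<^bsub>M\<^esub> = \<zero>\<^bsub>V\<^esub>"
    and const: "\<And>a x y. a \<in> carrier R \<Longrightarrow> x \<in> carrier M \<Longrightarrow> y \<in> carrier M \<Longrightarrow> \<gamma> x = \<gamma> y
      \<Longrightarrow> \<gamma> (a \<odot>\<^bsub>M\<^esub> x) = \<gamma> (a \<odot>\<^bsub>M\<^esub> y)"
  shows "\<exists>T :: ('r, 'm) module. lmodule R T \<and> carrier T = carrier V \<and> zero T = zero V \<and> add T = add V \<and>
    \<gamma> \<in> lmod_hom R M T"
proof -
  interpret lmodule R M by fact
  define T :: "('r, 'm) module" where "T = \<lparr>carrier = carrier V, monoid.mult = undefined, one = undefined,
    ring.zero = zero V, add = add V, module.smult = (\<lambda>a y. \<gamma> (a \<odot>\<^bsub>M\<^esub> inv_into (carrier M) \<gamma> y))\<rparr>"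
  have hom: "\<gamma> \<in> lmod_hom R M T"
  proof (rule lmod_homI)
    fix x assume x: "x \<in> carrier M"
    then show "\<gamma> x \<in> carrier T" using onto by (auto simp: T_def)
    fix a assume "a \<in> carrier R"
    then have "\<gamma> (a \<odot>\<^bsub>M\<^esub> x) = \<gamma> (a \<odot>\<^bsub>M\<^esub> inv_into (carrier M) \<gamma> (\<gamma> x))"
      using x by (intro const) (auto simp: inv_into_into f_inv_into_f)
    then show "\<gamma> (a \<odot>\<^bsub>M\<^esub> x) = a \<odot>\<^bsub>T\<^esub> \<gamma> x" by (simp add: T_def)
  qed (simp add: T_def add)
  have T: "carrier T = carrier V" "zero T = zero V" "add T = add V" by (simp_all add: T_def)
  have "lmodule R T" by (rule lmodule_image[OF M hom]) (simp_all add: T onto at_zero)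
  with hom T show ?thesis by blast
qed

lemma restrict_scalars_simps [simp]:
  "carrier (restrict_scalars \<phi> M) = carrier M" "zero (restrict_scalars \<phi> M) = zero M"
  "add (restrict_scalars \<phi> M) = add M" "a \<odot>\<^bsub>restrict_scalars \<phi> M\<^esub> x = \<phi> a \<odot>\<^bsub>M\<^esub> x"
  by (simp_all add: restrict_scalars_def)

lemma abelian_group_cong:
  assumes "abelian_group M" "carrier N = carrier M" "zero N = zero M" "add N = add M"
  shows "abelian_group N"
proof -
  interpret abelian_group M by fact
  show ?thesis
    by (rule abelian_groupI) (auto simp: assms(2-4) intro: a_assoc a_comm intro!: add.l_inv_ex)
qed

lemma restrict_scalars_lmodule:
  assumes "lmodule R M" "ring S" "\<phi> \<in> ring_hom S R"
  shows "lmodule S (restrict_scalars \<phi> M)"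
proof -
  interpret lmodule R M by fact
  have "abelian_group (restrict_scalars \<phi> M)" by (rule abelian_group_cong[OF M.abelian_group_axioms]) simp_all
  then show ?thesis using assms(2)
    by (intro lmodule.intro lmodule_axioms.intro)
      (simp_all add: ring_hom_closed[OF assms(3)] ring_hom_add[OF assms(3)] ring_hom_mult[OF assms(3)]
        ring_hom_one[OF assms(3)] smult_closed smult_l_distr smult_r_distr smult_assoc smult_one)
qed

lemma restrict_scalars_hom:
  assumes "g \<in> lmod_hom R M N" "\<phi> \<in> ring_hom S R"
  shows "g \<in> lmod_hom S (restrict_scalars \<phi> M) (restrict_scalars \<phi> N)"
  by (rule lmod_homI) (simp_all add: lmod_homD[OF assms(1)] ring_hom_closed[OF assms(2)])

section \<open>Free modules and tensor products\<close>

abbreviation TR :: "'r::comm_ring_1 ring" where "TR \<equiv> ring_of_type_algebra"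

lemma TR_simps [simp]:
  "carrier (TR :: 'r::comm_ring_1 ring) = UNIV" "\<one>\<^bsub>TR\<^esub> = (1 :: 'r)" "\<zero>\<^bsub>TR\<^esub> = (0 :: 'r)"
  "x \<oplus>\<^bsub>TR\<^esub> y = (x + y :: 'r)" "x \<otimes>\<^bsub>TR\<^esub> y = (x * y :: 'r)"
  by (simp_all add: ring_of_type_algebra_def)

lemma TR_ring: "ring (TR :: 'r::comm_ring_1 ring)"
  by (rule ring_from_type_algebra)

abbreviation (input) "single \<equiv> Poly_Mapping.single"
abbreviation (input) "supp \<equiv> Poly_Mapping.keys"
abbreviation (input) "scale c \<equiv> Poly_Mapping.map ((*) (c :: 'r::comm_ring_1))"

lemma lookup_map_mult [simp]:
  "Poly_Mapping.lookup (scale c f) b = c * Poly_Mapping.lookup f b"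
  for c :: "'r::comm_ring_1"
  by (simp add: map.rep_eq when_def)

lemma map_mult_simps:
  fixes c :: "'r::comm_ring_1"
  shows "scale c (f + g) = scale c f + scale c g"
    "scale c (single b d) = single b (c * d)"
    "scale c 0 = 0"
    "scale c (f - g) = scale c f - scale c g"
  by (auto intro!: poly_mapping_eqI simp: lookup_add lookup_minus lookup_single when_def algebra_simps)

lemma free_module_simps [simp]:
  "f \<in> carrier (free_module B) \<longleftrightarrow> supp f \<subseteq> B"
  "\<zero>\<^bsub>free_module B\<^esub> = 0" "f \<oplus>\<^bsub>free_module B\<^esub> g = f + g"
  "c \<odot>\<^bsub>free_module B\<^esub> f = scale c f"
  by (simp_all add: free_module_def)

lemma keys_add_subset: "supp f \<subseteq> B \<Longrightarrow> supp g \<subseteq> B \<Longrightarrow> supp (f + g) \<subseteq> B"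
  using Poly_Mapping.keys_add[of f g] by blast

lemma keys_diff_subset:
  fixes f g :: "'b \<Rightarrow>\<^sub>0 'r::ab_group_add"
  shows "supp f \<subseteq> B \<Longrightarrow> supp g \<subseteq> B \<Longrightarrow> supp (f - g) \<subseteq> B"
  using keys_diff[of f g] by blast

lemma keys_single_subset: "b \<in> B \<Longrightarrow> supp (single b c) \<subseteq> B"
  by (simp add: keys_single)

lemma keys_map_mult_subset:
  "supp f \<subseteq> B \<Longrightarrow> supp (scale c f) \<subseteq> B"
  for c :: "'r::comm_ring_1"
  by (auto simp: in_keys_iff subset_iff dest: mult_not_zero)

lemma free_module_lmodule: "lmodule TR (free_module B :: ('r::comm_ring_1, 'b \<Rightarrow>\<^sub>0 'r) module)"
proof -
  have "abelian_group (free_module B :: ('r, 'b \<Rightarrow>\<^sub>0 'r) module)"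
  proof (rule abelian_groupI)
    fix f :: "'b \<Rightarrow>\<^sub>0 'r" assume "f \<in> carrier (free_module B)"
    then show "\<exists>g\<in>carrier (free_module B). g \<oplus>\<^bsub>free_module B\<^esub> f = \<zero>\<^bsub>free_module B\<^esub>"
      by (intro bexI[of _ "- f"]) (auto simp: in_keys_iff)
  qed (auto simp: keys_add_subset add.assoc add.commute)
  then show ?thesis
    by (intro lmodule.intro lmodule_axioms.intro TR_ring)
      (auto simp: keys_map_mult_subset in_keys_iff lookup_add algebra_simps intro!: poly_mapping_eqI)
qed

lemma free_module_minus:
  assumes "f \<in> carrier (free_module B)" "g \<in> carrier (free_module B :: ('r::comm_ring_1, 'b \<Rightarrow>\<^sub>0 'r) module)"
  shows "f \<ominus>\<^bsub>free_module B\<^esub> g = f - g"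
proof -
  interpret lmodule "TR :: 'r ring" "free_module B :: ('r, 'b \<Rightarrow>\<^sub>0 'r) module"
    by (rule free_module_lmodule)
  have "\<ominus>\<^bsub>free_module B\<^esub> g = - g"
    using assms(2) M.minus_equality[of "- g" g] by (simp add: in_keys_iff)
  then show ?thesis by (simp add: a_minus_def)
qed

lemma free_module_induct [consumes 1, case_names zero single add]:
  assumes "supp f \<subseteq> B" "P 0" "\<And>b c. b \<in> B \<Longrightarrow> P (single b c)"
    "\<And>f g. supp f \<subseteq> B \<Longrightarrow> supp g \<subseteq> B \<Longrightarrow> P f \<Longrightarrow> P g \<Longrightarrow> P (f + g)"
  shows "P (f :: 'b \<Rightarrow>\<^sub>0 'r::comm_monoid_add)"
proof -
  let ?S = "\<lambda>A. \<Sum>b\<in>A. single b (Poly_Mapping.lookup f b)"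
  have "P (?S A) \<and> supp (?S A) \<subseteq> B" if "finite A" "A \<subseteq> B" for A
    using that
  proof induction
    case (insert b A)
    then show ?case
      using assms(3)[of b] assms(4)[of "single b (Poly_Mapping.lookup f b)" "?S A"]
      by (auto simp: keys_single_subset keys_add_subset)
  qed (simp add: assms(2))
  moreover have "?S (supp f) = f"
    by (auto intro!: poly_mapping_eqI simp: lookup_sum lookup_single when_def in_keys_iff)
  ultimately show ?thesis using assms(1) by (metis finite_keys)
qed

lemma free_module_hom_eqI:
  assumes N: "lmodule TR N" and g: "g \<in> lmod_hom TR (free_module B) N" and h: "h \<in> lmod_hom TR (free_module B) N"
    and eq: "\<And>b. b \<in> B \<Longrightarrow> g (single b 1) = h (single b 1)"
    and f: "supp f \<subseteq> B"
  shows "g f = h (f :: 'b \<Rightarrow>\<^sub>0 'r::comm_ring_1)"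
  using f
proof (induction rule: free_module_induct)
  case zero
  then show ?case
    using lmod_hom_zero[OF free_module_lmodule N g] lmod_hom_zero[OF free_module_lmodule N h] by simp
next
  case (single b c)
  then show ?case
    using lmod_homD(3)[OF g, of c "single b 1"] lmod_homD(3)[OF h, of c "single b 1"]
      eq[of b] by (simp add: map_mult_simps)
next
  case (add f f')
  then show ?case
    using lmod_homD(2)[OF g, of f f'] lmod_homD(2)[OF h, of f f'] by simp
qed

lemma free_module_universal:
  assumes N: "lmodule TR N" and h: "\<And>b. b \<in> B \<Longrightarrow> h b \<in> carrier N"
  shows "\<exists>g \<in> lmod_hom TR (free_module B :: ('r::comm_ring_1, 'b \<Rightarrow>\<^sub>0 'r) module) N.
    \<forall>b\<in>B. g (single b 1) = h b"
proof -
  interpret N: lmodule TR N by fact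
  note [simp] = N.smult_closed h
  define g where "g f = (\<Oplus>\<^bsub>N\<^esub>b\<in>supp f. Poly_Mapping.lookup f b \<odot>\<^bsub>N\<^esub> h b)" for f :: "'b \<Rightarrow>\<^sub>0 'r"
  have super: "g f = (\<Oplus>\<^bsub>N\<^esub>b\<in>A. Poly_Mapping.lookup f b \<odot>\<^bsub>N\<^esub> h b)"
    if "finite A" "supp f \<subseteq> A" "A \<subseteq> B" for f A
    unfolding g_def using that N.smult_zero_left[OF h]
    by (intro N.add.finprod_mono_neutral_cong_left) (auto simp: in_keys_iff Pi_iff subset_iff)
  have "g \<in> lmod_hom TR (free_module B) N"
  proof (rule lmod_homI)
    fix f :: "'b \<Rightarrow>\<^sub>0 'r" assume f: "f \<in> carrier (free_module B)"
    then show "g f \<in> carrier N" unfolding g_def by (intro N.finsum_closed) (auto simp: Pi_iff)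
    fix c :: 'r
    have "g (scale c f) = (\<Oplus>\<^bsub>N\<^esub>b\<in>supp f. (c * Poly_Mapping.lookup f b) \<odot>\<^bsub>N\<^esub> h b)"
      using f by (subst super[of "supp f"]) (auto simp: in_keys_iff)
    also have "\<dots> = (\<Oplus>\<^bsub>N\<^esub>b\<in>supp f. c \<odot>\<^bsub>N\<^esub> (Poly_Mapping.lookup f b \<odot>\<^bsub>N\<^esub> h b))"
      using f N.smult_assoc[of c _ "h _"] by (intro N.finsum_cong') (auto simp: Pi_iff subset_iff)
    also have "\<dots> = c \<odot>\<^bsub>N\<^esub> g f"
    proof -
      have "(\<lambda>x. c \<odot>\<^bsub>N\<^esub> x) \<in> lmod_hom TR N N"
        using N.smult_assoc[of c] N.smult_assoc[of _ c] N.smult_r_distr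
        by (intro lmod_homI) (auto simp: mult.commute)
      from lmod_hom_finsum[OF N N this, of "supp f" "\<lambda>b. Poly_Mapping.lookup f b \<odot>\<^bsub>N\<^esub> h b"]
      show ?thesis using f by (simp add: g_def Pi_iff subset_iff)
    qed
    finally show "g (c \<odot>\<^bsub>free_module B\<^esub> f) = c \<odot>\<^bsub>N\<^esub> g f" by simp
  next
    fix f f' :: "'b \<Rightarrow>\<^sub>0 'r" assume f: "f \<in> carrier (free_module B)" "f' \<in> carrier (free_module B)"
    let ?A = "supp f \<union> supp f'"
    have A: "finite ?A" "?A \<subseteq> B" using f by auto
    have "g (f + f') = (\<Oplus>\<^bsub>N\<^esub>b\<in>?A. Poly_Mapping.lookup f b \<odot>\<^bsub>N\<^esub> h b \<oplus>\<^bsub>N\<^esub> Poly_Mapping.lookup f' b \<odot>\<^bsub>N\<^esub> h b)"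
      using A N.smult_l_distr[of _ _ "h _"] Poly_Mapping.keys_add[of f f']
      by (subst super[of ?A]) (auto simp: lookup_add Pi_iff subset_iff intro!: N.finsum_cong')
    also have "\<dots> = g f \<oplus>\<^bsub>N\<^esub> g f'"
      using A by (subst N.finsum_addf) (auto simp: Pi_iff subset_iff super[of ?A])
    finally show "g (f \<oplus>\<^bsub>free_module B\<^esub> f') = g f \<oplus>\<^bsub>N\<^esub> g f'" by simp
  qed
  moreover have "g (single b 1) = h b" if "b \<in> B" for b
    using that N.smult_one[of "h b"] by (simp add: super[of "{b}"] N.finsum_insert)
  ultimately show ?thesis by blast
qed

text \<open>The relations of both kinds of tensor products have one of these two shapes, for additivity
  and for homogeneity in one of the arguments.\<close>

lemma free_module_hom_relations:
  assumes P: "lmodule TR P" and g: "g \<in> lmod_hom TR (free_module B) P"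
    and B: "b \<in> B" "b1 \<in> B" "b2 \<in> B"
  shows "g (single b 1) = g (single b1 1) \<oplus>\<^bsub>P\<^esub> g (single b2 1) \<Longrightarrow>
      g (single b 1 - single b1 1 - single b2 1) = \<zero>\<^bsub>P\<^esub>"
    and "g (single b 1) = c \<odot>\<^bsub>P\<^esub> g (single b1 1) \<Longrightarrow> g (single b 1 - single b1 c) = \<zero>\<^bsub>P\<^esub>"
proof -
  interpret P: lmodule TR P by fact
  note h = lmod_homD[OF g, unfolded free_module_simps]
  have mem: "single b c \<in> carrier (free_module B)" if "b \<in> B" for b and c :: 'a
    using that by (simp add: keys_single_subset)
  have diff: "g (u - v) = \<zero>\<^bsub>P\<^esub>" if "u \<in> carrier (free_module B)" "v \<in> carrier (free_module B)" "g u = g v" for u v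
    using lmod_hom_diff[OF free_module_lmodule P g that(1,2)] that lmod_homD(1)[OF g that(2)]
    by (simp add: free_module_minus P.minus_eq_zero_iff)
  show "g (single b 1 - single b1 1 - single b2 1) = \<zero>\<^bsub>P\<^esub>"
    if "g (single b 1) = g (single b1 1) \<oplus>\<^bsub>P\<^esub> g (single b2 1)"
  proof -
    have "g (single b 1 - (single b1 1 + single b2 1)) = \<zero>\<^bsub>P\<^esub>"
      using that B h(2)[of "single b1 1" "single b2 1"] by (intro diff mem) (simp_all add: keys_add_subset)
    then show ?thesis by (simp only: diff_diff_eq)
  qed
  show "g (single b 1 - single b1 c) = \<zero>\<^bsub>P\<^esub>" if "g (single b 1) = c \<odot>\<^bsub>P\<^esub> g (single b1 1)"
    using that B h(3)[of c "single b1 1"] by (intro diff mem) (simp_all add: map_mult_simps)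
qed

subsection \<open>Tensor products of two modules\<close>

lemma bilinear_relations_submodule:
  "submodule (bilinear_relations M N) TR (free_module (carrier M \<times> carrier N))"
  unfolding bilinear_relations_def by (rule submodule_generated_submodule[OF free_module_lmodule])

lemma tensor2_lmodule: "lmodule TR (tensor2 M N)"
  unfolding tensor2_def by (rule quotient_lmodule[OF free_module_lmodule bilinear_relations_submodule])

lemma tensor2_class_hom: "tensor2_class M N \<in> lmod_hom TR (free_module (carrier M \<times> carrier N)) (tensor2 M N)"
  unfolding tensor2_def tensor2_class_def[abs_def]
  by (rule quotient_proj_hom[OF free_module_lmodule bilinear_relations_submodule])

lemma tensor2_carrier:
  "carrier (tensor2 M N) = tensor2_class M N ` {f. supp f \<subseteq> carrier M \<times> carrier N}"
  by (auto simp: tensor2_def tensor2_class_def quotient_carrier free_module_def)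

lemma tensor2_class_eq_iff:
  assumes "supp f \<subseteq> carrier M \<times> carrier N" "supp g \<subseteq> carrier M \<times> carrier N"
  shows "tensor2_class M N f = tensor2_class M N g \<longleftrightarrow> f - g \<in> bilinear_relations M N"
  using assms coset_eq_iff[OF free_module_lmodule bilinear_relations_submodule, of f M N g]
  by (simp add: tensor2_class_def free_module_minus)

lemma tensor2_class_member:
  assumes "supp f \<subseteq> carrier M \<times> carrier N"
  shows "f \<in> tensor2_class M N f"
    and "g \<in> tensor2_class M N f \<Longrightarrow> supp g \<subseteq> carrier M \<times> carrier N"
    and "g \<in> tensor2_class M N f \<Longrightarrow> tensor2_class M N g = tensor2_class M N f"
  using coset_member(1)[OF free_module_lmodule bilinear_relations_submodule, of f M N]
    coset_member(2,3)[OF free_module_lmodule bilinear_relations_submodule, of f M N g] assms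
  by (simp_all add: tensor2_class_def)

lemma tensor2_add_left:
  assumes "x \<in> carrier M" "x' \<in> carrier M" "x \<oplus>\<^bsub>M\<^esub> x' \<in> carrier M" "y \<in> carrier N"
  shows "single (x \<oplus>\<^bsub>M\<^esub> x', y) c - single (x, y) c - single (x', y) c
    \<in> bilinear_relations M N"
proof -
  let ?g = "single (x \<oplus>\<^bsub>M\<^esub> x', y) 1 - single (x, y) 1 - single (x', y) 1"
  have "?g \<in> bilinear_relations M N"
    unfolding bilinear_relations_def using assms
    by (intro submodule_generated_base) (blast, simp only: free_module_simps, intro keys_diff_subset keys_single_subset, simp_all)
  from submodule_smult[OF bilinear_relations_submodule _ this, of c]
  show ?thesis by (simp add: map_mult_simps)
qed

lemma tensor2_add_right:
  assumes "x \<in> carrier M" "y \<in> carrier N" "y' \<in> carrier N" "y \<oplus>\<^bsub>N\<^esub> y' \<in> carrier N"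
  shows "single (x, y \<oplus>\<^bsub>N\<^esub> y') c - single (x, y) c - single (x, y') c
    \<in> bilinear_relations M N"
proof -
  let ?g = "single (x, y \<oplus>\<^bsub>N\<^esub> y') 1 - single (x, y) 1 - single (x, y') 1"
  have "?g \<in> bilinear_relations M N"
    unfolding bilinear_relations_def using assms
    by (intro submodule_generated_base) (blast, simp only: free_module_simps, intro keys_diff_subset keys_single_subset, simp_all)
  from submodule_smult[OF bilinear_relations_submodule _ this, of c]
  show ?thesis by (simp add: map_mult_simps)
qed

lemma tensor2_smult_left:
  assumes "x \<in> carrier M" "a \<odot>\<^bsub>M\<^esub> x \<in> carrier M" "y \<in> carrier N"
  shows "single (a \<odot>\<^bsub>M\<^esub> x, y) c - single (x, y) (a * c) \<in> bilinear_relations M N"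
proof -
  let ?g = "single (a \<odot>\<^bsub>M\<^esub> x, y) 1 - single (x, y) a"
  have "?g \<in> bilinear_relations M N"
    unfolding bilinear_relations_def using assms
    by (intro submodule_generated_base) (blast, simp only: free_module_simps, intro keys_diff_subset keys_single_subset, simp_all)
  from submodule_smult[OF bilinear_relations_submodule _ this, of c]
  show ?thesis by (simp add: map_mult_simps mult.commute)
qed

lemma tensor2_smult_right:
  assumes "x \<in> carrier M" "y \<in> carrier N" "a \<odot>\<^bsub>N\<^esub> y \<in> carrier N"
  shows "single (x, a \<odot>\<^bsub>N\<^esub> y) c - single (x, y) (a * c) \<in> bilinear_relations M N"
proof -
  let ?g = "single (x, a \<odot>\<^bsub>N\<^esub> y) 1 - single (x, y) a"
  have "?g \<in> bilinear_relations M N"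
    unfolding bilinear_relations_def using assms
    by (intro submodule_generated_base) (blast, simp only: free_module_simps, intro keys_diff_subset keys_single_subset, simp_all)
  from submodule_smult[OF bilinear_relations_submodule _ this, of c]
  show ?thesis by (simp add: map_mult_simps mult.commute)
qed

lemma hom_kills_bilinear_relations:
  assumes M: "lmodule TR M" and N: "lmodule TR N" and P: "lmodule TR P"
    and g: "g \<in> lmod_hom TR (free_module (carrier M \<times> carrier N)) P"
    and l: "\<And>y. y \<in> carrier N \<Longrightarrow> (\<lambda>x. g (single (x, y) 1)) \<in> lmod_hom TR M P"
    and r: "\<And>x. x \<in> carrier M \<Longrightarrow> (\<lambda>y. g (single (x, y) 1)) \<in> lmod_hom TR N P"
    and f: "f \<in> bilinear_relations M N"
  shows "g f = \<zero>\<^bsub>P\<^esub>"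
proof -
  interpret M: lmodule TR M by fact
  interpret N: lmodule TR N by fact
  show ?thesis
    using f unfolding bilinear_relations_def
    by (rule lmod_hom_kills_generated[OF free_module_lmodule P g, rotated])
      (auto intro!: free_module_hom_relations[OF P g] simp: M.smult_closed N.smult_closed
        lmod_homD(2,3)[OF l] lmod_homD(2,3)[OF r])
qed

lemma tensor2_left_hom:
  assumes "lmodule TR M" "lmodule TR N" "y \<in> carrier N"
  shows "(\<lambda>x. tensor2_class M N (single (x, y) c)) \<in> lmod_hom TR M (tensor2 M N)"
proof -
  interpret M: lmodule TR M by fact
  note h = lmod_homD[OF tensor2_class_hom[of M N]]
  have mem: "supp (single (x, y) d) \<subseteq> carrier M \<times> carrier N" if "x \<in> carrier M" for x d
    using that assms(3) by (intro keys_single_subset) simp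
  show ?thesis
  proof (rule lmod_homI)
    fix x assume x: "x \<in> carrier M"
    then show "tensor2_class M N (single (x, y) c) \<in> carrier (tensor2 M N)"
      by (intro h) (simp only: free_module_simps mem)
    fix a
    have "tensor2_class M N (single (a \<odot>\<^bsub>M\<^esub> x, y) c) = tensor2_class M N (single (x, y) (a * c))"
      using tensor2_smult_left[OF x M.smult_closed[OF _ x] assms(3), of a c]
      by (subst tensor2_class_eq_iff) (intro mem M.smult_closed x | simp)+
    also have "\<dots> = a \<odot>\<^bsub>tensor2 M N\<^esub> tensor2_class M N (single (x, y) c)"
      using h(3)[of a "single (x, y) c"] x assms(3) by (simp add: map_mult_simps)
    finally show "tensor2_class M N (single (a \<odot>\<^bsub>M\<^esub> x, y) c) = a \<odot>\<^bsub>tensor2 M N\<^esub> tensor2_class M N (single (x, y) c)" .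
  next
    fix x x' assume x: "x \<in> carrier M" "x' \<in> carrier M"
    have "tensor2_class M N (single (x \<oplus>\<^bsub>M\<^esub> x', y) c) =
        tensor2_class M N (single (x, y) c + single (x', y) c)"
      using tensor2_add_left[OF x M.a_closed[OF x] assms(3), of c]
      by (subst tensor2_class_eq_iff) (intro mem keys_add_subset M.a_closed x | simp add: diff_diff_eq)+
    also have "\<dots> = tensor2_class M N (single (x, y) c) \<oplus>\<^bsub>tensor2 M N\<^esub> tensor2_class M N (single (x', y) c)"
      using h(2)[of "single (x, y) c" "single (x', y) c"] x assms(3) by simp
    finally show "tensor2_class M N (single (x \<oplus>\<^bsub>M\<^esub> x', y) c) =
      tensor2_class M N (single (x, y) c) \<oplus>\<^bsub>tensor2 M N\<^esub> tensor2_class M N (single (x', y) c)" .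
  qed
qed

lemma tensor2_right_hom:
  assumes "lmodule TR M" "lmodule TR N" "x \<in> carrier M"
  shows "(\<lambda>y. tensor2_class M N (single (x, y) c)) \<in> lmod_hom TR N (tensor2 M N)"
proof -
  interpret N: lmodule TR N by fact
  note h = lmod_homD[OF tensor2_class_hom[of M N]]
  have mem: "supp (single (x, y) d) \<subseteq> carrier M \<times> carrier N" if "y \<in> carrier N" for y d
    using that assms(3) by (intro keys_single_subset) simp
  show ?thesis
  proof (rule lmod_homI)
    fix y assume y: "y \<in> carrier N"
    then show "tensor2_class M N (single (x, y) c) \<in> carrier (tensor2 M N)"
      by (intro h) (simp only: free_module_simps mem)
    fix a
    have "tensor2_class M N (single (x, a \<odot>\<^bsub>N\<^esub> y) c) = tensor2_class M N (single (x, y) (a * c))"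
      using tensor2_smult_right[OF assms(3) y N.smult_closed[OF _ y], of a c]
      by (subst tensor2_class_eq_iff) (intro mem N.smult_closed y | simp)+
    also have "\<dots> = a \<odot>\<^bsub>tensor2 M N\<^esub> tensor2_class M N (single (x, y) c)"
      using h(3)[of a "single (x, y) c"] y assms(3) by (simp add: map_mult_simps)
    finally show "tensor2_class M N (single (x, a \<odot>\<^bsub>N\<^esub> y) c) = a \<odot>\<^bsub>tensor2 M N\<^esub> tensor2_class M N (single (x, y) c)" .
  next
    fix y y' assume y: "y \<in> carrier N" "y' \<in> carrier N"
    have "tensor2_class M N (single (x, y \<oplus>\<^bsub>N\<^esub> y') c) =
        tensor2_class M N (single (x, y) c + single (x, y') c)"
      using tensor2_add_right[OF assms(3) y N.a_closed[OF y], of c]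
      by (subst tensor2_class_eq_iff) (intro mem keys_add_subset N.a_closed y | simp add: diff_diff_eq)+
    also have "\<dots> = tensor2_class M N (single (x, y) c) \<oplus>\<^bsub>tensor2 M N\<^esub> tensor2_class M N (single (x, y') c)"
      using h(2)[of "single (x, y) c" "single (x, y') c"] y assms(3) by simp
    finally show "tensor2_class M N (single (x, y \<oplus>\<^bsub>N\<^esub> y') c) =
      tensor2_class M N (single (x, y) c) \<oplus>\<^bsub>tensor2 M N\<^esub> tensor2_class M N (single (x, y') c)" .
  qed
qed

text \<open>The operations on \<open>U\<^sub>K\<close> and on \<open>L \<otimes>\<^sub>A F\<close> are defined by unions over all representatives of a class.
  A homomorphism that is bilinear on the basis takes one value on the whole class, so that such a
  union is a union of equal sets.\<close>

lemma tensor2_hom_constant: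
  assumes M: "lmodule TR M" and N: "lmodule TR N" and P: "lmodule TR P"
    and g: "g \<in> lmod_hom TR (free_module (carrier M \<times> carrier N)) P"
    and l: "\<And>y. y \<in> carrier N \<Longrightarrow> (\<lambda>x. g (single (x, y) 1)) \<in> lmod_hom TR M P"
    and r: "\<And>x. x \<in> carrier M \<Longrightarrow> (\<lambda>y. g (single (x, y) 1)) \<in> lmod_hom TR N P"
    and f: "supp f \<subseteq> carrier M \<times> carrier N" "f' \<in> tensor2_class M N f"
  shows "g f' = g f"
  using f hom_kills_bilinear_relations[OF M N P g l r]
  by (intro lmod_hom_constant_on_coset[OF free_module_lmodule bilinear_relations_submodule P g]) (simp_all add: tensor2_class_def)

lemma tensor2_class_Union:
  assumes "supp f \<subseteq> carrier M \<times> carrier N"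
    and "\<And>f'. f' \<in> tensor2_class M N f \<Longrightarrow> g f' = g f"
  shows "(\<Union>f'\<in>tensor2_class M N f. g f') = g f"
  using assms(2) tensor2_class_member(1)[OF assms(1)] by (intro SUP_eq_const) blast+

subsection \<open>Tensor products of finite families\<close>

definition multilinear ::
    "nat \<Rightarrow> (nat \<Rightarrow> ('r::comm_ring_1, 'm) module) \<Rightarrow> ('r, 'n) module \<Rightarrow> ((nat \<Rightarrow> 'm) \<Rightarrow> 'n) \<Rightarrow> bool" where
  "multilinear k Ms N h \<longleftrightarrow> (\<forall>w\<in>tuples k Ms. h w \<in> carrier N) \<and>
     (\<forall>w\<in>tuples k Ms. \<forall>j<k. (\<lambda>x. h (w(j := x))) \<in> lmod_hom TR (Ms j) N)"

lemma tuples_upd: "w \<in> tuples k Ms \<Longrightarrow> j < k \<Longrightarrow> x \<in> carrier (Ms j) \<Longrightarrow> w(j := x) \<in> tuples k Ms"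
  by (auto simp: tuples_def PiE_iff extensional_def)

lemma tuples_component: "w \<in> tuples k Ms \<Longrightarrow> j < k \<Longrightarrow> w j \<in> carrier (Ms j)"
  by (auto simp: tuples_def)

lemma tuples_restrict: "w \<in> tuples k Ms \<Longrightarrow> restrict w {..<k} = w"
  by (auto simp: tuples_def PiE_iff extensional_restrict)

lemma restrict_in_tuples: "(\<And>j. j < k \<Longrightarrow> w j \<in> carrier (Ms j)) \<Longrightarrow> restrict w {..<k} \<in> tuples k Ms"
  by (auto simp: tuples_def)

lemma multilinear_relations_submodule:
  "submodule (multilinear_relations k Ms) TR (free_module (tuples k Ms))"
  unfolding multilinear_relations_def by (rule submodule_generated_submodule[OF free_module_lmodule])

lemma tensor_lmodule: "lmodule TR (tensor k Ms)"
  unfolding tensor_def by (rule quotient_lmodule[OF free_module_lmodule multilinear_relations_submodule])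

lemma tensor_class_hom: "tensor_class k Ms \<in> lmod_hom TR (free_module (tuples k Ms)) (tensor k Ms)"
  unfolding tensor_def tensor_class_def[abs_def]
  by (rule quotient_proj_hom[OF free_module_lmodule multilinear_relations_submodule])

lemma tensor_carrier: "carrier (tensor k Ms) = tensor_class k Ms ` {f. supp f \<subseteq> tuples k Ms}"
  by (auto simp: tensor_def tensor_class_def quotient_carrier free_module_def)

lemma tensor_class_eq_iff:
  assumes "supp f \<subseteq> tuples k Ms" "supp g \<subseteq> tuples k Ms"
  shows "tensor_class k Ms f = tensor_class k Ms g \<longleftrightarrow> f - g \<in> multilinear_relations k Ms"
  using assms coset_eq_iff[OF free_module_lmodule multilinear_relations_submodule, of f k Ms g]
  by (simp add: tensor_class_def free_module_minus)

lemma tensor_class_member: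
  assumes "supp f \<subseteq> tuples k Ms"
  shows "f \<in> tensor_class k Ms f"
    and "g \<in> tensor_class k Ms f \<Longrightarrow> supp g \<subseteq> tuples k Ms"
    and "g \<in> tensor_class k Ms f \<Longrightarrow> tensor_class k Ms g = tensor_class k Ms f"
  using coset_member(1)[OF free_module_lmodule multilinear_relations_submodule, of f k Ms]
    coset_member(2,3)[OF free_module_lmodule multilinear_relations_submodule, of f k Ms g] assms
  by (simp_all add: tensor_class_def)

lemma pure_tensor_eq: "w \<in> tuples k Ms \<Longrightarrow> pure_tensor k Ms w = tensor_class k Ms (single w 1)"
  by (simp add: pure_tensor_def tuples_restrict)

lemma pure_tensor_cong: "(\<And>j. j < k \<Longrightarrow> w j = w' j) \<Longrightarrow> pure_tensor k Ms w = pure_tensor k Ms w'"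
  unfolding pure_tensor_def by (metis (no_types, lifting) lessThan_iff restrict_ext)

lemma pure_tensor_restrict: "pure_tensor k Ms (restrict w {..<k}) = pure_tensor k Ms w"
  by (rule pure_tensor_cong) simp

lemma pure_tensor_closed: "w \<in> tuples k Ms \<Longrightarrow> pure_tensor k Ms w \<in> carrier (tensor k Ms)"
  using lmod_homD(1)[OF tensor_class_hom, of "single w 1" k Ms]
  by (simp add: pure_tensor_eq)

lemma multilinear_relations_add:
  assumes "\<And>j. j < k \<Longrightarrow> lmodule TR (Ms j)" "w \<in> tuples k Ms" "j < k" "x \<in> carrier (Ms j)" "y \<in> carrier (Ms j)"
  shows "single (w(j := x \<oplus>\<^bsub>Ms j\<^esub> y)) 1 - single (w(j := x)) 1
     - single (w(j := y)) 1 \<in> multilinear_relations k Ms"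
proof -
  interpret lmodule TR "Ms j" by (rule assms(1)[OF assms(3)])
  show ?thesis
    unfolding multilinear_relations_def using assms
    by (intro submodule_generated_base)
      (blast, simp only: free_module_simps, intro keys_diff_subset keys_single_subset, simp_all add: tuples_upd)
qed

lemma multilinear_relations_smult:
  assumes "\<And>j. j < k \<Longrightarrow> lmodule TR (Ms j)" "w \<in> tuples k Ms" "j < k" "x \<in> carrier (Ms j)"
  shows "single (w(j := c \<odot>\<^bsub>Ms j\<^esub> x)) 1 - single (w(j := x)) c
     \<in> multilinear_relations k Ms"
proof -
  interpret lmodule TR "Ms j" by (rule assms(1)[OF assms(3)])
  show ?thesis
    unfolding multilinear_relations_def using assms
    by (intro submodule_generated_base)
      (blast, simp only: free_module_simps, intro keys_diff_subset keys_single_subset,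
        simp_all add: tuples_upd smult_closed)
qed

lemma pure_tensor_multilinear:
  assumes Ms: "\<And>j. j < k \<Longrightarrow> lmodule TR (Ms j)"
  shows "multilinear k Ms (tensor k Ms) (pure_tensor k Ms)"
proof -
  have "(\<lambda>x. pure_tensor k Ms (w(j := x))) \<in> lmod_hom TR (Ms j) (tensor k Ms)"
    if w: "w \<in> tuples k Ms" and j: "j < k" for w j
  proof -
    interpret lmodule TR "Ms j" by (rule Ms[OF j])
    note cl = tuples_upd[OF w j] and h = lmod_homD[OF tensor_class_hom[of k Ms]]
    have mem: "supp (single (w(j := x)) c) \<subseteq> tuples k Ms"
      if "x \<in> carrier (Ms j)" for x c using cl[OF that] by (rule keys_single_subset)
    show ?thesis
    proof (rule lmod_homI)
      fix x assume x: "x \<in> carrier (Ms j)"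
      then show "pure_tensor k Ms (w(j := x)) \<in> carrier (tensor k Ms)"
        by (intro pure_tensor_closed cl)
      fix c
      have "tensor_class k Ms (single (w(j := c \<odot>\<^bsub>Ms j\<^esub> x)) 1) =
          tensor_class k Ms (single (w(j := x)) c)"
        using multilinear_relations_smult[OF Ms w j x, of c]
        by (subst tensor_class_eq_iff) (intro mem smult_closed x | simp)+
      also have "\<dots> = c \<odot>\<^bsub>tensor k Ms\<^esub> tensor_class k Ms (single (w(j := x)) 1)"
        using h(3)[of c "single (w(j := x)) 1"] cl[OF x] by (simp add: map_mult_simps)
      finally show "pure_tensor k Ms (w(j := c \<odot>\<^bsub>Ms j\<^esub> x)) = c \<odot>\<^bsub>tensor k Ms\<^esub> pure_tensor k Ms (w(j := x))"
        using x by (simp add: pure_tensor_eq cl smult_closed)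
    next
      fix x y assume x: "x \<in> carrier (Ms j)" "y \<in> carrier (Ms j)"
      have "tensor_class k Ms (single (w(j := x \<oplus>\<^bsub>Ms j\<^esub> y)) 1) =
          tensor_class k Ms (single (w(j := x)) 1 + single (w(j := y)) 1)"
        using multilinear_relations_add[OF Ms w j x]
        by (subst tensor_class_eq_iff)
          (intro mem keys_add_subset M.a_closed x | simp add: diff_diff_eq)+
      also have "\<dots> = tensor_class k Ms (single (w(j := x)) 1) \<oplus>\<^bsub>tensor k Ms\<^esub>
          tensor_class k Ms (single (w(j := y)) 1)"
        using h(2)[of "single (w(j := x)) 1" "single (w(j := y)) 1"] cl x by simp
      finally show "pure_tensor k Ms (w(j := x \<oplus>\<^bsub>Ms j\<^esub> y)) =
          pure_tensor k Ms (w(j := x)) \<oplus>\<^bsub>tensor k Ms\<^esub> pure_tensor k Ms (w(j := y))"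
        using x by (simp add: pure_tensor_eq cl)
    qed
  qed
  then show ?thesis by (simp add: multilinear_def pure_tensor_closed)
qed

lemma hom_kills_multilinear_relations:
  assumes Ms: "\<And>j. j < k \<Longrightarrow> lmodule TR (Ms j)" and P: "lmodule TR P"
    and g: "g \<in> lmod_hom TR (free_module (tuples k Ms)) P"
    and ml: "multilinear k Ms P (\<lambda>w. g (single w 1))"
    and f: "f \<in> multilinear_relations k Ms"
  shows "g f = \<zero>\<^bsub>P\<^esub>"
proof -
  have h: "(\<lambda>x. g (single (w(j := x)) 1)) \<in> lmod_hom TR (Ms j) P" if "w \<in> tuples k Ms" "j < k" for w j
    using ml that by (simp add: multilinear_def)
  have closed: "x \<oplus>\<^bsub>Ms j\<^esub> y \<in> carrier (Ms j)" "c \<odot>\<^bsub>Ms j\<^esub> x \<in> carrier (Ms j)"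
    if "j < k" "x \<in> carrier (Ms j)" "y \<in> carrier (Ms j)" for j c x y
  proof -
    interpret lmodule TR "Ms j" by (rule Ms[OF that(1)])
    show "x \<oplus>\<^bsub>Ms j\<^esub> y \<in> carrier (Ms j)" "c \<odot>\<^bsub>Ms j\<^esub> x \<in> carrier (Ms j)" using that by (simp_all add: smult_closed)
  qed
  show ?thesis
    using f unfolding multilinear_relations_def
    by (rule lmod_hom_kills_generated[OF free_module_lmodule P g, rotated])
      (auto intro!: free_module_hom_relations[OF P g] tuples_upd closed simp: lmod_homD(2,3)[OF h])
qed

lemma tensor_hom_constant:
  assumes Ms: "\<And>j. j < k \<Longrightarrow> lmodule TR (Ms j)" and P: "lmodule TR P"
    and g: "g \<in> lmod_hom TR (free_module (tuples k Ms)) P"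
    and ml: "multilinear k Ms P (\<lambda>w. g (single w 1))"
    and f: "supp f \<subseteq> tuples k Ms" "f' \<in> tensor_class k Ms f"
  shows "g f' = g f"
  using f hom_kills_multilinear_relations[OF Ms P g ml]
  by (intro lmod_hom_constant_on_coset[OF free_module_lmodule multilinear_relations_submodule P g]) (simp_all add: tensor_class_def)

lemma tensor_universal:
  assumes Ms: "\<And>j. j < k \<Longrightarrow> lmodule TR (Ms j)" and P: "lmodule TR P" and h: "multilinear k Ms P h"
  shows "\<exists>g \<in> lmod_hom TR (tensor k Ms) P. \<forall>w\<in>tuples k Ms. g (pure_tensor k Ms w) = h w"
proof -
  obtain g0 where g0: "g0 \<in> lmod_hom TR (free_module (tuples k Ms)) P"
      "\<And>w. w \<in> tuples k Ms \<Longrightarrow> g0 (single w 1) = h w"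
    using free_module_universal[OF P, of "tuples k Ms" h] h by (auto simp: multilinear_def)
  have "multilinear k Ms P (\<lambda>w. g0 (single w 1))"
    unfolding multilinear_def
  proof (intro conjI ballI allI impI)
    fix w j assume w: "w \<in> tuples k Ms" "j < k"
    show "(\<lambda>x. g0 (single (w(j := x)) 1)) \<in> lmod_hom TR (Ms j) P"
      by (rule lmod_hom_cong[OF Ms[OF w(2)], of "\<lambda>x. h (w(j := x))"])
        (use h w in \<open>auto simp: multilinear_def g0(2) tuples_upd\<close>)
  qed (use h in \<open>auto simp: multilinear_def g0(2)\<close>)
  then have "g0 f = \<zero>\<^bsub>P\<^esub>" if "f \<in> multilinear_relations k Ms" for f
    using hom_kills_multilinear_relations[OF Ms P g0(1)] that by blast
  from quotient_factor[OF free_module_lmodule multilinear_relations_submodule P g0(1) this]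
  obtain g where "g \<in> lmod_hom TR (tensor k Ms) P"
      "\<And>f. supp f \<subseteq> tuples k Ms \<Longrightarrow> g (tensor_class k Ms f) = g0 f"
    by (auto simp: tensor_def tensor_class_def)
  with g0(2) show ?thesis
    by (intro bexI[of _ g]) (auto simp: pure_tensor_eq)
qed

lemma tensor_hom_eqI:
  assumes P: "lmodule TR P" and g: "g \<in> lmod_hom TR (tensor k Ms) P" and h: "h \<in> lmod_hom TR (tensor k Ms) P"
    and eq: "\<And>w. w \<in> tuples k Ms \<Longrightarrow> g (pure_tensor k Ms w) = h (pure_tensor k Ms w)"
    and t: "t \<in> carrier (tensor k Ms)"
  shows "g t = h t"
proof -
  obtain f where f: "supp f \<subseteq> tuples k Ms" "t = tensor_class k Ms f"
    using t by (auto simp: tensor_carrier)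
  have "(\<lambda>f. g (tensor_class k Ms f)) \<in> lmod_hom TR (free_module (tuples k Ms)) P"
    "(\<lambda>f. h (tensor_class k Ms f)) \<in> lmod_hom TR (free_module (tuples k Ms)) P"
    using lmod_hom_comp[OF tensor_class_hom] g h by blast+
  then show ?thesis
    using free_module_hom_eqI[OF P, of "\<lambda>f. g (tensor_class k Ms f)" "tuples k Ms" "\<lambda>f. h (tensor_class k Ms f)"] eq f
    by (auto simp: pure_tensor_eq)
qed

section \<open>Additive extension of maps on basis elements\<close>

text \<open>The product of \<open>U\<^sub>K\<close>, the change of its coefficients and its action on \<open>L \<otimes>\<^sub>A F\<close> are given by sums over
  supports that have this form; by additivity, identities between them need to be checked on basis
  elements only.\<close>

definition add_ext :: "('b \<Rightarrow> 'r \<Rightarrow> 'c) \<Rightarrow> ('b \<Rightarrow>\<^sub>0 'r::ab_group_add) \<Rightarrow> 'c::ab_group_add" where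
  "add_ext h f = (\<Sum>b\<in>supp f. h b (Poly_Mapping.lookup f b))"

lemma add_ext_add:
  assumes "\<And>b c d. h b (c + d) = h b c + h b d"
  shows "add_ext h (f + g) = add_ext h f + add_ext h g"
proof -
  have zero: "h b 0 = 0" for b using assms[of b 0 0] by simp
  let ?A = "supp f \<union> supp g"
  have super: "add_ext h u = (\<Sum>b\<in>?A. h b (Poly_Mapping.lookup u b))" if "supp u \<subseteq> ?A" for u
    unfolding add_ext_def using that by (intro sum.mono_neutral_left) (auto simp: in_keys_iff zero)
  show ?thesis
    using Poly_Mapping.keys_add[of f g] by (simp add: super lookup_add assms sum.distrib)
qed

lemma add_ext_single:
  assumes "\<And>b c d. h b (c + d) = h b c + h b d"
  shows "add_ext h (single b c) = h b c"
  using assms[of b 0 0] by (simp add: add_ext_def)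

section \<open>The algebra over a commutative ring\<close>

lemma pair_mult_add_ext:
  "pair_mult f g = add_ext (\<lambda>p m. add_ext (\<lambda>q n. single (fst p * fst q, snd p * snd q) (m * n)) g) f"
  by (simp add: pair_mult_def add_ext_def)

lemma pair_mult_add_left: "pair_mult (f + f') g = pair_mult f g + pair_mult f' g"
proof -
  have "add_ext (\<lambda>q n. single (fst p * fst q, snd p * snd q) ((c + d) * n)) g =
    add_ext (\<lambda>q n. single (fst p * fst q, snd p * snd q) (c * n)) g +
    add_ext (\<lambda>q n. single (fst p * fst q, snd p * snd q) (d * n)) g" for p :: "'a \<times> 'b" and c d :: int
    by (simp add: add_ext_def single_add distrib_right sum.distrib)
  then show ?thesis unfolding pair_mult_add_ext by (rule add_ext_add)
qed

lemma pair_mult_add_right: "pair_mult f (g + g') = pair_mult f g + pair_mult f g'"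
  unfolding pair_mult_add_ext
  by (subst add_ext_add) (simp_all add: single_add distrib_left add_ext_def sum.distrib)

lemma pair_mult_zero [simp]: "pair_mult 0 g = 0" "pair_mult f 0 = 0"
  by (simp_all add: pair_mult_def)

lemma pair_mult_single [simp]:
  "pair_mult (single p m) (single q n) =
    single (fst p * fst q, snd p * snd q) (m * n)"
  by (cases "m = 0"; cases "n = 0") (simp_all add: pair_mult_def)

lemma pair_mult_int_smult:
  "pair_mult (scale c f) g = scale c (pair_mult f g)"
  "pair_mult f (scale c g) = scale c (pair_mult f g)"
proof -
  have 1: "pair_mult (single p (c * m)) g = scale c (pair_mult (single p m) g) \<and>
    pair_mult (single p m) (scale c g) = scale c (pair_mult (single p m) g)" for p m
    by (induction g rule: poly_mapping_add_induct)
      (simp_all add: map_mult_simps pair_mult_add_right mult.left_commute mult.assoc)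
  have "pair_mult (scale c f) g = scale c (pair_mult f g) \<and>
    pair_mult f (scale c g) = scale c (pair_mult f g)"
    by (induction f rule: poly_mapping_add_induct) (simp_all add: 1 map_mult_simps pair_mult_add_left)
  then show "pair_mult (scale c f) g = scale c (pair_mult f g)"
    "pair_mult f (scale c g) = scale c (pair_mult f g)" by auto
qed

lemma pair_mult_assoc:
  fixes f g h :: "('a::semigroup_mult \<times> 'b::semigroup_mult) \<Rightarrow>\<^sub>0 int"
  shows "pair_mult (pair_mult f g) h = pair_mult f (pair_mult g h)"
proof -
  have "pair_mult (pair_mult (single p l) (single q m)) (single r n) =
    pair_mult (single p l) (pair_mult (single q m) (single r n))"
    for p q r :: "'a \<times> 'b" and l m n by (simp add: mult.assoc)
  then have "pair_mult (pair_mult (single p l) (single q m)) h =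
    pair_mult (single p l) (pair_mult (single q m) h)" for p q :: "'a \<times> 'b" and l m
    by (induction h rule: poly_mapping_add_induct) (simp_all add: pair_mult_add_right del: pair_mult_single)
  then have "pair_mult (pair_mult (single p l) g) h =
    pair_mult (single p l) (pair_mult g h)" for p :: "'a \<times> 'b" and l
    by (induction g rule: poly_mapping_add_induct) (simp_all add: pair_mult_add_right pair_mult_add_left del: pair_mult_single)
  then show ?thesis
    by (induction f rule: poly_mapping_add_induct) (simp_all add: pair_mult_add_left)
qed

lemma pair_mult_one:
  fixes f :: "('a::monoid_mult \<times> 'b::monoid_mult) \<Rightarrow>\<^sub>0 int"
  shows "pair_mult (single (1, 1) 1) f = f" "pair_mult f (single (1, 1) 1) = f"
  by (induction f rule: poly_mapping_add_induct) (simp_all add: pair_mult_add_left pair_mult_add_right)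

lemma UZ_of_int_mult: "u \<in> UZ D \<Longrightarrow> of_int n * u \<in> UZ D"
proof -
  assume u: "u \<in> UZ D"
  have nat: "of_nat m * u \<in> UZ D" for m
    by (induction m) (simp_all add: UZ.zero u UZ.add distrib_right)
  show ?thesis
    by (cases n rule: int_cases2) (use nat UZ.uminus[OF nat] in auto)
qed

lemma UZ_module_simps [simp]:
  "carrier (UZ_module D) = UZ D" "zero (UZ_module D) = 0" "u \<oplus>\<^bsub>UZ_module D\<^esub> w = u + w"
  "n \<odot>\<^bsub>UZ_module D\<^esub> u = of_int n * u"
  by (simp_all add: UZ_module_def module_via_def)

lemma module_via_simps [simp]:
  "carrier (module_via \<phi> S) = S" "zero (module_via \<phi> S) = 0" "u \<oplus>\<^bsub>module_via \<phi> S\<^esub> w = u + w"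
  "n \<odot>\<^bsub>module_via \<phi> S\<^esub> u = \<phi> n * u"
  by (simp_all add: module_via_def)

lemma UZ_module_lmodule: "lmodule TR (UZ_module D)"
proof -
  have "abelian_group (UZ_module D)"
    by (rule abelian_groupI) (auto simp: UZ.add UZ.zero add.assoc add.commute intro: bexI[of _ "- _"] UZ.uminus)
  then show ?thesis
    by (intro lmodule.intro lmodule_axioms.intro TR_ring)
      (auto simp: UZ_of_int_mult algebra_simps)
qed

lemma module_via_lmodule:
  assumes "\<And>a b. \<phi> (a + b) = \<phi> a + \<phi> b" "\<And>a b. \<phi> (a * b) = \<phi> a * \<phi> b" "\<phi> 1 = 1"
  shows "lmodule TR (module_via (\<phi> :: 'r::comm_ring_1 \<Rightarrow> 's::comm_ring_1) UNIV)"
proof -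
  have "abelian_group (module_via \<phi> UNIV)"
    by (rule abelian_groupI) (auto simp: add.assoc add.commute intro: exI[of _ "- _"])
  then show ?thesis
    by (intro lmodule.intro lmodule_axioms.intro TR_ring) (auto simp: assms algebra_simps)
qed

lemma Z_module_lmodule: "lmodule TR (Z_module :: (int, 'k::comm_ring_1) module)"
  unfolding Z_module_def by (rule module_via_lmodule) simp_all

lemma Z_module_simps [simp]:
  "carrier Z_module = UNIV" "zero Z_module = 0" "u \<oplus>\<^bsub>Z_module\<^esub> w = u + w"
  "n \<odot>\<^bsub>Z_module\<^esub> u = of_int n * u"
  by (simp_all add: Z_module_def)

text \<open>The ring whose quotient by the bilinearity relations is \<open>U\<^sub>K\<close>.\<close>

definition pair_ring :: "('g::complex_lie_algebra, 'i) chevalley_data \<Rightarrow> ('g loop uea \<times> 'k::comm_ring_1 \<Rightarrow>\<^sub>0 int) ring" where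
  "pair_ring D = \<lparr>carrier = {f. supp f \<subseteq> UZ D \<times> UNIV}, monoid.mult = pair_mult,
       one = single (1, 1) 1, ring.zero = 0, add = (+)\<rparr>"

lemma pair_ring_simps [simp]:
  "f \<in> carrier (pair_ring D) \<longleftrightarrow> supp f \<subseteq> UZ D \<times> UNIV"
  "f \<otimes>\<^bsub>pair_ring D\<^esub> g = pair_mult f g" "f \<oplus>\<^bsub>pair_ring D\<^esub> g = f + g"
  "\<one>\<^bsub>pair_ring D\<^esub> = single (1, 1) 1" "\<zero>\<^bsub>pair_ring D\<^esub> = 0"
  by (simp_all add: pair_ring_def)

lemma pair_mult_keys:
  assumes "supp f \<subseteq> UZ D \<times> UNIV" "supp g \<subseteq> UZ D \<times> UNIV"
  shows "supp (pair_mult f g) \<subseteq> UZ D \<times> UNIV"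
  using assms(1)
proof (induction rule: free_module_induct)
  case (single b c)
  show ?case
    using assms(2)
    by (induction rule: free_module_induct)
      (use single in \<open>auto simp: pair_mult_add_right keys_add_subset UZ.mult simp del: keys_single intro!: keys_single_subset\<close>)
qed (simp_all add: pair_mult_add_left keys_add_subset)

lemma pair_ring_ring: "ring (pair_ring D)"
proof (rule ringI)
  interpret F: lmodule TR "free_module (UZ D \<times> UNIV)" by (rule free_module_lmodule)
  show "abelian_group (pair_ring D)"
    by (rule abelian_group_cong[OF F.M.abelian_group_axioms]) (auto simp: free_module_def pair_ring_def)
  show "monoid (pair_ring D)"
    by (rule monoidI) (simp_all add: pair_mult_keys pair_mult_assoc pair_mult_one UZ.one)
qed (simp_all add: pair_mult_add_left pair_mult_add_right)

lemma pair_mult_hom: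
  fixes f :: "'g::complex_lie_algebra loop uea \<times> 'k::comm_ring_1 \<Rightarrow>\<^sub>0 int"
  assumes "supp f \<subseteq> UZ D \<times> UNIV"
  shows "pair_mult f \<in> lmod_hom TR (free_module (UZ D \<times> UNIV)) (free_module (UZ D \<times> UNIV))"
    "(\<lambda>g. pair_mult g f) \<in> lmod_hom TR (free_module (UZ D \<times> UNIV)) (free_module (UZ D \<times> UNIV))"
  using assms
  by (auto intro!: lmod_homI simp: pair_mult_add_left pair_mult_add_right pair_mult_int_smult
      dest: pair_mult_keys[of _ D] del: subsetI)

lemma UZ_mult_hom:
  assumes "u \<in> UZ D"
  shows "(\<lambda>w. u * w) \<in> lmod_hom TR (UZ_module D) (UZ_module D)"
    "(\<lambda>w. w * u) \<in> lmod_hom TR (UZ_module D) (UZ_module D)"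
proof -
  have "u * (of_int n * w) = of_int n * (u * w)" for n w
    by (metis mult.assoc mult_of_int_commute)
  then show "(\<lambda>w. u * w) \<in> lmod_hom TR (UZ_module D) (UZ_module D)"
    using assms by (auto intro!: lmod_homI simp: UZ.mult distrib_left)
qed (use assms in \<open>auto intro!: lmod_homI simp: UZ.mult distrib_right mult.assoc\<close>)

lemma Z_mult_hom:
  "(\<lambda>w. u * w) \<in> lmod_hom TR (Z_module :: (int, 'k::comm_ring_1) module) Z_module"
  "(\<lambda>w. w * u) \<in> lmod_hom TR (Z_module :: (int, 'k::comm_ring_1) module) Z_module"
  by (auto intro!: lmod_homI simp: algebra_simps)

text \<open>The relations form a two-sided ideal, because multiplication by a basis element \<open>(u, e)\<close> on
  either side, followed by the passage to classes, is bilinear.\<close>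

lemma pair_mult_bilinear_relations:
  fixes r :: "'g::complex_lie_algebra loop uea \<times> 'k::comm_ring_1 \<Rightarrow>\<^sub>0 int"
  assumes f: "f \<in> bilinear_relations (UZ_module D) Z_module" and r: "supp r \<subseteq> UZ D \<times> UNIV"
  shows "pair_mult r f \<in> bilinear_relations (UZ_module D) Z_module"
    "pair_mult f r \<in> bilinear_relations (UZ_module D) Z_module"
proof -
  let ?M = "UZ_module D" and ?N = "Z_module :: (int, 'k) module"
  let ?c = "tensor2_class ?M ?N"
  note M = UZ_module_lmodule[of D] and N = Z_module_lmodule[where ?'k = 'k]
  have fk: "supp f \<subseteq> UZ D \<times> UNIV"
    using subsetD[OF submodule_subset[OF bilinear_relations_submodule] f] by simp
  have "?c (pair_mult r f) = \<zero>\<^bsub>tensor2 ?M ?N\<^esub> \<and> ?c (pair_mult f r) = \<zero>\<^bsub>tensor2 ?M ?N\<^esub>"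
    using r
  proof (induction rule: free_module_induct)
    case zero
    then show ?case
      using lmod_hom_zero[OF free_module_lmodule tensor2_lmodule tensor2_class_hom, of ?M ?N] by simp
  next
    case (single b c)
    obtain u e where b: "b = (u, e)" "u \<in> UZ D" using single by auto
    have k: "supp (single b c) \<subseteq> UZ D \<times> UNIV" using single by (rule keys_single_subset)
    have "?c (pair_mult (single b c) f) = \<zero>\<^bsub>tensor2 ?M ?N\<^esub>"
    proof (rule hom_kills_bilinear_relations[OF M N tensor2_lmodule _ _ _ f])
      show "(\<lambda>f. ?c (pair_mult (single b c) f)) \<in> lmod_hom TR (free_module (carrier ?M \<times> carrier ?N)) (tensor2 ?M ?N)"
        using lmod_hom_comp[OF pair_mult_hom(1)[OF k] tensor2_class_hom[of ?M ?N, simplified]] by simp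
      show "(\<lambda>x. ?c (pair_mult (single b c) (single (x, y) 1))) \<in> lmod_hom TR ?M (tensor2 ?M ?N)" for y
        using lmod_hom_comp[OF UZ_mult_hom(1)[OF b(2)] tensor2_left_hom[OF M N, of "e * y" c]] by (simp add: b)
      show "(\<lambda>y. ?c (pair_mult (single b c) (single (x, y) 1))) \<in> lmod_hom TR ?N (tensor2 ?M ?N)"
        if "x \<in> carrier ?M" for x
        using lmod_hom_comp[OF Z_mult_hom(1)[of e] tensor2_right_hom[OF M N, of "u * x" c]] that by (simp add: b UZ.mult)
    qed
    moreover have "?c (pair_mult f (single b c)) = \<zero>\<^bsub>tensor2 ?M ?N\<^esub>"
    proof (rule hom_kills_bilinear_relations[OF M N tensor2_lmodule _ _ _ f])
      show "(\<lambda>f. ?c (pair_mult f (single b c))) \<in> lmod_hom TR (free_module (carrier ?M \<times> carrier ?N)) (tensor2 ?M ?N)"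
        using lmod_hom_comp[OF pair_mult_hom(2)[OF k] tensor2_class_hom[of ?M ?N, simplified]] by simp
      show "(\<lambda>x. ?c (pair_mult (single (x, y) 1) (single b c))) \<in> lmod_hom TR ?M (tensor2 ?M ?N)" for y
        using lmod_hom_comp[OF UZ_mult_hom(2)[OF b(2)] tensor2_left_hom[OF M N, of "y * e" c]] by (simp add: b)
      show "(\<lambda>y. ?c (pair_mult (single (x, y) 1) (single b c))) \<in> lmod_hom TR ?N (tensor2 ?M ?N)"
        if "x \<in> carrier ?M" for x
        using lmod_hom_comp[OF Z_mult_hom(2)[of e] tensor2_right_hom[OF M N, of "x * u" c]] that by (simp add: b UZ.mult)
    qed
    ultimately show ?case by blast
  next
    case (add g h)
    interpret T: lmodule TR "tensor2 ?M ?N" by (rule tensor2_lmodule)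
    show ?case
      using add fk pair_mult_keys[OF fk add.hyps(1)] pair_mult_keys[OF fk add.hyps(2)]
        pair_mult_keys[OF add.hyps(1) fk] pair_mult_keys[OF add.hyps(2) fk] lmod_homD(2)[OF tensor2_class_hom, of _ ?M ?N]
      by (simp add: pair_mult_add_left pair_mult_add_right)
  qed
  then show "pair_mult r f \<in> bilinear_relations ?M ?N" "pair_mult f r \<in> bilinear_relations ?M ?N"
    using coset_zero_iff[OF free_module_lmodule bilinear_relations_submodule, of _ ?M ?N] pair_mult_keys[OF fk r] pair_mult_keys[OF r fk]
    by (simp_all add: tensor2_class_def tensor2_def quotient_zero)
qed

lemma TR_hom_simps:
  assumes "\<phi> \<in> ring_hom (TR :: 'r::comm_ring_1 ring) (TR :: 's::comm_ring_1 ring)"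
  shows "\<phi> (a + b) = \<phi> a + \<phi> b" "\<phi> (a * b) = \<phi> a * \<phi> b" "\<phi> 1 = 1" "\<phi> 0 = 0"
    "\<phi> (of_int n) = of_int n"
proof -
  show add: "\<phi> (a + b) = \<phi> a + \<phi> b" for a b using ring_hom_add[OF assms, of a b] by simp
  show mult: "\<phi> (a * b) = \<phi> a * \<phi> b" for a b using ring_hom_mult[OF assms, of a b] by simp
  show one: "\<phi> 1 = 1" using ring_hom_one[OF assms] by simp
  show zero: "\<phi> 0 = 0" using add[of 0 0] by simp
  have nat: "\<phi> (of_nat m) = of_nat m" for m by (induction m) (simp_all add: zero one add)
  have "\<phi> (- x) = - \<phi> x" for x using add[of x "- x"] zero by (simp add: eq_neg_iff_add_eq_0 add.commute)
  then show "\<phi> (of_int n) = of_int n"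
    by (cases n rule: int_cases2) (simp_all add: nat)
qed

lemma pair_ring_ideal: "ideal (bilinear_relations (UZ_module D) Z_module) (pair_ring D)"
proof (rule idealI[OF pair_ring_ring])
  show "subgroup (bilinear_relations (UZ_module D) Z_module) (add_monoid (pair_ring D))"
    using submodule.axioms(1)[OF bilinear_relations_submodule[of "UZ_module D" Z_module]]
    by (simp add: pair_ring_def free_module_def subgroup_def m_inv_def)
qed (simp_all add: pair_mult_bilinear_relations)

lemma UK_eq: "UK D = pair_ring D Quot bilinear_relations (UZ_module D) Z_module"
  by (simp add: UK_def pair_ring_def)

lemma UK_ring: "ring (UK D)"
  unfolding UK_eq by (rule ideal.quotient_is_ring[OF pair_ring_ideal])

lemma UK_class_eq_coset: "UK_class D f = bilinear_relations (UZ_module D) Z_module +>\<^bsub>pair_ring D\<^esub> f"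
  by (simp add: UK_class_def tensor2_class_def a_r_coset_def r_coset_def pair_ring_def free_module_def)

lemma UK_class_hom: "UK_class D \<in> ring_hom (pair_ring D) (UK D)"
  using ideal.rcos_ring_hom[OF pair_ring_ideal[of D]] by (simp add: UK_eq UK_class_eq_coset[abs_def])

lemma UK_class_eq_iff:
  assumes "supp f \<subseteq> UZ D \<times> UNIV" "supp g \<subseteq> UZ D \<times> UNIV"
  shows "UK_class D f = UK_class D g \<longleftrightarrow> f - g \<in> bilinear_relations (UZ_module D) Z_module"
  unfolding UK_class_def using assms by (intro tensor2_class_eq_iff) simp_all

lemma UK_carrier: "carrier (UK D) = UK_class D ` {f. supp f \<subseteq> UZ D \<times> UNIV}"
  by (auto simp: UK_eq FactRing_def A_RCOSETS_def RCOSETS_def UK_class_eq_coset a_r_coset_def pair_ring_def)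

lemma UK_class_simps:
  assumes "supp f \<subseteq> UZ D \<times> UNIV"
  shows "UK_class D f \<in> carrier (UK D)"
    "supp g \<subseteq> UZ D \<times> UNIV \<Longrightarrow> UK_class D (f + g) = UK_class D f \<oplus>\<^bsub>UK D\<^esub> UK_class D g"
    "supp g \<subseteq> UZ D \<times> UNIV \<Longrightarrow> UK_class D (pair_mult f g) = UK_class D f \<otimes>\<^bsub>UK D\<^esub> UK_class D g"
  using assms ring_hom_closed[OF UK_class_hom, of f D] ring_hom_add[OF UK_class_hom, of f D g]
    ring_hom_mult[OF UK_class_hom, of f D g] by simp_all

lemma UK_class_one: "UK_class D (single (1, 1) 1) = \<one>\<^bsub>UK D\<^esub>"
  using ring_hom_one[OF UK_class_hom] by simp

lemma UK_class_zero: "UK_class D 0 = \<zero>\<^bsub>UK D\<^esub>"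
  using ring_hom_zero[OF UK_class_hom pair_ring_ring UK_ring] by simp

lemma UK_mem: "u \<in> UZ D \<Longrightarrow> supp (single (u, c) n) \<subseteq> UZ D \<times> UNIV"
  by (rule keys_single_subset) simp

lemma UK_of_closed: "u \<in> UZ D \<Longrightarrow> UK_of D u \<in> carrier (UK D)"
  unfolding UK_of_def by (intro UK_class_simps UK_mem)

lemma UK_of_add:
  assumes "u \<in> UZ D" "w \<in> UZ D"
  shows "UK_of D (u + w) = UK_of D u \<oplus>\<^bsub>UK D\<^esub> UK_of D w"
proof -
  have "UK_class D (single (u + w, 1) 1) = UK_class D (single (u, 1) 1 + single (w, 1) 1)"
    using tensor2_add_left[of u "UZ_module D" w 1 Z_module 1] assms
    by (subst UK_class_eq_iff) (intro UK_mem keys_add_subset UZ.add assms | simp add: UZ.add diff_diff_eq)+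
  then show ?thesis using assms by (simp add: UK_of_def UK_class_simps(2) UK_mem)
qed

lemma UK_of_mult:
  assumes "u \<in> UZ D" "w \<in> UZ D"
  shows "UK_of D (u * w) = UK_of D u \<otimes>\<^bsub>UK D\<^esub> UK_of D w"
  using UK_class_simps(3)[OF UK_mem[OF assms(1)] UK_mem[OF assms(2)], of 1 1 1 1] by (simp add: UK_of_def)

lemma UK_of_one: "UK_of D 1 = \<one>\<^bsub>UK D\<^esub>"
  by (simp add: UK_of_def UK_class_one)

lemma UK_of_scalar:
  assumes "u \<in> UZ D"
  shows "UK_of D u \<otimes>\<^bsub>UK D\<^esub> UK_scalar D c = UK_class D (single (u, c) 1)"
    and "UK_scalar D c \<otimes>\<^bsub>UK D\<^esub> UK_of D u = UK_class D (single (u, c) 1)"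
  using UK_class_simps(3)[OF UK_mem[OF assms] UK_mem[OF UZ.one], of 1 1 c 1]
    UK_class_simps(3)[OF UK_mem[OF UZ.one] UK_mem[OF assms], of c 1 1 1]
  by (simp_all add: UK_of_def UK_scalar_def)

lemma UK_scalar_hom: "UK_scalar D \<in> ring_hom (TR :: 'k::comm_ring_1 ring) (UK D)"
proof (rule ring_hom_memI)
  fix c d :: 'k
  show "UK_scalar D c \<in> carrier (UK D)" unfolding UK_scalar_def by (intro UK_class_simps UK_mem UZ.one)
  show "UK_scalar D (c \<otimes>\<^bsub>TR\<^esub> d) = UK_scalar D c \<otimes>\<^bsub>UK D\<^esub> UK_scalar D d"
    using UK_class_simps(3)[OF UK_mem[OF UZ.one] UK_mem[OF UZ.one], of D c 1 d 1] by (simp add: UK_scalar_def)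
  have "UK_class D (single (1, c + d) 1) = UK_class D (single (1, c) 1 + single (1, d) 1)"
    using tensor2_add_right[of 1 "UZ_module D" c Z_module d 1]
    by (subst UK_class_eq_iff) (intro UK_mem keys_add_subset UZ.one | simp add: UZ.one diff_diff_eq)+
  then show "UK_scalar D (c \<oplus>\<^bsub>TR\<^esub> d) = UK_scalar D c \<oplus>\<^bsub>UK D\<^esub> UK_scalar D d"
    by (simp add: UK_scalar_def UK_class_simps(2) UK_mem UZ.one)
next
  show "UK_scalar D \<one>\<^bsub>TR\<^esub> = \<one>\<^bsub>UK D\<^esub>" by (simp add: UK_scalar_def UK_class_one)
qed

lemma UK_scalar_closed: "UK_scalar D c \<in> carrier (UK D)"
  using ring_hom_closed[OF UK_scalar_hom] by simp

lemma UK_scalar_one: "UK_scalar D 1 = \<one>\<^bsub>UK D\<^esub>"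
  using ring_hom_one[OF UK_scalar_hom] by simp

lemma UK_scalar_zero: "UK_scalar D 0 = \<zero>\<^bsub>UK D\<^esub>"
  by (rule ring_hom_zero[OF UK_scalar_hom TR_ring UK_ring, simplified])

lemma UK_of_zero: "(UK_of D 0 :: ('g::complex_lie_algebra, 'k::comm_ring_1) hyp) = \<zero>\<^bsub>UK D\<^esub>"
proof -
  interpret ring "UK D" by (rule UK_ring)
  let ?z = "UK_of D 0 :: ('g, 'k) hyp"
  have "?z \<oplus>\<^bsub>UK D\<^esub> ?z = ?z" "?z \<in> carrier (UK D)"
    by (rule UK_of_add[OF UZ.zero UZ.zero, unfolded add_0_left, symmetric]) (rule UK_of_closed[OF UZ.zero])
  then show ?thesis using add.r_cancel_one'[of ?z ?z] by simp
qed

lemma UK_of_of_int_mult: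
  assumes "u \<in> UZ D"
  shows "(UK_of D (of_int n * u) :: ('g::complex_lie_algebra, 'k::comm_ring_1) hyp) =
    UK_scalar D (of_int n) \<otimes>\<^bsub>UK D\<^esub> UK_of D u"
proof -
  let ?M = "UZ_module D" and ?N = "Z_module :: (int, 'k) module"
  have "UK_class D (single (of_int n * u, 1) 1) = UK_class D (single (u, 1 :: 'k) n)"
    using tensor2_smult_left[of u ?M n 1 ?N 1] assms UK_mem[OF assms] UK_mem[OF UZ_of_int_mult[OF assms]]
    by (subst UK_class_eq_iff) (simp_all add: UZ_of_int_mult)
  also have "\<dots> = UK_class D (single (u, of_int n) 1)"
    using tensor2_smult_right[of u ?M 1 ?N n 1] assms UK_mem[OF assms]
    by (subst eq_commute, subst UK_class_eq_iff) simp_all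
  also have "\<dots> = UK_scalar D (of_int n) \<otimes>\<^bsub>UK D\<^esub> UK_of D u"
    by (rule UK_of_scalar(2)[OF assms, symmetric])
  finally show ?thesis by (simp only: UK_of_def)
qed

text \<open>The divided powers generate \<open>U\<^sub>\<int>\<close> as a ring, and every element of \<open>U\<^sub>K\<close> is a sum of products \<open>u \<otimes> c\<close>
  of an element of \<open>U\<^sub>\<int>\<close> and a scalar, since integral coefficients can be moved into the scalar.\<close>

lemma UK_induct [consumes 1, case_names divpow scalar add mult]:
  assumes x: "x \<in> carrier (UK D)"
    and divpow: "\<And>\<beta> r n. \<beta> \<in> roots (cartan D) \<Longrightarrow> P (UK_of D (divpow D \<beta> r n))"
    and scalar: "\<And>c. P (UK_scalar D c)"
    and add: "\<And>x y. x \<in> carrier (UK D) \<Longrightarrow> y \<in> carrier (UK D) \<Longrightarrow> P x \<Longrightarrow> P y \<Longrightarrow> P (x \<oplus>\<^bsub>UK D\<^esub> y)"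
    and mult: "\<And>x y. x \<in> carrier (UK D) \<Longrightarrow> y \<in> carrier (UK D) \<Longrightarrow> P x \<Longrightarrow> P y \<Longrightarrow> P (x \<otimes>\<^bsub>UK D\<^esub> y)"
  shows "P x"
proof -
  have of: "P (UK_of D u)" if "u \<in> UZ D" for u
    using that
  proof induction
    case (gen \<beta> r k) then show ?case by (rule divpow)
  next
    case zero show ?case using scalar[of 0] by (simp add: UK_of_zero UK_scalar_zero)
  next
    case one show ?case using scalar[of 1] by (simp add: UK_of_one UK_scalar_one)
  next
    case (add u w) then show ?case using assms(4) by (simp add: UK_of_add UK_of_closed)
  next
    case (uminus u)
    then show ?case
      using assms(5)[OF UK_scalar_closed UK_of_closed[OF uminus.hyps] scalar uminus.IH, of "of_int (- 1)"]
      by (simp only: UK_of_of_int_mult[symmetric]) simp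
  next
    case (mult u w) then show ?case using assms(5) by (simp add: UK_of_mult UK_of_closed)
  qed
  obtain f where f: "supp f \<subseteq> UZ D \<times> UNIV" "x = UK_class D f"
    using x by (auto simp: UK_carrier)
  have "P (UK_class D f)"
    using f(1)
  proof (induction rule: free_module_induct)
    case zero
    show ?case using scalar[of 0] by (simp add: UK_class_zero UK_scalar_zero)
  next
    case (single b n)
    then obtain u c where b: "b = (u, c)" "u \<in> UZ D" by auto
    have "UK_class D (single (u, c) n) = UK_class D (single (u, of_int n * c) 1)"
      using tensor2_smult_right[of u "UZ_module D" c Z_module n 1] b UK_mem[OF b(2)]
      by (subst eq_commute, subst UK_class_eq_iff) simp_all
    then show ?case
      using assms(5)[OF UK_of_closed[OF b(2)] UK_scalar_closed of[OF b(2)] scalar] b by (simp add: UK_of_scalar)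
  next
    case (add f g)
    then show ?case using assms(4) by (simp add: UK_class_simps)
  qed
  with f(2) show ?thesis by simp
qed

section \<open>Change of the coefficient ring\<close>

text \<open>\<open>u \<otimes> c \<mapsto> u \<otimes> \<phi> c\<close> on representatives.\<close>

definition push :: "('k \<Rightarrow> 'l) \<Rightarrow> ('u \<times> 'k \<Rightarrow>\<^sub>0 int) \<Rightarrow> ('u \<times> 'l \<Rightarrow>\<^sub>0 int)" where
  "push \<phi> = add_ext (\<lambda>p m. single (fst p, \<phi> (snd p)) m)"

lemma push_simps:
  "push \<phi> (f + g) = push \<phi> f + push \<phi> g" "push \<phi> (single p m) = single (fst p, \<phi> (snd p)) m"
  "push \<phi> 0 = 0"
  by (simp_all add: push_def add_ext_add add_ext_single single_add) (simp add: add_ext_def)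

lemma push_smult: "push \<phi> (scale c f) = scale c (push \<phi> f)"
  by (induction f rule: poly_mapping_add_induct) (simp_all add: push_simps map_mult_simps)

lemma push_keys: "supp f \<subseteq> A \<times> UNIV \<Longrightarrow> supp (push \<phi> f) \<subseteq> A \<times> UNIV"
proof (induction rule: free_module_induct)
  case (single b c) then show ?case unfolding push_simps by (intro keys_single_subset) auto
qed (simp_all add: push_simps keys_add_subset)

lemma push_mult:
  assumes "\<And>a b. \<phi> (a * b) = \<phi> a * \<phi> b"
  shows "push \<phi> (pair_mult f g) = pair_mult (push \<phi> f) (push \<phi> g)"
proof (induction f rule: poly_mapping_add_induct)
  case (single p m)
  show ?case
    by (induction g rule: poly_mapping_add_induct) (simp_all add: push_simps pair_mult_add_right assms)
qed (simp_all add: push_simps pair_mult_add_left)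

lemma UK_map_class:
  fixes f :: "'g::complex_lie_algebra loop uea \<times> 'k::comm_ring_1 \<Rightarrow>\<^sub>0 int"
  assumes \<phi>: "\<phi> \<in> ring_hom (TR :: 'k ring) (TR :: 'l::comm_ring_1 ring)" and f: "supp f \<subseteq> UZ D \<times> UNIV"
  shows "UK_map D \<phi> (UK_class D f) = UK_class D (push \<phi> f)"
proof -
  let ?M = "UZ_module D" and ?N = "Z_module :: (int, 'k) module" and ?N' = "Z_module :: (int, 'l) module"
  let ?g = "\<lambda>f. UK_class D (push \<phi> f)"
  have hom: "?g \<in> lmod_hom TR (free_module (carrier ?M \<times> carrier ?N)) (tensor2 ?M ?N')"
  proof -
    have "push \<phi> \<in> lmod_hom TR (free_module (carrier ?M \<times> carrier ?N)) (free_module (carrier ?M \<times> carrier ?N'))"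
      by (intro lmod_homI) (simp_all add: push_keys push_simps push_smult)
    from lmod_hom_comp[OF this tensor2_class_hom] show ?thesis by (simp add: UK_class_def)
  qed
  have const: "?g f' = ?g f" if "f' \<in> tensor2_class ?M ?N f" for f'
  proof (rule tensor2_hom_constant[OF UZ_module_lmodule Z_module_lmodule tensor2_lmodule hom _ _ _ that])
    show "(\<lambda>x. ?g (single (x, y) 1)) \<in> lmod_hom TR ?M (tensor2 ?M ?N')" for y
      using tensor2_left_hom[OF UZ_module_lmodule Z_module_lmodule, of "\<phi> y" D 1] by (simp add: push_simps UK_class_def)
    have "\<phi> \<in> lmod_hom TR ?N ?N'" by (rule lmod_homI) (simp_all add: TR_hom_simps[OF \<phi>])
    then show "(\<lambda>y. ?g (single (x, y) 1)) \<in> lmod_hom TR ?N (tensor2 ?M ?N')" if "x \<in> carrier ?M" for x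
      using lmod_hom_comp[OF _ tensor2_right_hom[OF UZ_module_lmodule Z_module_lmodule that, of 1]] by (simp add: push_simps UK_class_def)
  qed (use f in simp)
  have "UK_map D \<phi> (UK_class D f) = (\<Union>f'\<in>tensor2_class ?M ?N f. ?g f')"
    by (simp add: UK_map_def push_def add_ext_def UK_class_def)
  also have "\<dots> = ?g f" using f const by (intro tensor2_class_Union) simp_all
  finally show ?thesis .
qed

lemma UK_map_hom:
  fixes D :: "('g::complex_lie_algebra, 'i) chevalley_data"
  assumes \<phi>: "\<phi> \<in> ring_hom (TR :: 'k::comm_ring_1 ring) (TR :: 'l::comm_ring_1 ring)"
  shows "UK_map D \<phi> \<in> ring_hom (UK D) (UK D)"
proof (rule ring_hom_memI)
  fix x y :: "('g, 'k) hyp" assume "x \<in> carrier (UK D)" "y \<in> carrier (UK D)"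
  then obtain f g where *: "supp f \<subseteq> UZ D \<times> UNIV" "supp g \<subseteq> UZ D \<times> UNIV"
      "x = UK_class D f" "y = UK_class D g" by (auto simp: UK_carrier)
  show "UK_map D \<phi> x \<in> carrier (UK D)" using * by (simp add: UK_map_class[OF \<phi>] UK_class_simps push_keys)
  show "UK_map D \<phi> (x \<oplus>\<^bsub>UK D\<^esub> y) = UK_map D \<phi> x \<oplus>\<^bsub>UK D\<^esub> UK_map D \<phi> y"
    using * UK_map_class[OF \<phi>, of "f + g" D] keys_add_subset[of f _ g]
    by (simp add: UK_map_class[OF \<phi>] UK_class_simps push_keys push_simps)
  show "UK_map D \<phi> (x \<otimes>\<^bsub>UK D\<^esub> y) = UK_map D \<phi> x \<otimes>\<^bsub>UK D\<^esub> UK_map D \<phi> y"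
    using * UK_map_class[OF \<phi> pair_mult_keys[OF *(1,2)]]
    by (simp add: UK_map_class[OF \<phi>] UK_class_simps push_keys push_mult TR_hom_simps[OF \<phi>])
next
  show "UK_map D \<phi> \<one>\<^bsub>UK D\<^esub> = \<one>\<^bsub>UK D\<^esub>"
    using UK_map_class[OF \<phi> UK_mem[OF UZ.one, where D = D and c = 1 and n = 1]]
    by (simp add: push_simps UK_class_one TR_hom_simps[OF \<phi>])
qed

lemma UK_map_of:
  assumes "\<phi> \<in> ring_hom (TR :: 'k::comm_ring_1 ring) (TR :: 'l::comm_ring_1 ring)" "u \<in> UZ D"
  shows "UK_map D \<phi> (UK_of D u) = UK_of D u"
  using UK_map_class[OF assms(1) UK_mem[OF assms(2)]] by (simp add: UK_of_def push_simps TR_hom_simps[OF assms(1)])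

lemma UK_map_scalar:
  assumes "\<phi> \<in> ring_hom (TR :: 'k::comm_ring_1 ring) (TR :: 'l::comm_ring_1 ring)"
  shows "UK_map D \<phi> (UK_scalar D c) = UK_scalar D (\<phi> c)"
  using UK_map_class[OF assms(1) UK_mem[OF UZ.one]] by (simp add: UK_scalar_def push_simps)

section \<open>Extension of scalars along a surjection\<close>

lemma residue_map_hom: "is_residue_map \<rho> \<Longrightarrow> \<rho> \<in> ring_hom TR TR"
  by (rule ring_hom_memI) (simp_all add: is_residue_map_def)

lemma of_int_hom: "of_int \<in> ring_hom (TR :: int ring) (TR :: 'k::comm_ring_1 ring)"
  by (rule ring_hom_memI) simp_all

text \<open>\<open>(ker \<rho>) L\<close>; for a residue map this is \<open>L\<close> multiplied by the maximal ideal.\<close>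

definition kernel_multiples :: "('a::comm_ring_1 \<Rightarrow> 'f::comm_ring_1) \<Rightarrow> ('a, 'm) module \<Rightarrow> 'm set" where
  "kernel_multiples \<rho> L = submodule_generated TR L {a \<odot>\<^bsub>L\<^esub> x |a x. \<rho> a = 0 \<and> x \<in> carrier L}"

lemma smult_commute_hom:
  assumes "lmodule TR L"
  shows "(\<lambda>x. c \<odot>\<^bsub>L\<^esub> x) \<in> lmod_hom TR L L"
proof -
  interpret lmodule TR L by fact
  show ?thesis
    using smult_assoc[of c] smult_assoc[of _ c] by (intro lmod_homI) (simp_all add: smult_closed smult_r_distr mult.commute)
qed

text \<open>\<open>x \<otimes> \<rho> a = a x \<otimes> 1\<close>, and \<open>\<rho>\<close> is onto.\<close>

lemma residue_class_surj:
  assumes L: "lmodule TR L" and \<rho>: "\<rho> \<in> ring_hom (TR :: 'a ring) (TR :: 'f::comm_ring_1 ring)" "surj \<rho>"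
    and t: "t \<in> carrier (tensor2 L (module_via (\<rho> :: 'a::comm_ring_1 \<Rightarrow> 'f) UNIV))"
  shows "\<exists>x\<in>carrier L. t = tensor2_class L (module_via \<rho> UNIV) (single (x, 1) 1)"
proof -
  let ?F = "module_via \<rho> UNIV"
  let ?c = "tensor2_class L ?F"
  interpret L: lmodule TR L by fact
  note r = TR_hom_simps[OF \<rho>(1)]
  have F: "lmodule TR ?F" by (rule module_via_lmodule) (simp_all add: r)
  note kh = tensor2_left_hom[OF L F, of 1 1]
  obtain f where f: "supp f \<subseteq> carrier L \<times> UNIV" "t = ?c f"
    using t by (auto simp: tensor2_carrier)
  have "\<exists>x\<in>carrier L. ?c f = ?c (single (x, 1) 1)"
    using f(1)
  proof (induction rule: free_module_induct)
    case zero
    show ?case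
      using lmod_hom_zero[OF L tensor2_lmodule kh] lmod_hom_zero[OF free_module_lmodule tensor2_lmodule tensor2_class_hom, of L ?F]
      by (intro bexI[of _ "\<zero>\<^bsub>L\<^esub>"]) simp_all
  next
    case (single b c)
    then obtain x d where b: "b = (x, d)" "x \<in> carrier L" by auto
    obtain a where a: "\<rho> a = d" using \<rho>(2) by (metis surjD)
    note mem = keys_single_subset[of _ "carrier L \<times> carrier ?F"]
    have "?c (single (x, d) c) = ?c (single (x, 1) (a * c))"
      using tensor2_smult_right[of x L 1 ?F a c] b a by (subst tensor2_class_eq_iff) (intro mem | simp)+
    also have "\<dots> = ?c (single ((a * c) \<odot>\<^bsub>L\<^esub> x, 1) 1)"
      using tensor2_smult_left[of x L "a * c" 1 ?F 1] b L.smult_closed[of "a * c" x]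
      by (subst eq_commute, subst tensor2_class_eq_iff) (intro mem | simp)+
    finally show ?case using b L.smult_closed[of "a * c" x] by auto
  next
    case (add f g)
    then obtain x y where "x \<in> carrier L" "y \<in> carrier L"
      "?c f = ?c (single (x, 1) 1)" "?c g = ?c (single (y, 1) 1)" by auto
    then show ?case
      using lmod_homD(2)[OF kh, of x y] lmod_homD(2)[OF tensor2_class_hom, of f L ?F g] add.hyps
      by (intro bexI[of _ "x \<oplus>\<^bsub>L\<^esub> y"]) simp_all
  qed
  with f(2) show ?thesis by simp
qed

text \<open>Modulo \<open>(ker \<rho>) L\<close>, the class of \<open>a x\<close> depends only on \<open>x\<close> and \<open>\<rho> a\<close>.  Hence \<open>x \<otimes> \<rho> a \<mapsto> a x\<close> is a well-defined
  map from \<open>L \<otimes>\<^sub>A F\<close> to the quotient, and it recovers the class of \<open>x\<close> from \<open>x \<otimes> 1\<close>.\<close>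

lemma residue_class_zero:
  assumes L: "lmodule TR L" and \<rho>: "\<rho> \<in> ring_hom (TR :: 'a ring) (TR :: 'f::comm_ring_1 ring)" "surj \<rho>"
    and x: "x \<in> carrier L"
    and eq: "tensor2_class L (module_via \<rho> UNIV) (single (x, 1) 1) = \<zero>\<^bsub>tensor2 L (module_via (\<rho> :: 'a::comm_ring_1 \<Rightarrow> 'f) UNIV)\<^esub>"
  shows "x \<in> kernel_multiples \<rho> L"
proof -
  let ?F = "module_via \<rho> UNIV"
  interpret L: lmodule TR L by fact
  note r = TR_hom_simps[OF \<rho>(1)]
  have F: "lmodule TR ?F" by (rule module_via_lmodule) (simp_all add: r)
  define N where "N = kernel_multiples \<rho> L"
  have N: "submodule N TR L" unfolding N_def kernel_multiples_def by (rule submodule_generated_submodule[OF L])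
  define P where "P = quotient_module L N"
  define cls where "cls x = N +>\<^bsub>L\<^esub> x" for x
  have P: "lmodule TR P" unfolding P_def by (rule quotient_lmodule[OF L N])
  have cls: "cls \<in> lmod_hom TR L P" unfolding P_def cls_def[abs_def] by (rule quotient_proj_hom[OF L N])
  interpret P: lmodule TR P by (rule P)
  define s where "s d = (SOME a. \<rho> a = d)" for d
  have s: "\<rho> (s d) = d" for d unfolding s_def by (rule someI_ex) (metis \<rho>(2) surjD)
  have indep: "cls (a \<odot>\<^bsub>L\<^esub> x) = cls (a' \<odot>\<^bsub>L\<^esub> x)" if "x \<in> carrier L" "\<rho> a = \<rho> a'" for a a' x
  proof -
    have "a = (a - a') + a'" by simp
    then have "\<rho> (a - a') = 0" using that(2) r(1) by (metis add_cancel_left_left)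
    then have "(a - a') \<odot>\<^bsub>L\<^esub> x \<in> N"
      unfolding N_def kernel_multiples_def using that L.smult_closed[of "a - a'" x] by (intro submodule_generated_base) auto
    moreover have "a \<odot>\<^bsub>L\<^esub> x \<ominus>\<^bsub>L\<^esub> a' \<odot>\<^bsub>L\<^esub> x = (a - a') \<odot>\<^bsub>L\<^esub> x"
      using L.smult_l_distr[of "a - a'" a' x] that(1) L.smult_closed[of _ x]
      by (simp add: a_minus_def L.a_assoc L.r_neg)
    ultimately show ?thesis
      unfolding cls_def using coset_eq_iff[OF L N] that(1) by (simp add: L.smult_closed)
  qed
  obtain g where g: "g \<in> lmod_hom TR (free_module (carrier L \<times> carrier ?F)) P"
      "\<And>x d. x \<in> carrier L \<Longrightarrow> g (single (x, d) 1) = cls (s d \<odot>\<^bsub>L\<^esub> x)"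
    using free_module_universal[OF P, of "carrier L \<times> carrier ?F" "\<lambda>(x, d). cls (s d \<odot>\<^bsub>L\<^esub> x)"]
      lmod_homD(1)[OF cls] L.smult_closed by fastforce
  have l: "(\<lambda>x. g (single (x, y) 1)) \<in> lmod_hom TR L P" for y
    by (rule lmod_hom_cong[OF L lmod_hom_comp[OF smult_commute_hom[OF L, of "s y"] cls]]) (simp add: g(2))
  have m: "(\<lambda>y. g (single (z, y) 1)) \<in> lmod_hom TR ?F P" if z: "z \<in> carrier L" for z
  proof (rule lmod_homI)
    fix y y' a
    show "g (single (z, y) 1) \<in> carrier P" using z by (simp add: g(2) lmod_homD(1)[OF cls] L.smult_closed)
    have "cls (s (y + y') \<odot>\<^bsub>L\<^esub> z) = cls ((s y + s y') \<odot>\<^bsub>L\<^esub> z)" using z by (intro indep) (simp_all add: s r)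
    then show "g (single (z, y \<oplus>\<^bsub>?F\<^esub> y') 1) = g (single (z, y) 1) \<oplus>\<^bsub>P\<^esub> g (single (z, y') 1)"
      using z L.smult_l_distr[of "s y" "s y'" z] by (simp add: g(2) lmod_homD(2)[OF cls] L.smult_closed)
    have "cls (s (\<rho> a * y) \<odot>\<^bsub>L\<^esub> z) = cls ((a * s y) \<odot>\<^bsub>L\<^esub> z)" using z by (intro indep) (simp_all add: s r)
    then show "g (single (z, a \<odot>\<^bsub>?F\<^esub> y) 1) = a \<odot>\<^bsub>P\<^esub> g (single (z, y) 1)"
      using z P.smult_assoc[of a "s y" "cls z"] by (simp add: g(2) lmod_homD(1,3)[OF cls] L.smult_closed)
  qed
  have "single (x, 1) 1 \<in> bilinear_relations L ?F"
    using coset_zero_iff[OF free_module_lmodule bilinear_relations_submodule, of "single (x, 1) 1" L ?F] eq x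
    by (simp add: tensor2_class_def tensor2_def quotient_zero)
  then have "g (single (x, 1) 1) = \<zero>\<^bsub>P\<^esub>"
    using hom_kills_bilinear_relations[OF L F P g(1) l m] by blast
  moreover have "g (single (x, 1) 1) = cls x"
    using indep[OF x, of "s 1" 1] x L.smult_one[OF x] by (simp add: g(2) s r)
  ultimately show ?thesis
    using coset_zero_iff[OF L N x] by (simp add: N_def[symmetric] cls_def P_def quotient_zero)
qed

text \<open>The maps \<open>\<pi>\<close> that identify \<open>W\<close> with \<open>L \<otimes>\<^sub>A F\<close>, with \<open>\<pi> x\<close> in the role of \<open>x \<otimes> 1\<close>.  Semilinearity gives the
  converse of the last clause.\<close>

definition reduction ::
    "('g::complex_lie_algebra, 'i) chevalley_data \<Rightarrow> ('a::comm_ring_1 \<Rightarrow> 'f::comm_ring_1) \<Rightarrow>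
     (('g, 'a) hyp, 'm) module \<Rightarrow> (('g, 'f) hyp, 'n) module \<Rightarrow> ('m \<Rightarrow> 'n) \<Rightarrow> bool" where
  "reduction D \<rho> L W \<pi> \<longleftrightarrow>
     \<pi> \<in> lmod_hom TR (scalars D L) (restrict_scalars \<rho> (scalars D W)) \<and> \<pi> ` carrier L = carrier W \<and>
     (\<forall>u\<in>UZ D. \<forall>x\<in>carrier L. \<pi> (UK_of D u \<odot>\<^bsub>L\<^esub> x) = UK_of D u \<odot>\<^bsub>W\<^esub> \<pi> x) \<and>
     (\<forall>x\<in>carrier L. \<pi> x = \<zero>\<^bsub>W\<^esub> \<longrightarrow> x \<in> kernel_multiples \<rho> (scalars D L))"

lemma scalars_simps [simp]:
  "carrier (scalars D M) = carrier M" "zero (scalars D M) = zero M"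
  "add (scalars D M) = add M" "c \<odot>\<^bsub>scalars D M\<^esub> x = UK_scalar D c \<odot>\<^bsub>M\<^esub> x"
  by (simp_all add: scalars_def)

lemma scalars_lmodule: "lmodule (UK D) M \<Longrightarrow> lmodule TR (scalars D M)"
  unfolding scalars_def by (rule restrict_scalars_lmodule[OF _ TR_ring UK_scalar_hom])

text \<open>A \<open>\<rho>\<close>-semilinear map kills \<open>(ker \<rho>) L\<close>, which is the kernel of a reduction.\<close>

lemma reduction_constant:
  assumes red: "reduction D \<rho> L W \<pi>" and \<rho>: "\<rho> \<in> ring_hom TR TR" and L: "lmodule (UK D) L" and W: "lmodule (UK D) W"
    and N: "lmodule TR N" and g: "g \<in> lmod_hom TR (scalars D L) (restrict_scalars \<rho> N)"
    and x: "x \<in> carrier L" "y \<in> carrier L" "\<pi> x = \<pi> y"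
  shows "g x = g y"
proof -
  note L' = scalars_lmodule[OF L] and N' = restrict_scalars_lmodule[OF N TR_ring \<rho>]
    and W' = restrict_scalars_lmodule[OF scalars_lmodule[OF W] TR_ring \<rho>]
  interpret L: lmodule TR "scalars D L" by (rule L')
  interpret N: lmodule TR N by (rule N)
  interpret N': lmodule TR "restrict_scalars \<rho> N" by (rule N')
  interpret W': lmodule TR "restrict_scalars \<rho> (scalars D W)" by (rule W')
  have \<pi>: "\<pi> \<in> lmod_hom TR (scalars D L) (restrict_scalars \<rho> (scalars D W))" using red by (simp add: reduction_def)
  let ?d = "x \<ominus>\<^bsub>scalars D L\<^esub> y"
  have d: "?d \<in> carrier L" using x L.minus_closed by simp
  have "\<pi> ?d = \<pi> x \<ominus>\<^bsub>restrict_scalars \<rho> (scalars D W)\<^esub> \<pi> y"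
    using lmod_hom_diff[OF L' W' \<pi>] x by simp
  also have "\<dots> = \<zero>\<^bsub>W\<^esub>"
    using x W'.minus_eq_zero_iff[of "\<pi> x" "\<pi> y"] lmod_homD(1)[OF \<pi>] by simp
  finally have "?d \<in> kernel_multiples \<rho> (scalars D L)" using red d by (simp add: reduction_def)
  then have "g ?d = \<zero>\<^bsub>restrict_scalars \<rho> N\<^esub>"
    unfolding kernel_multiples_def
  proof (rule lmod_hom_kills_generated[OF L' N' g, rotated])
    fix z assume "z \<in> {a \<odot>\<^bsub>scalars D L\<^esub> x |a x. \<rho> a = 0 \<and> x \<in> carrier (scalars D L)}"
    then obtain a v where z: "z = a \<odot>\<^bsub>scalars D L\<^esub> v" "\<rho> a = 0" "v \<in> carrier (scalars D L)" by blast
    show "g z = \<zero>\<^bsub>restrict_scalars \<rho> N\<^esub>"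
      unfolding z(1) using z(2,3) lmod_homD(1,3)[OF g] N.smult_zero_left[of "g v"] by simp
  qed
  then have "g x \<ominus>\<^bsub>restrict_scalars \<rho> N\<^esub> g y = \<zero>\<^bsub>restrict_scalars \<rho> N\<^esub>"
    using lmod_hom_diff[OF L' N' g] x by simp
  then show ?thesis
    using N'.minus_eq_zero_iff[of "g x" "g y"] x lmod_homD(1)[OF g] by simp
qed

text \<open>\<open>(u \<otimes> e) (x \<otimes> d) = u x \<otimes> e d\<close> on representatives.\<close>

definition bc_mult ::
    "('g::complex_lie_algebra, 'i) chevalley_data \<Rightarrow> (('g, 'a::comm_ring_1) hyp, 'm) module \<Rightarrow>
     ('g loop uea \<times> 'f \<Rightarrow>\<^sub>0 int) \<Rightarrow> ('m \<times> 'f::comm_ring_1 \<Rightarrow>\<^sub>0 'a) \<Rightarrow> ('m \<times> 'f \<Rightarrow>\<^sub>0 'a)" where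
  "bc_mult D L f g = add_ext (\<lambda>p m. add_ext (\<lambda>q n.
     single (UK_of D (fst p) \<odot>\<^bsub>L\<^esub> fst q, snd p * snd q) (of_int m * n)) g) f"

lemma bc_mult_add:
  "bc_mult D L (f + f') g = bc_mult D L f g + bc_mult D L f' g"
  "bc_mult D L f (g + g') = bc_mult D L f g + bc_mult D L f g'"
  unfolding bc_mult_def
  by (subst add_ext_add; simp add: single_add distrib_right distrib_left add_ext_def sum.distrib)+

lemma bc_mult_simps:
  "bc_mult D L 0 g = 0" "bc_mult D L f 0 = 0"
  "bc_mult D L (single p m) (single q n) =
     single (UK_of D (fst p) \<odot>\<^bsub>L\<^esub> fst q, snd p * snd q) (of_int m * n)"
proof -
  show "bc_mult D L 0 g = 0" "bc_mult D L f 0 = 0"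
    by (simp_all add: bc_mult_def add_ext_def)
  show "bc_mult D L (single p m) (single q n) =
     single (UK_of D (fst p) \<odot>\<^bsub>L\<^esub> fst q, snd p * snd q) (of_int m * n)"
    by (cases "m = 0"; cases "n = 0") (simp_all add: bc_mult_def add_ext_def)
qed

lemma bc_mult_diff:
  "bc_mult D L (f - f') g = bc_mult D L f g - bc_mult D L f' g"
  "bc_mult D L f (g - g') = bc_mult D L f g - bc_mult D L f g'"
  using bc_mult_add(1)[of D L "f - f'" f' g] bc_mult_add(2)[of D L f "g - g'" g']
  by (simp_all add: eq_diff_eq)

lemma bc_mult_smult:
  "bc_mult D L (scale z f) g = scale (of_int z) (bc_mult D L f g)"
  "bc_mult D L f (scale c g) = scale c (bc_mult D L f g)"
proof -
  have 1: "bc_mult D L (single p (z * m)) g =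
      scale (of_int z) (bc_mult D L (single p m) g) \<and>
    bc_mult D L (single p m) (scale c g) =
      scale c (bc_mult D L (single p m) g)" for p m
    by (induction g rule: poly_mapping_add_induct)
      (simp_all add: map_mult_simps bc_mult_add bc_mult_simps mult.left_commute mult.assoc)
  have "bc_mult D L (scale z f) g = scale (of_int z) (bc_mult D L f g) \<and>
    bc_mult D L f (scale c g) = scale c (bc_mult D L f g)"
    by (induction f rule: poly_mapping_add_induct)
      (simp_all add: 1 map_mult_simps bc_mult_add bc_mult_simps)
  then show "bc_mult D L (scale z f) g = scale (of_int z) (bc_mult D L f g)"
    "bc_mult D L f (scale c g) = scale c (bc_mult D L f g)" by auto
qed

lemma UK_of_smult_hom:
  fixes L :: "(('g::complex_lie_algebra, 'a::comm_ring_1) hyp, 'm) module"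
  assumes L: "lmodule (UK D) L" and u: "u \<in> UZ D"
  shows "(\<lambda>x. UK_of D u \<odot>\<^bsub>L\<^esub> x) \<in> lmod_hom TR (scalars D L) (scalars D L)"
proof -
  interpret L: lmodule "UK D" L by (rule L)
  show ?thesis
  proof (rule lmod_homI)
    fix x and a :: 'a assume x: "x \<in> carrier (scalars D L)"
    have "UK_of D u \<otimes>\<^bsub>UK D\<^esub> UK_scalar D a = UK_scalar D a \<otimes>\<^bsub>UK D\<^esub> UK_of D u"
      by (simp add: UK_of_scalar[OF u])
    then show "UK_of D u \<odot>\<^bsub>L\<^esub> (a \<odot>\<^bsub>scalars D L\<^esub> x) = a \<odot>\<^bsub>scalars D L\<^esub> (UK_of D u \<odot>\<^bsub>L\<^esub> x)"
      using x u by (simp add: UK_of_closed UK_scalar_closed flip: L.smult_assoc)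
  qed (use u in \<open>simp_all add: UK_of_closed L.smult_closed L.smult_r_distr\<close>)
qed

lemma smult_UK_of_hom:
  assumes L: "lmodule (UK D) L" and x: "x \<in> carrier L"
  shows "(\<lambda>u. UK_of D u \<odot>\<^bsub>L\<^esub> x) \<in> lmod_hom TR (UZ_module D) (restrict_scalars of_int (scalars D L))"
proof -
  interpret L: lmodule "UK D" L by (rule L)
  show ?thesis
  proof (rule lmod_homI)
    fix u and n :: int assume "u \<in> carrier (UZ_module D)"
    then show "UK_of D (n \<odot>\<^bsub>UZ_module D\<^esub> u) \<odot>\<^bsub>L\<^esub> x = n \<odot>\<^bsub>restrict_scalars of_int (scalars D L)\<^esub> (UK_of D u \<odot>\<^bsub>L\<^esub> x)"
      using x by (simp add: UK_of_of_int_mult UK_of_closed UK_scalar_closed L.smult_assoc)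
  qed (use x in \<open>simp_all add: UK_of_closed L.smult_closed UK_of_add L.smult_l_distr\<close>)
qed

context
  fixes D :: "('g::complex_lie_algebra, 'i) chevalley_data"
    and L :: "(('g, 'a::comm_ring_1) hyp, 'm) module"
    and \<rho> :: "'a \<Rightarrow> 'f::comm_ring_1"
  assumes L: "lmodule (UK D) L" and \<rho>: "\<rho> \<in> ring_hom TR TR"
begin

interpretation L: lmodule "UK D" L by (rule L)

abbreviation (input) "F \<equiv> module_via \<rho> UNIV"
abbreviation (input) "cl \<equiv> tensor2_class (scalars D L) F"

lemma F_lmodule: "lmodule TR F"
  by (rule module_via_lmodule) (simp_all add: TR_hom_simps[OF \<rho>])

lemma bc_mult_keys:
  assumes "supp f \<subseteq> UZ D \<times> UNIV" "supp g \<subseteq> carrier L \<times> UNIV"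
  shows "supp (bc_mult D L f g :: ('m \<times> 'f \<Rightarrow>\<^sub>0 'a)) \<subseteq> carrier L \<times> UNIV"
  using assms(1)
proof (induction rule: free_module_induct)
  case (single b c)
  show ?case
    using assms(2)
  proof (induction rule: free_module_induct)
    case (single b' c')
    then show ?case
      using \<open>b \<in> UZ D \<times> UNIV\<close> unfolding bc_mult_simps
      by (intro keys_single_subset) (auto simp: L.smult_closed UK_of_closed)
  qed (simp_all add: bc_mult_add bc_mult_simps keys_add_subset)
qed (simp_all add: bc_mult_add bc_mult_simps keys_add_subset)

text \<open>This lemma and the next one say that the action on representatives respects the relations in
  each of its arguments.  For the first argument fixed, it is \<open>A\<close>-bilinear in \<open>(x, d)\<close> because \<open>U\<^sub>\<int>\<close>
  commutes with the scalars; for the second one fixed, it is only \<open>\<int>\<close>-bilinear in \<open>(u, e)\<close>, whence the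
  restriction of scalars to \<open>\<int>\<close>.\<close>

lemma bc_mult_relations_right:
  assumes g: "g \<in> bilinear_relations (scalars D L) F" and u: "u \<in> UZ D"
  shows "bc_mult D L (single (u, e) n) g \<in> bilinear_relations (scalars D L) F"
proof -
  let ?V = "tensor2 (scalars D L) F" and ?b = "bc_mult D L (single (u, e) n)"
  note L' = scalars_lmodule[OF L]
  have "cl (?b g) = \<zero>\<^bsub>?V\<^esub>"
  proof (rule hom_kills_bilinear_relations[OF L' F_lmodule tensor2_lmodule _ _ _ g])
    have "?b \<in> lmod_hom TR (free_module (carrier (scalars D L) \<times> carrier F)) (free_module (carrier (scalars D L) \<times> carrier F))"
      using bc_mult_keys[OF UK_mem[OF u]]
      by (intro lmod_homI) (simp_all add: bc_mult_add bc_mult_smult)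
    from lmod_hom_comp[OF this tensor2_class_hom]
    show "(\<lambda>g. cl (?b g)) \<in> lmod_hom TR (free_module (carrier (scalars D L) \<times> carrier F)) ?V" .
    show "(\<lambda>x. cl (?b (single (x, y) 1))) \<in> lmod_hom TR (scalars D L) ?V" for y
      using lmod_hom_comp[OF UK_of_smult_hom[OF L u] tensor2_left_hom[OF L' F_lmodule, of "e * y" "of_int n"]]
      by (simp add: bc_mult_simps)
    have "(\<lambda>y. e * y) \<in> lmod_hom TR F F" by (rule lmod_homI) (simp_all add: algebra_simps)
    then show "(\<lambda>y. cl (?b (single (x, y) 1))) \<in> lmod_hom TR F ?V" if "x \<in> carrier (scalars D L)" for x
      using lmod_hom_comp[OF _ tensor2_right_hom[OF L' F_lmodule, of "UK_of D u \<odot>\<^bsub>L\<^esub> x" "of_int n"]] that u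
      by (simp add: bc_mult_simps L.smult_closed UK_of_closed)
  qed
  moreover have "supp (?b g) \<subseteq> carrier L \<times> UNIV"
    using subsetD[OF submodule_subset[OF bilinear_relations_submodule] g]
    by (intro bc_mult_keys UK_mem u) simp
  ultimately show ?thesis
    using coset_zero_iff[OF free_module_lmodule bilinear_relations_submodule, of "?b g" "scalars D L" F]
    by (simp add: tensor2_class_def tensor2_def quotient_zero)
qed

lemma bc_mult_relations_left:
  assumes f: "f \<in> bilinear_relations (UZ_module D) Z_module" and g: "supp g \<subseteq> carrier L \<times> UNIV"
  shows "bc_mult D L f g \<in> bilinear_relations (scalars D L) F"
proof -
  let ?V = "tensor2 (scalars D L) F"
  let ?P = "restrict_scalars of_int ?V"
  note L' = scalars_lmodule[OF L]
  have P: "lmodule TR ?P" by (rule restrict_scalars_lmodule[OF tensor2_lmodule TR_ring of_int_hom])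
  have fk: "supp f \<subseteq> UZ D \<times> UNIV"
    using subsetD[OF submodule_subset[OF bilinear_relations_submodule] f] by simp
  have "cl (bc_mult D L f g) = \<zero>\<^bsub>?V\<^esub>"
    using g
  proof (induction rule: free_module_induct)
    case zero
    then show ?case
      using lmod_hom_zero[OF free_module_lmodule tensor2_lmodule tensor2_class_hom, of "scalars D L" F]
      by (simp add: bc_mult_simps)
  next
    case (single b c)
    then obtain x d where b: "b = (x, d)" "x \<in> carrier L" by auto
    let ?b = "\<lambda>f. bc_mult D L f (single b c)"
    have "cl (?b f) = \<zero>\<^bsub>?P\<^esub>"
    proof (rule hom_kills_bilinear_relations[OF UZ_module_lmodule Z_module_lmodule P _ _ _ f])
      show "(\<lambda>f. cl (?b f)) \<in> lmod_hom TR (free_module (carrier (UZ_module D) \<times> carrier Z_module)) ?P"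
        using bc_mult_keys[OF _ keys_single_subset[OF single]] lmod_homD[OF tensor2_class_hom[of "scalars D L" F]]
        by (intro lmod_homI) (simp_all add: bc_mult_add bc_mult_smult)
      show "(\<lambda>u. cl (?b (single (u, e) 1))) \<in> lmod_hom TR (UZ_module D) ?P" for e
        using lmod_hom_comp[OF smult_UK_of_hom[OF L b(2)] restrict_scalars_hom[OF tensor2_left_hom[OF L' F_lmodule, of "e * d" c] of_int_hom]]
        by (simp add: bc_mult_simps b)
      have "(\<lambda>e. e * d) \<in> lmod_hom TR Z_module (restrict_scalars of_int F)"
        by (rule lmod_homI) (simp_all add: algebra_simps TR_hom_simps[OF \<rho>])
      then show "(\<lambda>e. cl (?b (single (u, e) 1))) \<in> lmod_hom TR Z_module ?P" if "u \<in> carrier (UZ_module D)" for u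
        using lmod_hom_comp[OF _ restrict_scalars_hom[OF tensor2_right_hom[OF L' F_lmodule, of "UK_of D u \<odot>\<^bsub>L\<^esub> x" c] of_int_hom]] that b
        by (simp add: bc_mult_simps L.smult_closed UK_of_closed)
    qed
    then show ?case by simp
  next
    case (add g g')
    interpret T: lmodule TR "tensor2 (scalars D L) F" by (rule tensor2_lmodule)
    show ?case
      using add fk bc_mult_keys lmod_homD(2)[OF tensor2_class_hom, of _ "scalars D L" F]
      by (simp add: bc_mult_add)
  qed
  then show ?thesis
    using coset_zero_iff[OF free_module_lmodule bilinear_relations_submodule, of "bc_mult D L f g" "scalars D L" F]
      bc_mult_keys[OF fk g]
    by (simp add: tensor2_class_def tensor2_def quotient_zero)
qed

lemma base_change_smult:
  assumes u: "u \<in> UZ D" and x: "x \<in> carrier L"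
  shows "UK_class D (single (u, e) 1) \<odot>\<^bsub>base_change D \<rho> L\<^esub> cl (single (x, d) 1) =
    cl (single (UK_of D u \<odot>\<^bsub>L\<^esub> x, e * d) 1)"
proof -
  let ?f = "single (u, e) 1" and ?g = "single (x, d) 1"
  let ?A = "tensor2_class (UZ_module D) Z_module ?f" and ?B = "cl ?g"
  have fk: "supp ?f \<subseteq> carrier (UZ_module D) \<times> carrier Z_module" using u by (intro keys_single_subset) simp
  have gk: "supp ?g \<subseteq> carrier (scalars D L) \<times> carrier F" using x by (intro keys_single_subset) simp
  have const: "cl (bc_mult D L f g) = cl (bc_mult D L ?f ?g)" if "f \<in> ?A" "g \<in> ?B" for f g
  proof -
    note f = tensor2_class_member(2,3)[OF fk that(1)] and g = tensor2_class_member(2,3)[OF gk that(2)]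
    have "f - ?f \<in> bilinear_relations (UZ_module D) Z_module" "g - ?g \<in> bilinear_relations (scalars D L) F"
      using f g tensor2_class_eq_iff fk gk by blast+
    then have "bc_mult D L (f - ?f) g + bc_mult D L ?f (g - ?g) \<in> bilinear_relations (scalars D L) F"
      using bc_mult_relations_left[of "f - ?f" g] bc_mult_relations_right[of "g - ?g" u e 1] u g(1)
        submodule_add[OF bilinear_relations_submodule, of _ "scalars D L" F] by simp
    moreover have "bc_mult D L (f - ?f) g + bc_mult D L ?f (g - ?g) =
        bc_mult D L f g - bc_mult D L ?f ?g"
      by (simp only: bc_mult_diff) simp
    ultimately have "bc_mult D L f g - bc_mult D L ?f ?g \<in> bilinear_relations (scalars D L) F"
      by (simp only:)
    moreover have "supp (bc_mult D L f g) \<subseteq> carrier (scalars D L) \<times> carrier F"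
      using bc_mult_keys[of f g] f(1) g(1) by simp
    moreover have "supp (bc_mult D L ?f ?g) \<subseteq> carrier (scalars D L) \<times> carrier F"
      using gk unfolding scalars_simps module_via_simps by (rule bc_mult_keys[OF UK_mem[OF u]])
    ultimately show ?thesis
      by (simp only: tensor2_class_eq_iff)
  qed
  have "UK_class D ?f \<odot>\<^bsub>base_change D \<rho> L\<^esub> ?B = (\<Union>f\<in>?A. \<Union>g\<in>?B. cl (bc_mult D L f g))"
    by (simp add: base_change_def Let_def UK_class_def bc_mult_def add_ext_def)
  also have "\<dots> = cl (bc_mult D L ?f ?g)"
    using tensor2_class_member(1)[OF fk] tensor2_class_member(1)[OF gk] const by (intro SUP_eq_const) blast+
  finally show ?thesis by (simp add: bc_mult_simps)
qed

text \<open>An isomorphism \<open>L \<otimes>\<^sub>A F \<cong> W\<close> thus yields a reduction map \<open>x \<mapsto> x \<otimes> 1\<close>.\<close>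

lemma base_change_iso_reduction:
  assumes \<psi>: "\<psi> \<in> lmod_iso (UK D) (base_change D \<rho> L) W" and surj: "surj \<rho>" and W: "lmodule (UK D) W"
  shows "reduction D \<rho> L W (\<lambda>x. \<psi> (cl (single (x, 1) 1)))"
proof -
  let ?k = "\<lambda>x. cl (single (x, 1) 1)" and ?B = "base_change D \<rho> L" and ?V = "tensor2 (scalars D L) F"
  note L' = scalars_lmodule[OF L]
  have B: "carrier ?B = carrier ?V" "add ?B = add ?V" "zero ?B = zero ?V"
    by (simp_all add: base_change_def Let_def)
  have hom: "\<psi> \<in> lmod_hom (UK D) ?B W" and bij: "bij_betw \<psi> (carrier ?B) (carrier W)"
    using \<psi> by (auto simp: lmod_iso_def)
  have kh: "?k \<in> lmod_hom TR (scalars D L) ?V" by (rule tensor2_left_hom[OF L' F_lmodule]) simp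
  have kc: "?k x \<in> carrier ?B" if "x \<in> carrier L" for x using lmod_homD(1)[OF kh] that by (simp add: B)
  have of: "UK_of D u \<odot>\<^bsub>?B\<^esub> ?k x = ?k (UK_of D u \<odot>\<^bsub>L\<^esub> x)" if "u \<in> UZ D" "x \<in> carrier L" for u x
    using base_change_smult[OF that, of 1 1] by (simp add: UK_of_def)
  have scalar: "UK_scalar D (\<rho> a) \<odot>\<^bsub>?B\<^esub> ?k x = ?k (UK_scalar D a \<odot>\<^bsub>L\<^esub> x)" if x: "x \<in> carrier L" for a x
  proof -
    have "UK_scalar D (\<rho> a) \<odot>\<^bsub>?B\<^esub> ?k x = cl (single (x, \<rho> a) 1)"
      using base_change_smult[OF UZ.one x, of "\<rho> a" 1] x by (simp add: UK_scalar_def UK_of_one L.smult_one)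
    also have "\<dots> = a \<odot>\<^bsub>?V\<^esub> ?k x"
      using lmod_homD(3)[OF tensor2_right_hom[OF L' F_lmodule, of x 1], of a 1] x by simp
    also have "\<dots> = ?k (UK_scalar D a \<odot>\<^bsub>L\<^esub> x)" using lmod_homD(3)[OF kh, of a x] x by simp
    finally show ?thesis .
  qed
  show ?thesis
    unfolding reduction_def
  proof (intro conjI ballI impI)
    show "(\<lambda>x. \<psi> (?k x)) \<in> lmod_hom TR (scalars D L) (restrict_scalars \<rho> (scalars D W))"
    proof (rule lmod_homI)
      fix x y and a :: 'a assume xy: "x \<in> carrier (scalars D L)" "y \<in> carrier (scalars D L)"
      show "\<psi> (?k (x \<oplus>\<^bsub>scalars D L\<^esub> y)) = \<psi> (?k x) \<oplus>\<^bsub>restrict_scalars \<rho> (scalars D W)\<^esub> \<psi> (?k y)"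
        using xy lmod_homD(2)[OF kh xy] lmod_homD(2)[OF hom kc kc, of x y] by (simp add: B)
    next
      fix x and a :: 'a assume x: "x \<in> carrier (scalars D L)"
      show "\<psi> (?k x) \<in> carrier (restrict_scalars \<rho> (scalars D W))"
        using x kc lmod_homD(1)[OF hom] by simp
      show "\<psi> (?k (a \<odot>\<^bsub>scalars D L\<^esub> x)) = a \<odot>\<^bsub>restrict_scalars \<rho> (scalars D W)\<^esub> \<psi> (?k x)"
        using x scalar[of x a] lmod_homD(3)[OF hom UK_scalar_closed kc, of x "\<rho> a"] by simp
    qed
    have "?k ` carrier L = carrier ?B"
      using residue_class_surj[OF L' \<rho> surj] kc by (auto simp: B image_iff)
    then show "(\<lambda>x. \<psi> (?k x)) ` carrier L = carrier W"
      using bij by (metis bij_betw_imp_surj_on image_image)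
    show "\<psi> (?k (UK_of D u \<odot>\<^bsub>L\<^esub> x)) = UK_of D u \<odot>\<^bsub>W\<^esub> \<psi> (?k x)" if "u \<in> UZ D" "x \<in> carrier L" for u x
      using that of lmod_homD(3)[OF hom UK_of_closed kc] by metis
    fix x assume x: "x \<in> carrier L" "\<psi> (?k x) = \<zero>\<^bsub>W\<^esub>"
    interpret W: lmodule "UK D" W by (rule W)
    interpret V: lmodule TR ?V by (rule tensor2_lmodule)
    have zB: "\<zero>\<^bsub>?V\<^esub> \<in> carrier ?B" by (simp add: B)
    have "\<psi> \<zero>\<^bsub>?V\<^esub> \<oplus>\<^bsub>W\<^esub> \<psi> \<zero>\<^bsub>?V\<^esub> = \<psi> \<zero>\<^bsub>?V\<^esub>"
      using lmod_homD(2)[OF hom zB zB] by (simp add: B)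
    then have "\<psi> \<zero>\<^bsub>?V\<^esub> = \<zero>\<^bsub>W\<^esub>"
      using W.add.r_cancel_one'[of "\<psi> \<zero>\<^bsub>?V\<^esub>" "\<psi> \<zero>\<^bsub>?V\<^esub>"] lmod_homD(1)[OF hom zB] by simp
    then have "?k x = \<zero>\<^bsub>?V\<^esub>"
      using bij zB kc[OF x(1)] x(2) by (metis bij_betw_imp_inj_on inj_onD)
    then show "x \<in> kernel_multiples \<rho> (scalars D L)"
      using residue_class_zero[OF L' \<rho> surj] x(1) by simp
  qed
qed

end

section \<open>Multilinear maps and module structures on tensor products\<close>

lemma multilinearD:
  assumes "multilinear k Ms N h"
  shows "w \<in> tuples k Ms \<Longrightarrow> h w \<in> carrier N"
    "w \<in> tuples k Ms \<Longrightarrow> j < k \<Longrightarrow> (\<lambda>x. h (w(j := x))) \<in> lmod_hom TR (Ms j) N"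
  using assms by (simp_all add: multilinear_def)

lemma multilinear_comp_hom:
  assumes "multilinear k Ms N h" "g \<in> lmod_hom TR N P"
  shows "multilinear k Ms P (\<lambda>w. g (h w))"
  unfolding multilinear_def
  using lmod_hom_comp[OF multilinearD(2)[OF assms(1)] assms(2)] multilinearD(1)[OF assms(1)] lmod_homD(1)[OF assms(2)]
  by blast

lemma tuples_map:
  assumes "\<And>j. j < k \<Longrightarrow> f j \<in> lmod_hom R (As j) (Bs j)" "w \<in> tuples k As"
  shows "restrict (\<lambda>j. f j (w j)) {..<k} \<in> tuples k Bs"
  using assms lmod_homD(1)[OF assms(1)] by (intro restrict_in_tuples) (auto dest: tuples_component)

lemma multilinear_map:
  assumes h: "multilinear k Bs N h" and f: "\<And>j. j < k \<Longrightarrow> f j \<in> lmod_hom TR (As j) (Bs j)"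
  shows "multilinear k As N (\<lambda>w. h (restrict (\<lambda>j. f j (w j)) {..<k}))"
  unfolding multilinear_def
proof (intro conjI ballI allI impI)
  fix w assume w: "w \<in> tuples k As"
  let ?w = "restrict (\<lambda>j. f j (w j)) {..<k}"
  have w': "?w \<in> tuples k Bs" using tuples_map[OF f w] .
  then show "h ?w \<in> carrier N" by (rule multilinearD(1)[OF h])
  fix j assume j: "j < k"
  have "(\<lambda>x. h (?w(j := f j x))) \<in> lmod_hom TR (As j) N"
    using lmod_hom_comp[OF f[OF j] multilinearD(2)[OF h w' j]] .
  moreover have "restrict (\<lambda>i. f i ((w(j := x)) i)) {..<k} = ?w(j := f j x)" for x
    using j by (auto simp: restrict_def)
  ultimately show "(\<lambda>x. h (restrict (\<lambda>i. f i ((w(j := x)) i)) {..<k})) \<in> lmod_hom TR (As j) N"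
    by simp
qed

lemma tuples_restrict_scalars [simp]: "tuples k (\<lambda>j. restrict_scalars \<rho> (Ms j)) = tuples k Ms"
  by (simp add: tuples_def)

lemma multilinear_restrict_scalars:
  assumes "multilinear k Ms N h" "\<rho> \<in> ring_hom TR TR"
  shows "multilinear k (\<lambda>j. restrict_scalars \<rho> (Ms j)) (restrict_scalars \<rho> N) h"
  unfolding multilinear_def tuples_restrict_scalars restrict_scalars_simps
  using restrict_scalars_hom[OF multilinearD(2)[OF assms(1)] assms(2)] multilinearD(1)[OF assms(1)]
  by blast

lemma lmod_hom_sum:
  assumes N: "lmodule TR N" and f: "\<And>i. i \<in> S \<Longrightarrow> f i \<in> lmod_hom TR M N" and S: "finite S"
    and M: "lmodule TR M"
  shows "(\<lambda>x. \<Oplus>\<^bsub>N\<^esub>i\<in>S. f i x) \<in> lmod_hom TR M N"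
proof -
  interpret N: lmodule TR N by fact
  interpret M: lmodule TR M by fact
  note c = lmod_homD(1)[OF f]
  show ?thesis
  proof (rule lmod_homI)
    fix x assume x: "x \<in> carrier M"
    then show "(\<Oplus>\<^bsub>N\<^esub>i\<in>S. f i x) \<in> carrier N" using c by (intro N.finsum_closed) auto
    fix a
    have "(\<Oplus>\<^bsub>N\<^esub>i\<in>S. f i (a \<odot>\<^bsub>M\<^esub> x)) = (\<Oplus>\<^bsub>N\<^esub>i\<in>S. a \<odot>\<^bsub>N\<^esub> f i x)"
      using x c lmod_homD(3)[OF f] by (intro N.finsum_cong') (auto simp: N.smult_closed)
    also have "\<dots> = a \<odot>\<^bsub>N\<^esub> (\<Oplus>\<^bsub>N\<^esub>i\<in>S. f i x)"
      using x c lmod_hom_finsum[OF N N smult_commute_hom[OF N] S, of "\<lambda>i. f i x" a] by (simp add: Pi_iff)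
    finally show "(\<Oplus>\<^bsub>N\<^esub>i\<in>S. f i (a \<odot>\<^bsub>M\<^esub> x)) = a \<odot>\<^bsub>N\<^esub> (\<Oplus>\<^bsub>N\<^esub>i\<in>S. f i x)" .
  next
    fix x y assume xy: "x \<in> carrier M" "y \<in> carrier M"
    have "(\<Oplus>\<^bsub>N\<^esub>i\<in>S. f i (x \<oplus>\<^bsub>M\<^esub> y)) = (\<Oplus>\<^bsub>N\<^esub>i\<in>S. f i x \<oplus>\<^bsub>N\<^esub> f i y)"
      using xy c lmod_homD(2)[OF f] by (intro N.finsum_cong') auto
    then show "(\<Oplus>\<^bsub>N\<^esub>i\<in>S. f i (x \<oplus>\<^bsub>M\<^esub> y)) = (\<Oplus>\<^bsub>N\<^esub>i\<in>S. f i x) \<oplus>\<^bsub>N\<^esub> (\<Oplus>\<^bsub>N\<^esub>i\<in>S. f i y)"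
      using xy c S by (simp add: N.finsum_addf Pi_iff)
  qed
qed

lemma multilinear_sum:
  assumes N: "lmodule TR N" and Ms: "\<And>j. j < k \<Longrightarrow> lmodule TR (Ms j)" and S: "finite S"
    and h: "\<And>i. i \<in> S \<Longrightarrow> multilinear k Ms N (h i)"
  shows "multilinear k Ms N (\<lambda>w. \<Oplus>\<^bsub>N\<^esub>i\<in>S. h i w)"
proof -
  interpret N: lmodule TR N by fact
  show ?thesis
    unfolding multilinear_def
    using multilinearD(1)[OF h] lmod_hom_sum[OF N multilinearD(2)[OF h] S Ms]
    by (auto intro!: N.finsum_closed)
qed

text \<open>Changing the entries of a tuple one after the other.\<close>

lemma multilinear_constant:
  assumes const: "\<And>w j y y'. w \<in> tuples k Ms \<Longrightarrow> j < k \<Longrightarrow> y \<in> carrier (Ms j) \<Longrightarrow> y' \<in> carrier (Ms j) \<Longrightarrow>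
      E j y y' \<Longrightarrow> h (w(j := y)) = h (w(j := y'))"
    and x: "x \<in> tuples k Ms" "x' \<in> tuples k Ms" "\<And>j. j < k \<Longrightarrow> E j (x j) (x' j)"
  shows "h x = h x'"
proof -
  define z where "z n = (\<lambda>i. if i < n then x' i else x i)" for n
  have z: "z n \<in> tuples k Ms" for n using x by (auto simp: z_def tuples_def PiE_iff extensional_def)
  have "h (z n) = h x" if "n \<le> k" for n
    using that
  proof (induction n)
    case (Suc n)
    have "z (Suc n) = (z n)(n := x' n)" "z n = (z n)(n := x n)" by (auto simp: z_def)
    then have "h (z (Suc n)) = h (z n)"
      using const[OF z, of n "x n" "x' n" n] x Suc.prems by (simp add: tuples_component)
    with Suc show ?case by simp
  qed (simp add: z_def)
  moreover have "z k = x'"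
    using x(1,2) by (auto simp: z_def tuples_def PiE_iff extensional_def)
  ultimately show ?thesis by force
qed

lemma tensor_submodule_top:
  assumes S: "submodule S TR (tensor k Ms)" and pt: "\<And>w. w \<in> tuples k Ms \<Longrightarrow> pure_tensor k Ms w \<in> S"
  shows "S = carrier (tensor k Ms)"
proof
  show "S \<subseteq> carrier (tensor k Ms)" by (rule submodule_subset[OF S])
  note h = lmod_homD[OF tensor_class_hom[of k Ms]]
  have "tensor_class k Ms f \<in> S" if "supp f \<subseteq> tuples k Ms" for f
    using that
  proof (induction rule: free_module_induct)
    case zero
    then show ?case
      using lmod_hom_zero[OF free_module_lmodule tensor_lmodule tensor_class_hom, of k Ms] submodule_zero[OF S] by simp
  next
    case (single w c)
    then show ?case
      using h(3)[of c "single w 1"] submodule_smult[OF S _ pt, of c w]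
      by (simp add: map_mult_simps pure_tensor_eq)
  next
    case (add f g)
    then show ?case using h(2)[of f g] submodule_add[OF S] by simp
  qed
  then show "carrier (tensor k Ms) \<subseteq> S" by (auto simp: tensor_carrier)
qed

lemma lmod_hom_descend_scalars:
  assumes "g \<in> lmod_hom TR (restrict_scalars \<rho> M) (restrict_scalars \<rho> N)" "surj \<rho>"
  shows "g \<in> lmod_hom TR M N"
proof (rule lmod_homI)
  fix c x assume "x \<in> carrier M"
  moreover obtain a where "\<rho> a = c" using assms(2) by (metis surjD)
  ultimately show "g (c \<odot>\<^bsub>M\<^esub> x) = c \<odot>\<^bsub>N\<^esub> g x" using lmod_homD(3)[OF assms(1), of a x] by simp
qed (use lmod_homD(1,2)[OF assms(1)] in simp_all)

lemma lmod_hom_inverse: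
  assumes M: "lmodule R M" and g: "g \<in> lmod_hom R M N" and bij: "bij_betw g (carrier M) (carrier N)"
  shows "inv_into (carrier M) g \<in> lmod_hom R N M"
proof -
  interpret lmodule R M by fact
  let ?i = "inv_into (carrier M) g"
  have i: "?i y \<in> carrier M" "g (?i y) = y" if "y \<in> carrier N" for y
    using bij that by (auto simp: bij_betw_def inv_into_into f_inv_into_f)
  have e: "?i (g x) = x" if "x \<in> carrier M" for x using bij that by (simp add: bij_betw_def)
  show ?thesis
  proof (rule lmod_homI)
    fix x y assume "x \<in> carrier N" "y \<in> carrier N"
    then show "?i (x \<oplus>\<^bsub>N\<^esub> y) = ?i x \<oplus>\<^bsub>M\<^esub> ?i y"
      using e[of "?i x \<oplus>\<^bsub>M\<^esub> ?i y"] i lmod_homD(2)[OF g, of "?i x" "?i y"] by simp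
  next
    fix a x assume "a \<in> carrier R" "x \<in> carrier N"
    then show "?i (a \<odot>\<^bsub>N\<^esub> x) = a \<odot>\<^bsub>M\<^esub> ?i x"
      using e[of "a \<odot>\<^bsub>M\<^esub> ?i x"] i lmod_homD(3)[OF g, of a "?i x"] by (simp add: smult_closed)
  qed (use i in simp)
qed

lemma finsum_struct_cong:
  assumes "carrier M = carrier N" "add M = add N" "zero M = zero N"
  shows "finsum M f A = finsum N f A"
  using assms by (simp add: finsum_def finprod_def)

abbreviation (input) "divop D \<beta> r n \<equiv> UK_of D (divpow D \<beta> r n)"

abbreviation compositions :: "nat \<Rightarrow> nat \<Rightarrow> (nat \<Rightarrow> nat) set" where
  "compositions k n \<equiv> {l \<in> {..<k} \<rightarrow>\<^sub>E UNIV. (\<Sum>j<k. l j) = n}"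

lemma finite_compositions: "finite (compositions k n)"
proof (rule finite_subset)
  show "compositions k n \<subseteq> {..<k} \<rightarrow>\<^sub>E {..n}"
  proof
    fix l assume l: "l \<in> compositions k n"
    have "l j \<le> n" if "j < k" for j using l that member_le_sum[of j "{..<k}" l] by auto
    then show "l \<in> {..<k} \<rightarrow>\<^sub>E {..n}" using l by (auto simp: PiE_iff)
  qed
qed (simp add: finite_PiE)

lemma lift_tuple:
  assumes "\<And>j. j < k \<Longrightarrow> p j ` carrier (As j) = carrier (Bs j)" "w \<in> tuples k Bs"
  shows "restrict (\<lambda>j. inv_into (carrier (As j)) (p j) (w j)) {..<k} \<in> tuples k As"
    and "j < k \<Longrightarrow> p j (inv_into (carrier (As j)) (p j) (w j)) = w j"
proof -
  have "w j \<in> p j ` carrier (As j)" if "j < k" for j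
    using tuples_component[OF assms(2) that] assms(1)[OF that] by simp
  then show "restrict (\<lambda>j. inv_into (carrier (As j)) (p j) (w j)) {..<k} \<in> tuples k As"
    "j < k \<Longrightarrow> p j (inv_into (carrier (As j)) (p j) (w j)) = w j"
    by (auto intro!: restrict_in_tuples inv_into_into simp: f_inv_into_f)
qed

text \<open>Stated for semilinear maps so as to cover both reductions, along \<open>A \<rightarrow> F\<close>, and quotients, along
  the identity.  The image is closed under scalars because \<open>\<rho>\<close> is onto, so it suffices that it
  contains the pure tensors.\<close>

lemma tensor_map_onto:
  fixes \<rho> :: "'a::comm_ring_1 \<Rightarrow> 'f::comm_ring_1"
  assumes \<rho>: "\<rho> \<in> ring_hom TR TR" "surj \<rho>"
    and A: "\<And>j. j < k \<Longrightarrow> lmodule TR (A j)" and B: "\<And>j. j < k \<Longrightarrow> lmodule TR (B j)"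
    and p: "\<And>j. j < k \<Longrightarrow> p j \<in> lmod_hom TR (A j) (restrict_scalars \<rho> (B j))"
    and p_onto: "\<And>j. j < k \<Longrightarrow> p j ` carrier (A j) = carrier (B j)"
  shows "\<exists>\<alpha> \<in> lmod_hom TR (tensor k A) (restrict_scalars \<rho> (tensor k B)).
    (\<forall>x\<in>tuples k A. \<alpha> (pure_tensor k A x) = pure_tensor k B (\<lambda>j. p j (x j))) \<and>
    \<alpha> ` carrier (tensor k A) = carrier (tensor k B)"
proof -
  let ?VA = "tensor k A" and ?VB = "tensor k B"
  have VB: "lmodule TR (restrict_scalars \<rho> ?VB)"
    by (rule restrict_scalars_lmodule[OF tensor_lmodule TR_ring \<rho>(1)])
  have "multilinear k A (restrict_scalars \<rho> ?VB) (\<lambda>x. pure_tensor k B (restrict (\<lambda>j. p j (x j)) {..<k}))"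
    by (rule multilinear_map[OF multilinear_restrict_scalars[OF pure_tensor_multilinear[OF B] \<rho>(1)] p])
  from tensor_universal[of k A, OF A VB this]
  obtain \<alpha> where \<alpha>: "\<alpha> \<in> lmod_hom TR ?VA (restrict_scalars \<rho> ?VB)"
      "\<And>x. x \<in> tuples k A \<Longrightarrow> \<alpha> (pure_tensor k A x) = pure_tensor k B (\<lambda>j. p j (x j))"
    by (auto simp: pure_tensor_restrict)
  have "\<alpha> ` carrier ?VA = carrier ?VB"
  proof (rule tensor_submodule_top)
    interpret VA: lmodule TR ?VA by (rule tensor_lmodule)
    interpret VB: lmodule TR ?VB by (rule tensor_lmodule)
    note h = lmod_homD[OF \<alpha>(1), unfolded restrict_scalars_simps]
    show "submodule (\<alpha> ` carrier ?VA) TR ?VB"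
    proof (rule VB.submoduleI)
      show "\<alpha> ` carrier ?VA \<subseteq> carrier ?VB" using h(1) by blast
      show "\<zero>\<^bsub>?VB\<^esub> \<in> \<alpha> ` carrier ?VA"
        using lmod_hom_zero[OF tensor_lmodule VB \<alpha>(1)] VA.zero_closed by (metis imageI restrict_scalars_simps(2))
      show "x \<oplus>\<^bsub>?VB\<^esub> y \<in> \<alpha> ` carrier ?VA" if "x \<in> \<alpha> ` carrier ?VA" "y \<in> \<alpha> ` carrier ?VA" for x y
        using that by (auto simp flip: h(2))
      show "c \<odot>\<^bsub>?VB\<^esub> x \<in> \<alpha> ` carrier ?VA" if x: "x \<in> \<alpha> ` carrier ?VA" for c x
      proof -
        obtain a where "\<rho> a = c" using \<rho>(2) by (metis surjD)
        moreover obtain v where "v \<in> carrier ?VA" "x = \<alpha> v" using x by blast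
        ultimately have "c \<odot>\<^bsub>?VB\<^esub> x = \<alpha> (a \<odot>\<^bsub>?VA\<^esub> v)" using h(3)[of a v] by simp
        then show ?thesis using \<open>v \<in> carrier ?VA\<close> VA.smult_closed[of a v] by simp
      qed
    qed
    fix w assume w: "w \<in> tuples k B"
    let ?x = "restrict (\<lambda>j. inv_into (carrier (A j)) (p j) (w j)) {..<k}"
    have x: "?x \<in> tuples k A" by (rule lift_tuple(1)[OF p_onto w])
    have "\<alpha> (pure_tensor k A ?x) = pure_tensor k B w"
      unfolding \<alpha>(2)[OF x] using lift_tuple(2)[OF p_onto w] by (intro pure_tensor_cong) simp
    then show "pure_tensor k B w \<in> \<alpha> ` carrier ?VA" using imageI[OF pure_tensor_closed[OF x], of \<alpha>] by (simp only:)
  qed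
  with \<alpha> show ?thesis by blast
qed

lemma is_tensor_moduleD:
  assumes "is_tensor_module D k W T"
  shows "lmodule (UK D) T" "carrier T = carrier (tensor k (\<lambda>j. scalars D (W j)))"
    "zero T = zero (tensor k (\<lambda>j. scalars D (W j)))" "add T = add (tensor k (\<lambda>j. scalars D (W j)))"
    "t \<in> carrier T \<Longrightarrow> UK_scalar D c \<odot>\<^bsub>T\<^esub> t = c \<odot>\<^bsub>tensor k (\<lambda>j. scalars D (W j))\<^esub> t"
    "\<beta> \<in> roots (cartan D) \<Longrightarrow> w \<in> tuples k W \<Longrightarrow>
      divop D \<beta> r n \<odot>\<^bsub>T\<^esub> pure_tensor k (\<lambda>j. scalars D (W j)) w =
        (\<Oplus>\<^bsub>T\<^esub> l \<in> compositions k n. pure_tensor k (\<lambda>j. scalars D (W j)) (\<lambda>j. divop D \<beta> r (l j) \<odot>\<^bsub>W j\<^esub> w j))"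
  using assms unfolding is_tensor_module_def Let_def by blast+

text \<open>The divided powers act on any tensor product of modules by the comultiplication formula, by the
  universal property.  So the map \<open>\<gamma>\<close> between the tensor products intertwines their actions, and its
  kernel is stable under the whole of \<open>U\<^sub>K\<close>.\<close>

lemma tensor_module_quotient:
  fixes D :: "('g::complex_lie_algebra, 'i) chevalley_data"
    and W :: "nat \<Rightarrow> (('g, 'f::comm_ring_1) hyp, 'w) module" and Ms :: "nat \<Rightarrow> (('g, 'f) hyp, 'm) module"
  assumes T: "is_tensor_module D k W T"
    and W: "\<And>j. j < k \<Longrightarrow> lmodule (UK D) (W j)" and Ms: "\<And>j. j < k \<Longrightarrow> lmodule (UK D) (Ms j)"
    and quot: "\<And>j. j < k \<Longrightarrow> is_quotient_of (UK D) (Ms j) (W j)"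
  shows "\<exists>T'. is_tensor_module D k Ms T' \<and> is_quotient_of (UK D) T' T"
proof -
  define B where "B = (\<lambda>j. scalars D (W j))"
  define C where "C = (\<lambda>j. scalars D (Ms j))"
  let ?VB = "tensor k B" and ?VC = "tensor k C"
  have Bm: "lmodule TR (B j)" and Cm: "lmodule TR (C j)" if "j < k" for j
    using scalars_lmodule W[OF that] Ms[OF that] by (simp_all add: B_def C_def)
  note T_lmod = is_tensor_moduleD(1)[OF T] and T_simps = is_tensor_moduleD(2-4)[OF T, folded B_def]
    and T_scalar = is_tensor_moduleD(5)[OF T, folded B_def] and T_divpow = is_tensor_moduleD(6)[OF T, folded B_def]
  have tW: "tuples k W = tuples k B" and tM: "tuples k Ms = tuples k C" by (simp_all add: tuples_def B_def C_def)
  interpret T: lmodule "UK D" T by (rule T_lmod)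
  interpret VB: lmodule TR ?VB by (rule tensor_lmodule)
  interpret VC: lmodule TR ?VC by (rule tensor_lmodule)
  obtain q where q: "\<And>j. j < k \<Longrightarrow> q j \<in> lmod_hom (UK D) (W j) (Ms j)"
      "\<And>j. j < k \<Longrightarrow> q j ` carrier (W j) = carrier (Ms j)"
    using quot unfolding is_quotient_of_def by metis
  have q': "q j \<in> lmod_hom TR (B j) (C j)" and q'_onto: "q j ` carrier (B j) = carrier (C j)" if "j < k" for j
    using restrict_scalars_hom[OF q(1)[OF that] UK_scalar_hom] q(2)[OF that]
    by (simp_all add: B_def C_def flip: scalars_def)
  have id: "lmod_hom TR M (restrict_scalars (\<lambda>c. c) N) = lmod_hom TR M N" for M :: "('f, 'u) module" and N :: "('f, 'v) module"
    by (simp add: lmod_hom_def)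
  obtain \<gamma> where \<gamma>: "\<gamma> \<in> lmod_hom TR ?VB ?VC"
      "\<And>w. w \<in> tuples k B \<Longrightarrow> \<gamma> (pure_tensor k B w) = pure_tensor k C (\<lambda>j. q j (w j))"
    and \<gamma>_onto: "\<gamma> ` carrier ?VB = carrier ?VC"
    using tensor_map_onto[of "\<lambda>c. c" k B C q] Bm Cm q' q'_onto
    unfolding id by (auto simp: ring_hom_def)
  have lift: "\<exists>w\<in>tuples k B. pure_tensor k C m = \<gamma> (pure_tensor k B w) \<and> (\<forall>j<k. q j (w j) = m j)"
    if m: "m \<in> tuples k C" for m
  proof -
    let ?w = "restrict (\<lambda>j. inv_into (carrier (B j)) (q j) (m j)) {..<k}"
    have w: "?w \<in> tuples k B" "\<And>j. j < k \<Longrightarrow> q j (?w j) = m j" using lift_tuple[OF q'_onto m] by simp_all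
    moreover have "pure_tensor k C m = \<gamma> (pure_tensor k B ?w)"
      unfolding \<gamma>(2)[OF w(1)] using w(2) by (intro pure_tensor_cong) simp
    ultimately show ?thesis by blast
  qed
  let ?p = "\<lambda>\<beta> r w l. pure_tensor k B (\<lambda>j. divop D \<beta> r (l j) \<odot>\<^bsub>W j\<^esub> w j)"
  let ?p' = "\<lambda>\<beta> r w l. pure_tensor k C (\<lambda>j. divop D \<beta> r (l j) \<odot>\<^bsub>Ms j\<^esub> q j (w j))"
  have p: "?p \<beta> r w l \<in> carrier ?VB" "\<gamma> (?p \<beta> r w l) = ?p' \<beta> r w l"
    if \<beta>: "\<beta> \<in> roots (cartan D)" and w: "w \<in> tuples k B" for \<beta> r w l
  proof -
    let ?w = "restrict (\<lambda>j. divop D \<beta> r (l j) \<odot>\<^bsub>W j\<^esub> w j) {..<k}"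
    have "(\<lambda>x. divop D \<beta> r (l j) \<odot>\<^bsub>W j\<^esub> x) \<in> lmod_hom TR (B j) (B j)" if "j < k" for j
      using UK_of_smult_hom[OF W[OF that] UZ.gen[OF \<beta>]] by (simp add: B_def)
    from tuples_map[of k, OF this w] have w': "?w \<in> tuples k B" .
    from pure_tensor_closed[OF this] show "?p \<beta> r w l \<in> carrier ?VB" by (simp only: pure_tensor_restrict)
    have "\<gamma> (pure_tensor k B ?w) = ?p' \<beta> r w l"
      unfolding \<gamma>(2)[OF w'] using tuples_component[OF w] lmod_homD(3)[OF q(1) UK_of_closed[OF UZ.gen[OF \<beta>]]]
      by (intro pure_tensor_cong) (simp add: B_def)
    then show "\<gamma> (?p \<beta> r w l) = ?p' \<beta> r w l" by (simp only: pure_tensor_restrict)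
  qed

  \<comment> \<open>Every \<open>u\<close> acts on the image through some operator \<open>\<delta>\<close>, so its action respects the fibres.\<close>
  have "\<exists>\<delta>. \<forall>v\<in>carrier T. \<gamma> (u \<odot>\<^bsub>T\<^esub> v) = \<delta> (\<gamma> v)" if "u \<in> carrier (UK D)" for u
    using that
  proof (induction rule: UK_induct)
    case (divpow \<beta> r n)
    have hom: "(\<lambda>x. divop D \<beta> r a \<odot>\<^bsub>Ms j\<^esub> x) \<in> lmod_hom TR (C j) (C j)" if "j < k" for a j
      using UK_of_smult_hom[OF Ms[OF that] UZ.gen[OF divpow]] by (simp add: C_def)
    have "multilinear k C ?VC (\<lambda>m. \<Oplus>\<^bsub>?VC\<^esub> l \<in> compositions k n. pure_tensor k C
        (restrict (\<lambda>j. divop D \<beta> r (l j) \<odot>\<^bsub>Ms j\<^esub> m j) {..<k}))"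
      by (intro multilinear_sum tensor_lmodule Cm finite_compositions multilinear_map[OF pure_tensor_multilinear[OF Cm] hom])
    from tensor_universal[of k C, OF Cm tensor_lmodule this]
    obtain \<delta> where \<delta>: "\<delta> \<in> lmod_hom TR ?VC ?VC" "\<And>m. m \<in> tuples k C \<Longrightarrow> \<delta> (pure_tensor k C m) =
        (\<Oplus>\<^bsub>?VC\<^esub> l \<in> compositions k n. pure_tensor k C (\<lambda>j. divop D \<beta> r (l j) \<odot>\<^bsub>Ms j\<^esub> m j))"
      by (auto simp: pure_tensor_restrict)
    let ?u = "divop D \<beta> r n"
    have act: "(\<lambda>v. ?u \<odot>\<^bsub>T\<^esub> v) \<in> lmod_hom TR ?VB ?VB"
    proof (rule lmod_homI)
      have h: "(\<lambda>v. ?u \<odot>\<^bsub>T\<^esub> v) \<in> lmod_hom TR (scalars D T) (scalars D T)"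
        by (rule UK_of_smult_hom[OF T_lmod UZ.gen[OF divpow]])
      fix x y and a :: 'f assume xy: "x \<in> carrier ?VB"
      show c: "?u \<odot>\<^bsub>T\<^esub> x \<in> carrier ?VB" using lmod_homD(1)[OF h, of x] xy by (simp add: T_simps)
      show "?u \<odot>\<^bsub>T\<^esub> (a \<odot>\<^bsub>?VB\<^esub> x) = a \<odot>\<^bsub>?VB\<^esub> (?u \<odot>\<^bsub>T\<^esub> x)"
        using lmod_homD(3)[OF h, of a x] xy c by (simp add: T_simps T_scalar)
      show "?u \<odot>\<^bsub>T\<^esub> (x \<oplus>\<^bsub>?VB\<^esub> y) = ?u \<odot>\<^bsub>T\<^esub> x \<oplus>\<^bsub>?VB\<^esub> ?u \<odot>\<^bsub>T\<^esub> y" if "y \<in> carrier ?VB"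
        using lmod_homD(2)[OF h, of x y] xy that by (simp add: T_simps)
    qed
    have "\<gamma> (?u \<odot>\<^bsub>T\<^esub> v) = \<delta> (\<gamma> v)" if "v \<in> carrier ?VB" for v
    proof (rule tensor_hom_eqI[OF tensor_lmodule lmod_hom_comp[OF act \<gamma>(1)] lmod_hom_comp[OF \<gamma>(1) \<delta>(1)] _ that])
      fix w assume w: "w \<in> tuples k B"
      have "\<gamma> (?u \<odot>\<^bsub>T\<^esub> pure_tensor k B w) = \<gamma> (\<Oplus>\<^bsub>?VB\<^esub> l \<in> compositions k n. ?p \<beta> r w l)"
        using w by (simp add: T_divpow[OF divpow] tW finsum_struct_cong[OF T_simps(1,3,2)])
      also have "\<dots> = (\<Oplus>\<^bsub>?VC\<^esub> l \<in> compositions k n. \<gamma> (?p \<beta> r w l))"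
        using p(1)[OF divpow w]
        by (intro lmod_hom_finsum[OF tensor_lmodule tensor_lmodule \<gamma>(1) finite_compositions]) simp
      also have "\<dots> = (\<Oplus>\<^bsub>?VC\<^esub> l \<in> compositions k n. ?p' \<beta> r w l)" by (simp only: p(2)[OF divpow w])
      also have "\<dots> = \<delta> (pure_tensor k C (restrict (\<lambda>j. q j (w j)) {..<k}))"
      proof -
        have "pure_tensor k C (\<lambda>j. divop D \<beta> r (l j) \<odot>\<^bsub>Ms j\<^esub> restrict (\<lambda>j. q j (w j)) {..<k} j) = ?p' \<beta> r w l" for l
          by (rule pure_tensor_cong) simp
        then show ?thesis by (simp only: \<delta>(2)[OF tuples_map[OF q' w]])
      qed
      finally show "\<gamma> (?u \<odot>\<^bsub>T\<^esub> pure_tensor k B w) = \<delta> (\<gamma> (pure_tensor k B w))"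
        by (simp add: \<gamma>(2)[OF w] pure_tensor_restrict)
    qed
    then show ?case unfolding T_simps by blast
  next
    case (scalar c)
    show ?case
      using lmod_homD(3)[OF \<gamma>(1), of c] by (intro exI[of _ "\<lambda>y. c \<odot>\<^bsub>?VC\<^esub> y"]) (simp add: T_scalar T_simps)
  next
    case (add x y)
    then obtain \<delta> \<epsilon> where "\<forall>v\<in>carrier T. \<gamma> (x \<odot>\<^bsub>T\<^esub> v) = \<delta> (\<gamma> v)" "\<forall>v\<in>carrier T. \<gamma> (y \<odot>\<^bsub>T\<^esub> v) = \<epsilon> (\<gamma> v)" by blast
    then show ?case
      using add.hyps lmod_homD(2)[OF \<gamma>(1)] T.smult_closed
      by (intro exI[of _ "\<lambda>v. \<delta> v \<oplus>\<^bsub>?VC\<^esub> \<epsilon> v"]) (simp add: T.smult_l_distr T_simps)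
  next
    case (mult x y)
    then obtain \<delta> \<epsilon> where "\<forall>v\<in>carrier T. \<gamma> (x \<odot>\<^bsub>T\<^esub> v) = \<delta> (\<gamma> v)" "\<forall>v\<in>carrier T. \<gamma> (y \<odot>\<^bsub>T\<^esub> v) = \<epsilon> (\<gamma> v)" by blast
    then show ?case
      using mult.hyps by (intro exI[of _ "\<lambda>v. \<delta> (\<epsilon> v)"]) (simp add: T.smult_assoc T.smult_closed)
  qed
  then have stable: "\<gamma> (u \<odot>\<^bsub>T\<^esub> x) = \<gamma> (u \<odot>\<^bsub>T\<^esub> y)"
    if "u \<in> carrier (UK D)" "x \<in> carrier T" "y \<in> carrier T" "\<gamma> x = \<gamma> y" for u x y
    using that by metis
  have "\<exists>T'. lmodule (UK D) T' \<and> carrier T' = carrier ?VC \<and> zero T' = zero ?VC \<and> add T' = add ?VC \<and>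
      \<gamma> \<in> lmod_hom (UK D) T T'"
  proof (rule lmodule_transport[OF T_lmod])
    show "\<gamma> ` carrier T = carrier ?VC" by (simp only: \<gamma>_onto T_simps)
    show "\<gamma> (x \<oplus>\<^bsub>T\<^esub> y) = \<gamma> x \<oplus>\<^bsub>?VC\<^esub> \<gamma> y" if "x \<in> carrier T" "y \<in> carrier T" for x y
      using that lmod_homD(2)[OF \<gamma>(1)] by (simp add: T_simps)
    show "\<gamma> \<zero>\<^bsub>T\<^esub> = \<zero>\<^bsub>?VC\<^esub>"
      using lmod_hom_zero[OF tensor_lmodule tensor_lmodule \<gamma>(1)] by (simp only: T_simps)
  qed (rule stable)
  then obtain T' where T': "lmodule (UK D) T'" "carrier T' = carrier ?VC" "zero T' = zero ?VC" "add T' = add ?VC"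
    and \<gamma>': "\<gamma> \<in> lmod_hom (UK D) T T'" by blast
  have "is_tensor_module D k Ms T'"
    unfolding is_tensor_module_def Let_def C_def[symmetric]
  proof (intro conjI allI ballI T')
    fix c t assume "t \<in> carrier T'"
    then obtain v where v: "v \<in> carrier T" "t = \<gamma> v" using \<gamma>_onto by (auto simp: T' T_simps)
    then show "UK_scalar D c \<odot>\<^bsub>T'\<^esub> t = c \<odot>\<^bsub>?VC\<^esub> t"
      using lmod_homD(3)[OF \<gamma>' UK_scalar_closed, of v c] lmod_homD(3)[OF \<gamma>(1), of c v] by (simp add: T_scalar T_simps)
  next
    fix \<beta> r n m assume \<beta>: "\<beta> \<in> roots (cartan D)" and m: "m \<in> tuples k Ms"
    then obtain w where w: "w \<in> tuples k B" "\<And>j. j < k \<Longrightarrow> q j (w j) = m j"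
      and mw: "pure_tensor k C m = \<gamma> (pure_tensor k B w)" using lift tM by blast
    have "divop D \<beta> r n \<odot>\<^bsub>T'\<^esub> pure_tensor k C m = \<gamma> (divop D \<beta> r n \<odot>\<^bsub>T\<^esub> pure_tensor k B w)"
      using lmod_homD(3)[OF \<gamma>' UK_of_closed[OF UZ.gen[OF \<beta>]]] pure_tensor_closed[OF w(1)] by (simp add: mw T_simps)
    also have "\<dots> = \<gamma> (\<Oplus>\<^bsub>T\<^esub> l \<in> compositions k n. ?p \<beta> r w l)"
      using w(1) by (simp add: T_divpow[OF \<beta>] tW)
    also have "\<dots> = (\<Oplus>\<^bsub>T'\<^esub> l \<in> compositions k n. \<gamma> (?p \<beta> r w l))"
      using p(1)[OF \<beta> w(1)] by (intro lmod_hom_finsum[OF T_lmod T'(1) \<gamma>' finite_compositions]) (simp add: T_simps)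
    also have "\<dots> = (\<Oplus>\<^bsub>T'\<^esub> l \<in> compositions k n. pure_tensor k C (\<lambda>j. divop D \<beta> r (l j) \<odot>\<^bsub>Ms j\<^esub> m j))"
    proof -
      have "?p' \<beta> r w l = pure_tensor k C (\<lambda>j. divop D \<beta> r (l j) \<odot>\<^bsub>Ms j\<^esub> m j)" for l
        using w(2) by (intro pure_tensor_cong) simp
      then show ?thesis by (simp only: p(2)[OF \<beta> w(1)])
    qed
    finally show "divop D \<beta> r n \<odot>\<^bsub>T'\<^esub> pure_tensor k C m =
        (\<Oplus>\<^bsub>T'\<^esub> l \<in> compositions k n. pure_tensor k C (\<lambda>j. divop D \<beta> r (l j) \<odot>\<^bsub>Ms j\<^esub> m j))" .
  qed
  moreover have "is_quotient_of (UK D) T' T"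
    unfolding is_quotient_of_def using \<gamma>' \<gamma>_onto by (auto simp: T' T_simps)
  ultimately show ?thesis by blast
qed

text \<open>Tensor products commute with reduction: \<open>N\<close> and the tensor product of the \<open>W j\<close> are both reductions
  of the tensor product of the \<open>L j\<close>.  The map \<open>\<alpha>\<close> is the second of them; \<open>\<theta>\<close> goes from the tensor
  product of the \<open>W j\<close> to \<open>N\<close>, and it is injective because \<open>\<alpha>\<close> in turn factors through \<open>\<pi>'\<close>.\<close>

lemma tensor_reduction_iso:
  fixes D :: "('g::complex_lie_algebra, 'i) chevalley_data"
    and \<rho> :: "'a::comm_ring_1 \<Rightarrow> 'f::comm_ring_1"
    and L :: "nat \<Rightarrow> (('g, 'a) hyp, 'l) module" and W :: "nat \<Rightarrow> (('g, 'f) hyp, 'w) module"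
    and M :: "(('g, 'a) hyp, 'm) module" and N :: "(('g, 'f) hyp, 'n) module"
  defines "A \<equiv> \<lambda>j. scalars D (L j)" and "B \<equiv> \<lambda>j. scalars D (W j)"
  assumes \<rho>: "\<rho> \<in> ring_hom TR TR" "surj \<rho>"
    and L: "\<And>j. j < k \<Longrightarrow> lmodule (UK D) (L j)" and W: "\<And>j. j < k \<Longrightarrow> lmodule (UK D) (W j)"
    and M: "lmodule (UK D) M" and N: "lmodule (UK D) N"
    and red: "\<And>j. j < k \<Longrightarrow> reduction D \<rho> (L j) (W j) (\<pi> j)" and redM: "reduction D \<rho> M N \<pi>'"
    and t: "t \<in> lmod_hom TR (tensor k A) (scalars D M)"
    and t_bij: "bij_betw t (carrier (tensor k A)) (carrier M)"
  shows "\<exists>\<eta> \<in> lmod_hom TR (scalars D N) (tensor k B). bij_betw \<eta> (carrier N) (carrier (tensor k B)) \<and>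
    (\<forall>x\<in>tuples k A. \<eta> (\<pi>' (t (pure_tensor k A x))) = pure_tensor k B (\<lambda>j. \<pi> j (x j)))"
proof -
  let ?VA = "tensor k A" and ?VB = "tensor k B" and ?M = "scalars D M" and ?N = "scalars D N"
  note Mm = scalars_lmodule[OF M] and Nm = scalars_lmodule[OF N]
  note restr = restrict_scalars_lmodule[OF _ TR_ring \<rho>(1)]
  have Am: "lmodule TR (A j)" and Bm: "lmodule TR (B j)" if "j < k" for j
    using scalars_lmodule L[OF that] W[OF that] by (simp_all add: A_def B_def)
  have \<pi>: "\<pi> j \<in> lmod_hom TR (A j) (restrict_scalars \<rho> (B j))" and \<pi>_onto: "\<pi> j ` carrier (A j) = carrier (B j)"
    if "j < k" for j
    using red[OF that] by (simp_all add: reduction_def A_def B_def)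
  have \<pi>': "\<pi>' \<in> lmod_hom TR ?M (restrict_scalars \<rho> ?N)" and \<pi>'_onto: "\<pi>' ` carrier M = carrier N"
    using redM by (simp_all add: reduction_def)
  have "\<exists>\<alpha> \<in> lmod_hom TR ?VA (restrict_scalars \<rho> ?VB).
      (\<forall>x\<in>tuples k A. \<alpha> (pure_tensor k A x) = pure_tensor k B (\<lambda>j. \<pi> j (x j))) \<and> \<alpha> ` carrier ?VA = carrier ?VB"
    by (rule tensor_map_onto[OF \<rho> Am Bm \<pi> \<pi>_onto])
  then obtain \<alpha> where \<alpha>: "\<alpha> \<in> lmod_hom TR ?VA (restrict_scalars \<rho> ?VB)"
      "\<And>x. x \<in> tuples k A \<Longrightarrow> \<alpha> (pure_tensor k A x) = pure_tensor k B (\<lambda>j. \<pi> j (x j))"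
    and \<alpha>_onto: "\<alpha> ` carrier ?VA = carrier ?VB" by blast

  \<comment> \<open>To define \<open>\<theta>\<close> on a pure tensor, lift its factors, take their product in \<open>M\<close> and reduce.  The result
    does not depend on the lifts, since in each argument \<open>?g\<close> factors through \<open>\<pi> j\<close>.\<close>
  let ?g = "\<lambda>x. \<pi>' (t (pure_tensor k A x))"
  have g: "multilinear k A (restrict_scalars \<rho> ?N) ?g"
    by (rule multilinear_comp_hom[OF pure_tensor_multilinear[OF Am] lmod_hom_comp[OF t \<pi>']])
  have g_upd: "?g (w(j := y)) = ?g (w(j := y'))"
    if "w \<in> tuples k A" "j < k" "y \<in> carrier (A j)" "y' \<in> carrier (A j)" "\<pi> j y = \<pi> j y'" for w j y y'
  proof -
    have "(\<lambda>y. ?g (w(j := y))) \<in> lmod_hom TR (scalars D (L j)) (restrict_scalars \<rho> ?N)"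
      using multilinearD(2)[OF g that(1,2)] by (simp only: A_def)
    from reduction_constant[OF red[OF that(2)] \<rho>(1) L[OF that(2)] W[OF that(2)] Nm this _ _ that(5)] that(3,4)
    show ?thesis by (simp only: A_def scalars_simps)
  qed
  have g_const: "?g x = ?g x'" if "x \<in> tuples k A" "x' \<in> tuples k A" "\<And>j. j < k \<Longrightarrow> \<pi> j (x j) = \<pi> j (x' j)" for x x'
    by (rule multilinear_constant[where h = ?g and Ms = A and E = "\<lambda>j y y'. \<pi> j y = \<pi> j y'", OF g_upd that])
  let ?s = "\<lambda>w. restrict (\<lambda>j. inv_into (carrier (A j)) (\<pi> j) (w j)) {..<k}"
  have s: "?s w \<in> tuples k A" "\<And>j. j < k \<Longrightarrow> \<pi> j (?s w j) = w j" if "w \<in> tuples k B" for w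
    using lift_tuple[OF \<pi>_onto that] by simp_all
  have "multilinear k B ?N (\<lambda>w. ?g (?s w))"
    unfolding multilinear_def
  proof (intro conjI ballI allI impI)
    fix w assume w: "w \<in> tuples k B"
    show "?g (?s w) \<in> carrier ?N" using multilinearD(1)[OF g s(1)[OF w]] by simp
    fix j assume j: "j < k"
    let ?h = "\<lambda>y. ?g ((?s w)(j := y))"
    have h: "?h \<in> lmod_hom TR (A j) (restrict_scalars \<rho> ?N)" by (rule multilinearD(2)[OF g s(1)[OF w] j])
    have "\<exists>g'\<in>lmod_hom TR (restrict_scalars \<rho> (B j)) (restrict_scalars \<rho> ?N). \<forall>y\<in>carrier (A j). g' (\<pi> j y) = ?h y"
    proof (rule lmod_hom_factor[OF Am[OF j] \<pi>[OF j] _ h])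
      show "\<pi> j ` carrier (A j) = carrier (restrict_scalars \<rho> (B j))" using \<pi>_onto[OF j] by simp
      show "?h y = ?h y'" if "y \<in> carrier (A j)" "y' \<in> carrier (A j)" "\<pi> j y = \<pi> j y'" for y y'
        by (rule g_upd[OF s(1)[OF w] j that])
    qed
    then obtain g' where g': "g' \<in> lmod_hom TR (restrict_scalars \<rho> (B j)) (restrict_scalars \<rho> ?N)"
        "\<And>y. y \<in> carrier (A j) \<Longrightarrow> g' (\<pi> j y) = ?h y" by blast
    have "g' y = ?g (?s (w(j := y)))" if y: "y \<in> carrier (B j)" for y
    proof -
      let ?y = "inv_into (carrier (A j)) (\<pi> j) y"
      have "?y \<in> carrier (A j)" "\<pi> j ?y = y" using y \<pi>_onto[OF j] by (auto intro!: inv_into_into simp: f_inv_into_f)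
      then have "g' y = ?h ?y" using g'(2)[of ?y] by simp
      also have "(?s w)(j := ?y) = ?s (w(j := y))" using j by (auto simp: restrict_def)
      finally show ?thesis .
    qed
    then show "(\<lambda>y. ?g (?s (w(j := y)))) \<in> lmod_hom TR (B j) ?N"
      by (rule lmod_hom_cong[OF Bm[OF j] lmod_hom_descend_scalars[OF g'(1) \<rho>(2)]])
  qed
  from tensor_universal[of k B, OF Bm Nm this]
  obtain \<theta> where \<theta>: "\<theta> \<in> lmod_hom TR ?VB ?N"
      "\<And>w. w \<in> tuples k B \<Longrightarrow> \<theta> (pure_tensor k B w) = ?g (?s w)" by blast
  have \<theta>\<alpha>: "\<theta> (\<alpha> v) = \<pi>' (t v)" if v: "v \<in> carrier ?VA" for v
  proof (rule tensor_hom_eqI[OF restr[OF Nm] lmod_hom_comp[OF \<alpha>(1) restrict_scalars_hom[OF \<theta>(1) \<rho>(1)]] lmod_hom_comp[OF t \<pi>'] _ v])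
    fix x assume x: "x \<in> tuples k A"
    let ?w = "restrict (\<lambda>j. \<pi> j (x j)) {..<k}"
    have w: "?w \<in> tuples k B" using tuples_map[OF \<pi> x] by simp
    have "\<theta> (\<alpha> (pure_tensor k A x)) = \<theta> (pure_tensor k B ?w)" by (simp add: \<alpha>(2)[OF x] pure_tensor_restrict)
    also have "\<dots> = ?g (?s ?w)" by (rule \<theta>(2)[OF w])
    also have "\<dots> = ?g x" using s(2)[OF w] by (intro g_const s(1) w x) simp
    finally show "\<theta> (\<alpha> (pure_tensor k A x)) = ?g x" .
  qed
  have t_onto: "t ` carrier ?VA = carrier M" using t_bij by (simp add: bij_betw_def)
  have \<theta>_onto: "\<theta> ` carrier ?VB = carrier N"
  proof -
    have "\<theta> ` carrier ?VB = (\<lambda>v. \<theta> (\<alpha> v)) ` carrier ?VA" using \<alpha>_onto by (metis image_image)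
    also have "\<dots> = \<pi>' ` t ` carrier ?VA" by (simp add: \<theta>\<alpha> image_image cong: image_cong)
    finally show ?thesis by (simp add: t_onto \<pi>'_onto)
  qed
  have "inj_on \<theta> (carrier ?VB)"
  proof (rule inj_onI)
    fix x y assume xy: "x \<in> carrier ?VB" "y \<in> carrier ?VB" "\<theta> x = \<theta> y"
    have "x \<in> \<alpha> ` carrier ?VA" "y \<in> \<alpha> ` carrier ?VA" using xy(1,2) by (simp_all only: \<alpha>_onto)
    then obtain v u where v: "v \<in> carrier ?VA" "x = \<alpha> v" and u: "u \<in> carrier ?VA" "y = \<alpha> u"
      by (elim imageE) blast
    have inv: "inv_into (carrier ?VA) t (t z) = z" if "z \<in> carrier ?VA" for z
      using t_bij that by (simp add: bij_betw_def)
    have "inv_into (carrier ?VA) t \<in> lmod_hom TR ?M ?VA"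
      using t_bij by (intro lmod_hom_inverse[OF tensor_lmodule t]) simp
    note const = reduction_constant[OF redM \<rho>(1) M N tensor_lmodule lmod_hom_comp[OF this \<alpha>(1)]]
    have "t v \<in> carrier M" "t u \<in> carrier M" using v u t_onto by blast+
    moreover have "\<pi>' (t v) = \<pi>' (t u)" using xy(3) v u \<theta>\<alpha> by simp
    ultimately have "\<alpha> (inv_into (carrier ?VA) t (t v)) = \<alpha> (inv_into (carrier ?VA) t (t u))"
      by (rule const)
    then show "x = y" using v u by (simp add: inv)
  qed
  with \<theta>_onto have \<theta>_bij: "bij_betw \<theta> (carrier ?VB) (carrier N)" by (simp add: bij_betw_def)

  let ?\<eta> = "inv_into (carrier ?VB) \<theta>"
  have "?\<eta> (?g x) = pure_tensor k B (\<lambda>j. \<pi> j (x j))" if x: "x \<in> tuples k A" for x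
  proof -
    have "?g x = \<theta> (\<alpha> (pure_tensor k A x))" using \<theta>\<alpha> pure_tensor_closed[OF x] by simp
    moreover have "\<alpha> (pure_tensor k A x) \<in> carrier ?VB" using \<alpha>_onto pure_tensor_closed[OF x] by blast
    ultimately show ?thesis using \<theta>_bij by (simp add: bij_betw_def \<alpha>(2)[OF x])
  qed
  moreover have "?\<eta> \<in> lmod_hom TR ?N ?VB"
    using \<theta>_bij by (intro lmod_hom_inverse[OF tensor_lmodule \<theta>(1)]) simp
  ultimately show ?thesis using bij_betw_inv_into[OF \<theta>_bij] by blast
qed

text \<open>The module structure of \<open>N\<close> is transported to the tensor product of the \<open>W j\<close>.  Every pure tensor
  of the latter comes from a pure tensor in \<open>M\<close>, on which the divided powers act by the
  comultiplication formula.\<close>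

lemma tensor_reduction:
  fixes D :: "('g::complex_lie_algebra, 'i) chevalley_data"
    and \<rho> :: "'a::comm_ring_1 \<Rightarrow> 'f::comm_ring_1"
    and L :: "nat \<Rightarrow> (('g, 'a) hyp, 'l) module" and W :: "nat \<Rightarrow> (('g, 'f) hyp, 'w) module"
    and M :: "(('g, 'a) hyp, 'm) module" and N :: "(('g, 'f) hyp, 'n) module"
  assumes \<rho>: "\<rho> \<in> ring_hom TR TR" "surj \<rho>"
    and L: "\<And>j. j < k \<Longrightarrow> lmodule (UK D) (L j)" and W: "\<And>j. j < k \<Longrightarrow> lmodule (UK D) (W j)"
    and M: "lmodule (UK D) M" and N: "lmodule (UK D) N"
    and red: "\<And>j. j < k \<Longrightarrow> reduction D \<rho> (L j) (W j) (\<pi> j)" and redM: "reduction D \<rho> M N \<pi>'"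
    and t: "t \<in> lmod_hom TR (tensor k (\<lambda>j. scalars D (L j))) (scalars D M)"
    and t_bij: "bij_betw t (carrier (tensor k (\<lambda>j. scalars D (L j)))) (carrier M)"
    and t_divpow: "\<And>\<beta> r n x. \<beta> \<in> roots (cartan D) \<Longrightarrow> x \<in> tuples k (\<lambda>j. scalars D (L j)) \<Longrightarrow>
      divop D \<beta> r n \<odot>\<^bsub>M\<^esub> t (pure_tensor k (\<lambda>j. scalars D (L j)) x) =
        (\<Oplus>\<^bsub>M\<^esub> l \<in> compositions k n.
          t (pure_tensor k (\<lambda>j. scalars D (L j)) (\<lambda>j. divop D \<beta> r (l j) \<odot>\<^bsub>L j\<^esub> x j)))"
  shows "\<exists>T. is_tensor_module D k W T \<and> lmod_isomorphic (UK D) N T"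
proof -
  define A where "A = (\<lambda>j. scalars D (L j))"
  define B where "B = (\<lambda>j. scalars D (W j))"
  let ?VB = "tensor k B" and ?M = "scalars D M" and ?N = "scalars D N"
  note Mm = scalars_lmodule[OF M] and Nm = scalars_lmodule[OF N]
  note t = t[folded A_def] and t_bij = t_bij[folded A_def] and t_divpow = t_divpow[folded A_def]
  have tW: "tuples k W = tuples k B" by (simp add: tuples_def B_def)
  have \<pi>_onto: "\<pi> j ` carrier (A j) = carrier (B j)" if "j < k" for j
    using red[OF that] by (simp add: reduction_def A_def B_def)
  have \<pi>': "\<pi>' \<in> lmod_hom TR ?M (restrict_scalars \<rho> ?N)" and \<pi>'_onto: "\<pi>' ` carrier M = carrier N"
    and \<pi>'_of: "\<And>u x. u \<in> UZ D \<Longrightarrow> x \<in> carrier M \<Longrightarrow> \<pi>' (UK_of D u \<odot>\<^bsub>M\<^esub> x) = UK_of D u \<odot>\<^bsub>N\<^esub> \<pi>' x"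
    using redM by (simp_all add: reduction_def)
  let ?g = "\<lambda>x. \<pi>' (t (pure_tensor k A x))"
  let ?s = "\<lambda>w. restrict (\<lambda>j. inv_into (carrier (A j)) (\<pi> j) (w j)) {..<k}"
  have s: "?s w \<in> tuples k A" "\<And>j. j < k \<Longrightarrow> \<pi> j (?s w j) = w j" if "w \<in> tuples k B" for w
    using lift_tuple[OF \<pi>_onto that] by simp_all
  obtain \<eta> where \<eta>: "\<eta> \<in> lmod_hom TR ?N ?VB" and \<eta>_bij: "bij_betw \<eta> (carrier N) (carrier ?VB)"
    and \<eta>g: "\<And>x. x \<in> tuples k A \<Longrightarrow> \<eta> (?g x) = pure_tensor k B (\<lambda>j. \<pi> j (x j))"
    using tensor_reduction_iso[OF \<rho> L W M N red redM t[unfolded A_def] t_bij[unfolded A_def]]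
    unfolding A_def[symmetric] B_def[symmetric] by blast
  have "\<exists>T. lmodule (UK D) T \<and> carrier T = carrier ?VB \<and> zero T = zero ?VB \<and> add T = add ?VB \<and> \<eta> \<in> lmod_hom (UK D) N T"
  proof (rule lmodule_transport[OF N])
    show "\<eta> ` carrier N = carrier ?VB" using \<eta>_bij by (simp add: bij_betw_def)
    show "\<eta> \<zero>\<^bsub>N\<^esub> = \<zero>\<^bsub>?VB\<^esub>" using lmod_hom_zero[OF Nm tensor_lmodule \<eta>] by simp
    show "\<eta> (x \<oplus>\<^bsub>N\<^esub> y) = \<eta> x \<oplus>\<^bsub>?VB\<^esub> \<eta> y" if "x \<in> carrier N" "y \<in> carrier N" for x y
      using lmod_homD(2)[OF \<eta>, of x y] that by simp
    show "\<eta> (a \<odot>\<^bsub>N\<^esub> x) = \<eta> (a \<odot>\<^bsub>N\<^esub> y)" if "x \<in> carrier N" "y \<in> carrier N" "\<eta> x = \<eta> y" for a x y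
      using \<eta>_bij that by (metis bij_betw_imp_inj_on inj_onD)
  qed
  then obtain T where T: "lmodule (UK D) T" "carrier T = carrier ?VB" "zero T = zero ?VB" "add T = add ?VB"
    and \<eta>': "\<eta> \<in> lmod_hom (UK D) N T" by blast
  have "is_tensor_module D k W T"
    unfolding is_tensor_module_def Let_def B_def[symmetric]
  proof (intro conjI allI ballI T)
    fix c v assume "v \<in> carrier T"
    then obtain y where y: "y \<in> carrier N" "v = \<eta> y" using \<eta>_bij by (auto simp: T bij_betw_def)
    then show "UK_scalar D c \<odot>\<^bsub>T\<^esub> v = c \<odot>\<^bsub>?VB\<^esub> v"
      using lmod_homD(3)[OF \<eta>' UK_scalar_closed, of y c] lmod_homD(3)[OF \<eta>, of c y] by simp
  next
    fix \<beta> r n w assume \<beta>: "\<beta> \<in> roots (cartan D)" and "w \<in> tuples k W"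
    then have w: "w \<in> tuples k B" by (simp add: tW)
    let ?u = "\<lambda>a. divpow D \<beta> r a"
    have u: "?u a \<in> UZ D" for a by (rule UZ.gen[OF \<beta>])
    let ?x = "?s w"
    let ?p = "\<lambda>l. restrict (\<lambda>j. UK_of D (?u (l j)) \<odot>\<^bsub>L j\<^esub> ?x j) {..<k}"
    have p: "?p l \<in> tuples k A" for l
    proof (rule tuples_map[OF _ s(1)[OF w]])
      show "(\<lambda>z. UK_of D (?u (l j)) \<odot>\<^bsub>L j\<^esub> z) \<in> lmod_hom TR (A j) (A j)" if "j < k" for j
        using UK_of_smult_hom[OF L[OF that] u] by (simp add: A_def)
    qed
    have tp: "t (pure_tensor k A x) \<in> carrier M" if "x \<in> tuples k A" for x
      using lmod_homD(1)[OF t pure_tensor_closed[OF that]] by simp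
    have gN: "?g x \<in> carrier N" if "x \<in> tuples k A" for x
      using tp[OF that] \<pi>'_onto by blast
    have "\<eta> (?g ?x) = pure_tensor k B w"
      unfolding \<eta>g[OF s(1)[OF w]] using s(2)[OF w] by (rule pure_tensor_cong)
    then have "UK_of D (?u n) \<odot>\<^bsub>T\<^esub> pure_tensor k B w = \<eta> (UK_of D (?u n) \<odot>\<^bsub>N\<^esub> ?g ?x)"
      using lmod_homD(3)[OF \<eta>' UK_of_closed[OF u] gN[OF s(1)[OF w]]] by (simp only:)
    also have "UK_of D (?u n) \<odot>\<^bsub>N\<^esub> ?g ?x = \<pi>' (UK_of D (?u n) \<odot>\<^bsub>M\<^esub> t (pure_tensor k A ?x))"
      using \<pi>'_of[OF u tp[OF s(1)[OF w]]] by simp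
    also have "UK_of D (?u n) \<odot>\<^bsub>M\<^esub> t (pure_tensor k A ?x) = (\<Oplus>\<^bsub>M\<^esub> l \<in> compositions k n. t (pure_tensor k A (?p l)))"
      using t_divpow[OF \<beta> s(1)[OF w]] by (simp only: pure_tensor_restrict)
    also have "\<pi>' \<dots> = \<pi>' (\<Oplus>\<^bsub>?M\<^esub> l \<in> compositions k n. t (pure_tensor k A (?p l)))"
      by (simp add: finsum_struct_cong[of ?M M])
    also have "\<dots> = (\<Oplus>\<^bsub>restrict_scalars \<rho> ?N\<^esub> l \<in> compositions k n. ?g (?p l))"
      using tp[OF p] by (intro lmod_hom_finsum[OF Mm restrict_scalars_lmodule[OF Nm TR_ring \<rho>(1)] \<pi>' finite_compositions]) simp
    also have "\<dots> = (\<Oplus>\<^bsub>N\<^esub> l \<in> compositions k n. ?g (?p l))"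
      by (simp add: finsum_struct_cong[of "restrict_scalars \<rho> ?N" N])
    also have "\<eta> \<dots> = (\<Oplus>\<^bsub>T\<^esub> l \<in> compositions k n. \<eta> (?g (?p l)))"
      using tp[OF p] \<pi>'_onto by (intro lmod_hom_finsum[OF N T(1) \<eta>' finite_compositions]) auto
    also have "\<dots> = (\<Oplus>\<^bsub>T\<^esub> l \<in> compositions k n. pure_tensor k B (\<lambda>j. UK_of D (?u (l j)) \<odot>\<^bsub>W j\<^esub> w j))"
    proof -
      have "\<eta> (?g (?p l)) = pure_tensor k B (\<lambda>j. UK_of D (?u (l j)) \<odot>\<^bsub>W j\<^esub> w j)" for l
        unfolding \<eta>g[OF p]
      proof (rule pure_tensor_cong)
        fix j assume j: "j < k"
        have "?x j \<in> carrier (L j)" using tuples_component[OF s(1)[OF w] j] by (simp add: A_def)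
        then have "\<pi> j (UK_of D (?u (l j)) \<odot>\<^bsub>L j\<^esub> ?x j) = UK_of D (?u (l j)) \<odot>\<^bsub>W j\<^esub> \<pi> j (?x j)"
          using red[OF j] u unfolding reduction_def by blast
        then show "\<pi> j (?p l j) = UK_of D (?u (l j)) \<odot>\<^bsub>W j\<^esub> w j" using j s(2)[OF w j] by simp
      qed
      then show ?thesis by simp
    qed
    finally show "UK_of D (?u n) \<odot>\<^bsub>T\<^esub> pure_tensor k B w =
      (\<Oplus>\<^bsub>T\<^esub> l \<in> compositions k n. pure_tensor k B (\<lambda>j. UK_of D (?u (l j)) \<odot>\<^bsub>W j\<^esub> w j))" .
  qed
  moreover have "\<eta> \<in> lmod_iso (UK D) N T" using \<eta>' \<eta>_bij by (simp add: lmod_iso_def T)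
  ultimately show ?thesis by (auto simp: lmod_isomorphic_def)
qed

section \<open>Weyl modules and their integral lattices\<close>

lemma emb_hom: "emb \<in> ring_hom TR TR"
  by (rule ring_hom_memI) (simp_all add: emb_def Fract_of_int_eq flip: One_fract_def to_ac_add to_ac_mult)

lemma regular_module_lmodule:
  assumes "ring R"
  shows "lmodule R (regular_module R)"
proof -
  interpret ring R by fact
  have "abelian_group (regular_module R)"
    by (rule abelian_group_cong[OF is_abelian_group]) (simp_all add: regular_module_def)
  then show ?thesis
    by (intro lmodule.intro lmodule_axioms.intro assms)
      (simp_all add: regular_module_def l_distr r_distr m_assoc)
qed

lemma weyl_lmodule: "lmodule (UK D) (weyl D \<omega>)"
  unfolding weyl_def weyl_ideal_def
  by (rule quotient_lmodule[OF regular_module_lmodule[OF UK_ring] submodule_generated_submodule[OF regular_module_lmodule[OF UK_ring]]])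

lemma weyl_generator_closed:
  assumes "v \<in> weyl_generators D \<omega>"
  shows "v \<in> carrier (weyl D \<omega>)"
proof -
  interpret lmodule "UK D" "weyl D \<omega>" by (rule weyl_lmodule)
  have "weyl_ideal D \<omega> +>\<^bsub>regular_module (UK D)\<^esub> \<one>\<^bsub>UK D\<^esub> \<in> carrier (weyl D \<omega>)"
    by (auto simp: weyl_def quotient_carrier regular_module_def)
  with assms show ?thesis
    by (auto simp: weyl_generators_def intro!: smult_closed UK_scalar_closed)
qed

lemma cyclic_submodule_lmodule:
  fixes R :: "'r ring"
  assumes "lmodule R M" "v \<in> carrier M"
  shows "lmodule R (cyclic_submodule R M v)"
proof -
  interpret lmodule R M by fact
  show ?thesis
    by (rule lmodule_image[OF regular_module_lmodule[OF R.ring_axioms], of "\<lambda>u. u \<odot>\<^bsub>M\<^esub> v"])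
      (use assms(2) in \<open>auto intro!: lmod_homI
        simp: cyclic_submodule_def regular_module_def smult_l_distr smult_assoc smult_zero_left\<close>)
qed

lemma integral_lattice_simps:
  "carrier (integral_lattice D M v) = (\<lambda>u. UK_map D emb u \<odot>\<^bsub>M\<^esub> v) ` carrier (UK D)"
  "add (integral_lattice D M v) = add M" "zero (integral_lattice D M v) = zero M"
  "u \<odot>\<^bsub>integral_lattice D M v\<^esub> x = UK_map D emb u \<odot>\<^bsub>M\<^esub> x"
  by (simp_all add: integral_lattice_def cyclic_submodule_def)

lemma integral_lattice_lmodule:
  assumes "lmodule (UK D) M" "v \<in> carrier M"
  shows "lmodule (UK D) (integral_lattice D M v)"
  unfolding integral_lattice_def using assms(2)
  by (intro cyclic_submodule_lmodule restrict_scalars_lmodule[OF assms(1) UK_ring UK_map_hom[OF emb_hom]]) simp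

lemma integral_lattice_inclusion:
  assumes "lmodule (UK D) M" "v \<in> carrier M"
  shows "(\<lambda>x. x) \<in> lmod_hom (UK D) (integral_lattice D M v) (restrict_scalars (UK_map D emb) M)"
proof -
  interpret lmodule "UK D" M by fact
  show ?thesis
    using assms(2)
    by (intro lmod_homI) (auto simp: integral_lattice_simps smult_closed ring_hom_closed[OF UK_map_hom[OF emb_hom]])
qed

lemma integral_lattice_scalar_inclusion:
  assumes "lmodule (UK D) M" "v \<in> carrier M"
  shows "(\<lambda>x. x) \<in> lmod_hom TR (scalars D (integral_lattice D M v)) (restrict_scalars emb (scalars D M))"
  using lmod_homD(1)[OF integral_lattice_inclusion[OF assms]]
  by (intro lmod_homI) (simp_all add: integral_lattice_simps UK_map_scalar[OF emb_hom])

lemma integral_lattice_iso: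
  assumes \<phi>: "\<phi> \<in> lmod_iso (UK D) M N" and M: "lmodule (UK D) M" and v: "v \<in> carrier M"
  shows "bij_betw \<phi> (carrier (integral_lattice D M v)) (carrier (integral_lattice D N (\<phi> v)))"
proof -
  have hom: "\<phi> \<in> lmod_hom (UK D) M N" and bij: "bij_betw \<phi> (carrier M) (carrier N)"
    using \<phi> by (auto simp: lmod_iso_def)
  have "\<phi> ` carrier (integral_lattice D M v) = carrier (integral_lattice D N (\<phi> v))"
    using lmod_homD(3)[OF hom ring_hom_closed[OF UK_map_hom[OF emb_hom]] v]
    by (force simp: integral_lattice_simps)
  moreover have "carrier (integral_lattice D M v) \<subseteq> carrier M"
    using lmod_homD(1)[OF integral_lattice_inclusion[OF M v]] by auto
  ultimately show ?thesis using bij by (auto simp: bij_betw_def intro: inj_on_subset)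
qed

lemma emb_zero: "emb 0 = 0"
  by (rule TR_hom_simps(4)[OF emb_hom])

lemma lookup_map_emb [simp]: "Poly_Mapping.lookup (Poly_Mapping.map emb f) w = emb (Poly_Mapping.lookup f w)"
  by (simp add: map.rep_eq when_def emb_zero)

text \<open>The canonical map, defined by unions over representatives, is the one that the universal property
  gives.\<close>

lemma lattice_tensor_map_hom:
  fixes As :: "nat \<Rightarrow> ('a::idom, 'm) module" and Ms :: "nat \<Rightarrow> ('a fract alg_closure, 'm) module"
  assumes As: "\<And>j. j < k \<Longrightarrow> lmodule TR (As j)" and Ms: "\<And>j. j < k \<Longrightarrow> lmodule TR (Ms j)"
    and incl: "\<And>j. j < k \<Longrightarrow> (\<lambda>x. x) \<in> lmod_hom TR (As j) (restrict_scalars emb (Ms j))"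
  shows "lattice_tensor_map k Ms \<in> lmod_hom TR (tensor k As) (restrict_scalars emb (tensor k Ms))"
    and "w \<in> tuples k As \<Longrightarrow> lattice_tensor_map k Ms (pure_tensor k As w) = pure_tensor k Ms w"
proof -
  let ?V = "restrict_scalars emb (tensor k Ms)"
  let ?g = "\<lambda>f. tensor_class k Ms (Poly_Mapping.map emb f)"
  note e = TR_hom_simps[OF emb_hom]
  have V: "lmodule TR ?V" by (rule restrict_scalars_lmodule[OF tensor_lmodule TR_ring emb_hom])
  have tuples: "tuples k As \<subseteq> tuples k Ms"
    using lmod_homD(1)[OF incl] by (auto simp: tuples_def PiE_iff)
  have keys: "supp (Poly_Mapping.map emb f) \<subseteq> tuples k Ms" if "supp f \<subseteq> tuples k As" for f :: "(nat \<Rightarrow> 'm) \<Rightarrow>\<^sub>0 'a"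
    using that tuples by (auto simp: in_keys_iff subset_iff emb_zero) (metis emb_zero)
  have g: "?g \<in> lmod_hom TR (free_module (tuples k As)) ?V"
  proof (rule lmod_homI)
    fix f :: "(nat \<Rightarrow> 'm) \<Rightarrow>\<^sub>0 'a" and c :: 'a assume f: "f \<in> carrier (free_module (tuples k As))"
    then show "?g f \<in> carrier ?V" using lmod_homD(1)[OF tensor_class_hom[of k Ms]] keys by simp
    have "Poly_Mapping.map emb (scale c f) = scale (emb c) (Poly_Mapping.map emb f)"
      by (rule poly_mapping_eqI) (simp add: e)
    then show "?g (c \<odot>\<^bsub>free_module (tuples k As)\<^esub> f) = c \<odot>\<^bsub>?V\<^esub> ?g f"
      using lmod_homD(3)[OF tensor_class_hom[of k Ms], of "emb c" "Poly_Mapping.map emb f"] keys f by simp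
  next
    fix f f' :: "(nat \<Rightarrow> 'm) \<Rightarrow>\<^sub>0 'a" assume f: "f \<in> carrier (free_module (tuples k As))" "f' \<in> carrier (free_module (tuples k As))"
    have "Poly_Mapping.map emb (f + f') = Poly_Mapping.map emb f + Poly_Mapping.map emb f'"
      by (rule poly_mapping_eqI) (simp add: e lookup_add)
    then show "?g (f \<oplus>\<^bsub>free_module (tuples k As)\<^esub> f') = ?g f \<oplus>\<^bsub>?V\<^esub> ?g f'"
      using lmod_homD(2)[OF tensor_class_hom[of k Ms], of "Poly_Mapping.map emb f" "Poly_Mapping.map emb f'"] keys f by simp
  qed
  have single: "?g (single w 1) = pure_tensor k Ms w" if w: "w \<in> tuples k As" for w
  proof -
    have "Poly_Mapping.map emb (single w (1 :: 'a)) = single w 1"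
      by (rule poly_mapping_eqI) (simp add: e lookup_single when_def)
    then show ?thesis using w tuples by (simp add: pure_tensor_eq subsetD)
  qed
  have "multilinear k As ?V (\<lambda>w. pure_tensor k Ms (restrict (\<lambda>j. w j) {..<k}))"
    by (rule multilinear_map[OF multilinear_restrict_scalars[OF pure_tensor_multilinear[OF Ms] emb_hom] incl])
  then have ml0: "multilinear k As ?V (pure_tensor k Ms)" by (simp add: pure_tensor_restrict)
  have ml: "multilinear k As ?V (\<lambda>w. ?g (single w 1))"
    unfolding multilinear_def
  proof (intro conjI ballI allI impI)
    show "?g (single w 1) \<in> carrier ?V" if "w \<in> tuples k As" for w
      using multilinearD(1)[OF ml0 that] single[OF that] by (simp only:)
    show "(\<lambda>x. ?g (single (w(j := x)) 1)) \<in> lmod_hom TR (As j) ?V" if w: "w \<in> tuples k As" "j < k" for w j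
      by (rule lmod_hom_cong[OF As[OF w(2)] multilinearD(2)[OF ml0 w]]) (rule single[OF tuples_upd[OF w], symmetric])
  qed
  have class_eq: "lattice_tensor_map k Ms (tensor_class k As f) = ?g f" if f: "supp f \<subseteq> tuples k As" for f
    unfolding lattice_tensor_map_def
    using tensor_hom_constant[OF As V g ml f] tensor_class_member(1)[OF f] by (intro SUP_eq_const) blast+
  show "lattice_tensor_map k Ms (pure_tensor k As w) = pure_tensor k Ms w" if w: "w \<in> tuples k As"
    using class_eq[OF keys_single_subset[OF w]] single[OF w] by (simp add: pure_tensor_eq[OF w])
  obtain g' where g': "g' \<in> lmod_hom TR (tensor k As) ?V" "\<And>w. w \<in> tuples k As \<Longrightarrow> g' (pure_tensor k As w) = pure_tensor k Ms w"
    using tensor_universal[of k As, OF As V ml0] by blast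
  have "g' v = lattice_tensor_map k Ms v" if v: "v \<in> carrier (tensor k As)" for v
  proof -
    obtain f where f: "supp f \<subseteq> tuples k As" "v = tensor_class k As f" using v by (auto simp: tensor_carrier)
    have "g' (tensor_class k As f) = ?g f"
      by (rule free_module_hom_eqI[OF V lmod_hom_comp[OF tensor_class_hom g'(1)] g _ f(1)])
        (use g'(2) single in \<open>simp add: pure_tensor_eq\<close>)
    then show ?thesis using f class_eq by simp
  qed
  then show "lattice_tensor_map k Ms \<in> lmod_hom TR (tensor k As) ?V"
    by (rule lmod_hom_cong[OF tensor_lmodule g'(1)])
qed

text \<open>What is asked of \<open>M\<close> and \<open>t\<close> in \<open>tensor_reduction\<close>, for lattices.  The comultiplication formula holds
  in \<open>M\<close> because it holds in \<open>T\<close>, of which \<open>M\<close> is a part by way of \<open>\<phi>\<close>, and because the divided powers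
  lie in \<open>U\<^sub>\<int>\<close>, so that they act on the lattices as they do on the modules containing them.\<close>

lemma lattice_tensor_divpow:
  fixes W :: "nat \<Rightarrow> (('g::complex_lie_algebra, 'a::idom fract alg_closure) hyp, 'w) module"
    and N :: "(('g, 'a fract alg_closure) hyp, 'n) module" and D :: "('g, 'i) chevalley_data" and v :: "nat \<Rightarrow> 'w"
  defines "A \<equiv> \<lambda>j. scalars D (integral_lattice D (W j) (v j))"
  assumes W: "\<And>j. j < k \<Longrightarrow> lmodule (UK D) (W j)" and v: "\<And>j. j < k \<Longrightarrow> v j \<in> carrier (W j)"
    and T: "is_tensor_module D k W T" and N: "lmodule (UK D) N" and \<phi>: "\<phi> \<in> lmod_iso (UK D) T N"
  defines "vv \<equiv> pure_tensor k (\<lambda>j. scalars D (W j)) v"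
  defines "M \<equiv> integral_lattice D N (\<phi> vv)"
  defines "t \<equiv> \<lambda>x. \<phi> (lattice_tensor_map k (\<lambda>j. scalars D (W j)) x)"
  assumes bij: "bij_betw (lattice_tensor_map k (\<lambda>j. scalars D (W j)))
    (carrier (tensor k A)) (carrier (integral_lattice D T vv))"
  shows "t \<in> lmod_hom TR (tensor k A) (scalars D M)"
    and "bij_betw t (carrier (tensor k A)) (carrier M)"
    and "\<beta> \<in> roots (cartan D) \<Longrightarrow> x \<in> tuples k A \<Longrightarrow>
      divop D \<beta> r n \<odot>\<^bsub>M\<^esub> t (pure_tensor k A x) =
        (\<Oplus>\<^bsub>M\<^esub> l \<in> compositions k n.
          t (pure_tensor k A (\<lambda>j. divop D \<beta> r (l j) \<odot>\<^bsub>integral_lattice D (W j) (v j)\<^esub> x j)))"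
proof -
  define B where "B j = scalars D (W j)" for j
  have B_eq: "B = (\<lambda>j. scalars D (W j))" by (simp add: B_def fun_eq_iff)
  let ?VA = "tensor k A" and ?VB = "tensor k B" and ?\<tau> = "lattice_tensor_map k B"
  let ?L = "\<lambda>j. integral_lattice D (W j) (v j)"
  note Lm = integral_lattice_lmodule[OF W v]
  have Am: "lmodule TR (A j)" if "j < k" for j unfolding A_def by (rule scalars_lmodule[OF Lm[OF that that]])
  have Bm: "lmodule TR (B j)" if "j < k" for j unfolding B_def by (rule scalars_lmodule[OF W[OF that]])
  have incl: "(\<lambda>x. x) \<in> lmod_hom TR (A j) (restrict_scalars emb (B j))" if "j < k" for j
    unfolding A_def B_def by (rule integral_lattice_scalar_inclusion[OF W[OF that] v[OF that]])
  have \<tau>: "?\<tau> \<in> lmod_hom TR ?VA (restrict_scalars emb ?VB)"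
      "\<And>w. w \<in> tuples k A \<Longrightarrow> ?\<tau> (pure_tensor k A w) = pure_tensor k B w"
    using lattice_tensor_map_hom[of k A B, OF Am Bm incl] by blast+
  note T_lmod = is_tensor_moduleD(1)[OF T] and T_carrier = is_tensor_moduleD(2)[OF T, folded B_eq]
    and T_add = is_tensor_moduleD(4)[OF T, folded B_eq] and T_scalar = is_tensor_moduleD(5)[OF T, folded B_eq]
    and T_divpow = is_tensor_moduleD(6)[OF T, folded B_eq]
  have hom: "\<phi> \<in> lmod_hom (UK D) T N" using \<phi> by (simp add: lmod_iso_def)
  have vv: "vv \<in> carrier T"
  proof -
    have "restrict v {..<k} \<in> tuples k B" using v by (intro restrict_in_tuples) (simp add: B_def)
    from pure_tensor_closed[OF this] show ?thesis by (simp add: pure_tensor_restrict T_carrier vv_def B_eq)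
  qed
  have \<phi>vv: "\<phi> vv \<in> carrier N" by (rule lmod_homD(1)[OF hom vv])
  have t_eq: "t = (\<lambda>x. \<phi> (?\<tau> x))" by (simp add: t_def B_eq)
  have bij': "bij_betw ?\<tau> (carrier ?VA) (carrier (integral_lattice D T vv))" using bij by (simp add: B_eq)
  have "t = \<phi> \<circ> ?\<tau>" by (simp add: t_eq fun_eq_iff)
  then show t_bij: "bij_betw t (carrier ?VA) (carrier M)"
    using bij_betw_trans[OF bij' integral_lattice_iso[OF \<phi> T_lmod vv]] by (simp add: M_def)
  note h = lmod_homD[OF \<tau>(1), unfolded restrict_scalars_simps]
  show "t \<in> lmod_hom TR ?VA (scalars D M)"
  proof (rule lmod_homI)
    fix x y and a :: 'a assume x: "x \<in> carrier ?VA"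
    show "t x \<in> carrier (scalars D M)" using t_bij x by (auto simp: bij_betw_def)
    have "t (a \<odot>\<^bsub>?VA\<^esub> x) = \<phi> (UK_scalar D (emb a) \<odot>\<^bsub>T\<^esub> ?\<tau> x)"
      using h(1)[of x] h(3)[of a x] x by (simp add: t_eq T_scalar T_carrier)
    also have "\<dots> = UK_scalar D (emb a) \<odot>\<^bsub>N\<^esub> t x"
      using lmod_homD(3)[OF hom UK_scalar_closed, of "?\<tau> x" "emb a"] h(1)[of x] x by (simp add: t_eq T_carrier)
    finally show "t (a \<odot>\<^bsub>?VA\<^esub> x) = a \<odot>\<^bsub>scalars D M\<^esub> t x"
      by (simp add: M_def integral_lattice_simps UK_map_scalar[OF emb_hom])
    show "t (x \<oplus>\<^bsub>?VA\<^esub> y) = t x \<oplus>\<^bsub>scalars D M\<^esub> t y" if y: "y \<in> carrier ?VA"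
      using lmod_homD(2)[OF hom, of "?\<tau> x" "?\<tau> y"] h(1,2) x y
      by (simp add: t_eq M_def integral_lattice_simps T_carrier T_add)
  qed
  have t_pure: "t (pure_tensor k A x) = \<phi> (pure_tensor k B x)" if "x \<in> tuples k A" for x
    by (simp add: t_eq \<tau>(2)[OF that])
  assume \<beta>: "\<beta> \<in> roots (cartan D)" and x: "x \<in> tuples k A"
  have u: "divpow D \<beta> r a \<in> UZ D" for a by (rule UZ.gen[OF \<beta>])
  let ?p = "\<lambda>l. restrict (\<lambda>j. divop D \<beta> r (l j) \<odot>\<^bsub>?L j\<^esub> x j) {..<k}"
  have p: "?p l \<in> tuples k A" for l
  proof (rule tuples_map[OF _ x])
    show "(\<lambda>z. divop D \<beta> r (l j) \<odot>\<^bsub>?L j\<^esub> z) \<in> lmod_hom TR (A j) (A j)" if "j < k" for j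
      using UK_of_smult_hom[OF Lm[OF that that] u] by (simp add: A_def)
  qed
  have sub: "z \<in> tuples k B" if "z \<in> tuples k A" for z
    using that lmod_homD(1)[OF incl] by (auto simp: tuples_def PiE_iff)
  have pc: "pure_tensor k B (?p l) \<in> carrier T" for l using pure_tensor_closed[OF sub[OF p]] by (simp add: T_carrier)
  have tc: "t (pure_tensor k A (?p l)) \<in> carrier M" for l
    using t_bij pure_tensor_closed[OF p] by (auto simp: bij_betw_def)
  have xW: "x \<in> tuples k W" using sub[OF x] by (simp add: tuples_def B_def)
  let ?R = "restrict_scalars (UK_map D emb) N"
  have Mm: "lmodule (UK D) M" unfolding M_def by (rule integral_lattice_lmodule[OF N \<phi>vv])
  have Rm: "lmodule (UK D) ?R" by (rule restrict_scalars_lmodule[OF N UK_ring UK_map_hom[OF emb_hom]])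
  have "divop D \<beta> r n \<odot>\<^bsub>M\<^esub> t (pure_tensor k A x) = \<phi> (divop D \<beta> r n \<odot>\<^bsub>T\<^esub> pure_tensor k B x)"
    using lmod_homD(3)[OF hom UK_of_closed[OF u]] pure_tensor_closed[OF sub[OF x]]
    by (simp add: t_pure[OF x] M_def integral_lattice_simps UK_map_of[OF emb_hom u] T_carrier)
  also have "divop D \<beta> r n \<odot>\<^bsub>T\<^esub> pure_tensor k B x = (\<Oplus>\<^bsub>T\<^esub> l \<in> compositions k n. pure_tensor k B (?p l))"
    unfolding T_divpow[OF \<beta> xW]
    by (simp add: pure_tensor_restrict integral_lattice_simps UK_map_of[OF emb_hom u])
  also have "\<phi> \<dots> = (\<Oplus>\<^bsub>N\<^esub> l \<in> compositions k n. \<phi> (pure_tensor k B (?p l)))"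
    using pc by (intro lmod_hom_finsum[OF T_lmod N hom finite_compositions]) simp
  also have "\<dots> = (\<Oplus>\<^bsub>?R\<^esub> l \<in> compositions k n. t (pure_tensor k A (?p l)))"
    by (simp add: t_pure[OF p] finsum_struct_cong[of ?R N])
  also have "\<dots> = (\<Oplus>\<^bsub>M\<^esub> l \<in> compositions k n. t (pure_tensor k A (?p l)))"
    using tc lmod_hom_finsum[OF Mm Rm integral_lattice_inclusion[OF N \<phi>vv, folded M_def] finite_compositions]
    by (simp add: Pi_iff)
  finally show "divop D \<beta> r n \<odot>\<^bsub>M\<^esub> t (pure_tensor k A x) =
      (\<Oplus>\<^bsub>M\<^esub> l \<in> compositions k n. t (pure_tensor k A (\<lambda>j. divop D \<beta> r (l j) \<odot>\<^bsub>?L j\<^esub> x j)))"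
    by (simp only: pure_tensor_restrict)
qed

section \<open>Tuples of polynomials with invertible leading coefficients\<close>

lemma map_poly_ring_hom:
  assumes \<phi>: "\<phi> \<in> ring_hom (TR :: 'a::comm_ring_1 ring) (TR :: 'b::comm_ring_1 ring)"
  shows "map_poly \<phi> (p * q) = map_poly \<phi> p * map_poly \<phi> q"
    "map_poly \<phi> 1 = 1" "map_poly \<phi> (p ^ n) = map_poly \<phi> p ^ n"
    "map_poly \<phi> (\<Prod>j\<in>J. f j) = (\<Prod>j\<in>J. map_poly \<phi> (f j))" 
proof -
  note e = TR_hom_simps[OF \<phi>]
  have sum: "\<phi> (\<Sum>i\<in>I. h i) = (\<Sum>i\<in>I. \<phi> (h i))" for I :: "nat set" and h
    by (induction I rule: infinite_finite_induct) (simp_all add: e)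
  show mult: "map_poly \<phi> (p * q) = map_poly \<phi> p * map_poly \<phi> q" for p q
    by (rule poly_eqI) (simp add: coeff_map_poly coeff_mult e sum)
  show one: "map_poly \<phi> 1 = 1" by (simp add: e)
  show "map_poly \<phi> (p ^ n) = map_poly \<phi> p ^ n" by (induction n) (simp_all add: mult one)
  show "map_poly \<phi> (\<Prod>j\<in>J. f j) = (\<Prod>j\<in>J. map_poly \<phi> (f j))"
    by (induction J rule: infinite_finite_induct) (simp_all add: mult one)
qed

lemma map_poly_omega_weight:
  assumes \<phi>: "\<phi> \<in> ring_hom (TR :: 'a::comm_ring_1 ring) (TR :: 'b::comm_ring_1 ring)"
  shows "map_poly \<phi> (omega_weight D \<mu> a i) = omega_weight D \<mu> (\<phi> a) i"
proof -
  note e = TR_hom_simps[OF \<phi>]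
  have "\<phi> (- a) = - \<phi> a" using e(1)[of a "- a"] e(4) by (simp add: eq_neg_iff_add_eq_0 add.commute)
  then have "map_poly \<phi> [:1, - a:] = [:1, - \<phi> a:]" by (intro poly_eqI) (simp add: coeff_map_poly coeff_pCons e split: nat.split)
  then show ?thesis by (simp add: omega_weight_def map_poly_ring_hom[OF \<phi>])
qed

lemma omega_weight_P_plus_plus:
  assumes "a dvd (1 :: 'a::idom)"
  shows "omega_weight D \<mu> a \<in> P_plus_plus"
proof -
  have "a \<noteq> 0" using assms by auto
  then have "lead_coeff (omega_weight D \<mu> a i) dvd 1" for i
    using assms dvd_power_same[of "- a" 1] by (simp add: omega_weight_def lead_coeff_power)
  moreover have "Polynomial.coeff (omega_weight D \<mu> a i) 0 = 1" for i
    by (simp add: omega_weight_def flip: poly_0_coeff_0)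
  ultimately show ?thesis by (simp add: P_plus_plus_def P_plus_def)
qed

lemma prod_P_plus_plus:
  assumes "\<And>j. j \<in> J \<Longrightarrow> f j \<in> P_plus_plus"
  shows "(\<lambda>i. \<Prod>j\<in>J. (f j i :: 'a::idom poly)) \<in> P_plus_plus"
proof -
  have "lead_coeff (\<Prod>j\<in>J. f j i) dvd 1" for i
    using prod_dvd_prod[of J "\<lambda>j. lead_coeff (f j i)" "\<lambda>_. 1"] assms by (simp add: lead_coeff_prod P_plus_plus_def)
  moreover have "Polynomial.coeff (\<Prod>j\<in>J. f j i) 0 = 1" for i
    using assms by (simp add: P_plus_plus_def P_plus_def poly_prod flip: poly_0_coeff_0)
  ultimately show ?thesis by (simp add: P_plus_plus_def P_plus_def)
qed

section \<open>Weyl modules as tensor products\<close>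

theorem corollary4p8:
  fixes D :: "('g::complex_lie_algebra, 'i::finite) chevalley_data"
    and \<rho> :: "'a::idom \<Rightarrow> 'f::alg_closed_field"
    and p k :: nat
    and lam :: "nat \<Rightarrow> 'g \<Rightarrow> complex"
    and b :: "nat \<Rightarrow> 'f"
  assumes "fd_simple_lie_algebra TYPE('g)" and "chevalley_setup D"
    and "CHAR('f) = p" and "p > 0"
    and "is_dvr TYPE('a)" and "\<forall>(n::int) (a::'a). n \<noteq> 0 \<and> of_int n * a = 0 \<longrightarrow> a = 0"
    and "is_residue_map \<rho>"
    and C1: "\<forall>\<omega> :: 'i \<Rightarrow> 'a poly. \<omega> \<in> P_plus_plus \<longrightarrow>
      (\<forall>v \<in> weyl_generators D (\<lambda>i. map_poly emb (\<omega> i)).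
        lmod_isomorphic (UK D)
          (base_change D \<rho> (integral_lattice D (weyl D (\<lambda>i. map_poly emb (\<omega> i))) v))
          (weyl D (\<lambda>i. map_poly \<rho> (\<omega> i))))"
    and C2: "\<forall>(m::nat) (\<mu> :: nat \<Rightarrow> 'g \<Rightarrow> complex) (a :: nat \<Rightarrow> 'a) v.
      let W = (\<lambda>j. weyl D (omega_weight D (\<mu> j) (emb (a j))));
          L = (\<lambda>j. integral_lattice D (W j) (v j));
          \<omega> = (\<lambda>i. \<Prod>j<m. omega_weight D (\<mu> j) (emb (a j)) i);
          vv = pure_tensor m (\<lambda>j. scalars D (W j)) v
      in (\<forall>j<m. \<mu> j \<in> dominant_weights D) \<longrightarrow> (\<forall>j<m. a j dvd 1) \<longrightarrow>
         (\<forall>i<m. \<forall>j<m. i \<noteq> j \<longrightarrow> \<rho> (a i) \<noteq> \<rho> (a j)) \<longrightarrow>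
         (\<forall>j<m. v j \<in> weyl_generators D (omega_weight D (\<mu> j) (emb (a j)))) \<longrightarrow>
         (\<exists>T. is_tensor_module D m W T \<and>
           (\<exists>\<phi> \<in> lmod_iso (UK D) T (weyl D \<omega>). \<phi> vv \<in> weyl_generators D \<omega>) \<and>
           bij_betw (lattice_tensor_map m (\<lambda>j. scalars D (W j)))
             (carrier (tensor m (\<lambda>j. scalars D (L j)))) (carrier (integral_lattice D T vv)))"
    and "\<forall>j<k. lam j \<in> dominant_weights D" and "\<forall>j<k. b j \<noteq> 0"
    and "\<forall>i<k. \<forall>j<k. i \<noteq> j \<longrightarrow> b i \<noteq> b j"
  shows "let W = (\<lambda>j. weyl D (omega_weight D (lam j) (b j)));
             W' = weyl D (\<lambda>i. \<Prod>j<k. omega_weight D (lam j) (b j) i)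
         in (\<exists>T. is_tensor_module D k W T \<and> lmod_isomorphic (UK D) W' T) \<and>
            (\<forall>Ms :: nat \<Rightarrow> (('g, 'f) hyp, 'm) module.
               (\<forall>j<k. lmodule (UK D) (Ms j) \<and> is_quotient_of (UK D) (Ms j) (W j)) \<longrightarrow>
               (\<exists>T. is_tensor_module D k Ms T \<and> is_quotient_of (UK D) T W'))"
proof -
  note residue = \<open>is_residue_map \<rho>\<close>
  have \<rho>: "\<rho> \<in> ring_hom TR TR" "surj \<rho>" and unit: "\<And>a. \<rho> a \<noteq> 0 \<Longrightarrow> a dvd 1"
    using residue_map_hom[OF residue] residue by (auto simp: is_residue_map_def)
  \<comment> \<open>Lifts of the \<open>b j\<close> are units since their residues do not vanish.\<close>
  define a where "a j = inv_into UNIV \<rho> (b j)" for j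
  have a: "\<rho> (a j) = b j" for j by (simp add: a_def surj_f_inv_f[OF \<rho>(2)])
  have a_unit: "a j dvd 1" if "j < k" for j using assms(11) that a[of j] unit[of "a j"] by simp
  define W where "W j = weyl D (omega_weight D (lam j) (b j))" for j
  define W0 where "W0 j = weyl D (omega_weight D (lam j) (emb (a j)))" for j
  define \<omega> where "\<omega> i = (\<Prod>j<k. omega_weight D (lam j) (a j) i)" for i
  let ?\<omega>gen = "\<lambda>i. \<Prod>j<k. omega_weight D (lam j) (emb (a j)) i"
  let ?Ngen = "weyl D ?\<omega>gen" and ?N = "weyl D (\<lambda>i. \<Prod>j<k. omega_weight D (lam j) (b j) i)"
  have \<omega>_emb: "(\<lambda>i. map_poly emb (\<omega> i)) = ?\<omega>gen"
    by (simp add: \<omega>_def map_poly_ring_hom[OF emb_hom] map_poly_omega_weight[OF emb_hom])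
  have \<omega>_\<rho>: "(\<lambda>i. map_poly \<rho> (\<omega> i)) = (\<lambda>i. \<Prod>j<k. omega_weight D (lam j) (b j) i)"
    by (simp add: \<omega>_def map_poly_ring_hom[OF \<rho>(1)] map_poly_omega_weight[OF \<rho>(1)] a)
  \<comment> \<open>(C1), in terms of reductions; it is applied to each factor and to the product.\<close>
  have reduction: "\<exists>\<pi>. reduction D \<rho> (integral_lattice D (weyl D (\<lambda>i. map_poly emb (\<zeta> i))) v) (weyl D (\<lambda>i. map_poly \<rho> (\<zeta> i))) \<pi>"
    if \<zeta>: "\<zeta> \<in> P_plus_plus" and v: "v \<in> weyl_generators D (\<lambda>i. map_poly emb (\<zeta> i))" for \<zeta> v
  proof -
    obtain \<psi> where "\<psi> \<in> lmod_iso (UK D) (base_change D \<rho> (integral_lattice D (weyl D (\<lambda>i. map_poly emb (\<zeta> i))) v))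
        (weyl D (\<lambda>i. map_poly \<rho> (\<zeta> i)))"
      using C1 \<zeta> v unfolding lmod_isomorphic_def by blast
    from base_change_iso_reduction[OF integral_lattice_lmodule[OF weyl_lmodule weyl_generator_closed[OF v]] \<rho>(1) this \<rho>(2) weyl_lmodule]
    show ?thesis by blast
  qed

  \<comment> \<open>The class of \<open>1\<close> is an \<open>\<ell>\<close>-highest-weight generator of each factor.\<close>
  define v where "v j = UK_scalar D 1 \<odot>\<^bsub>W0 j\<^esub> (weyl_ideal D (omega_weight D (lam j) (emb (a j))) +>\<^bsub>regular_module (UK D)\<^esub> \<one>\<^bsub>UK D\<^esub>)" for j
  have v: "v j \<in> weyl_generators D (omega_weight D (lam j) (emb (a j)))" for j
    unfolding weyl_generators_def v_def W0_def by (rule CollectI) (metis zero_neq_one)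
  define L where "L j = integral_lattice D (W0 j) (v j)" for j
  have Lm: "lmodule (UK D) (L j)" for j
    unfolding L_def W0_def by (rule integral_lattice_lmodule[OF weyl_lmodule weyl_generator_closed[OF v]])
  have Wm: "lmodule (UK D) (W j)" for j unfolding W_def by (rule weyl_lmodule)
  have "\<exists>\<pi>. reduction D \<rho> (L j) (W j) \<pi>" if "j < k" for j
    using reduction[OF omega_weight_P_plus_plus[OF a_unit[OF that]], of "v j" D "lam j"] v[of j]
    by (simp add: map_poly_omega_weight[OF emb_hom] map_poly_omega_weight[OF \<rho>(1)] a L_def W_def W0_def)
  then obtain \<pi> where \<pi>: "\<And>j. j < k \<Longrightarrow> reduction D \<rho> (L j) (W j) (\<pi> j)" by metis

  let ?vv = "pure_tensor k (\<lambda>j. scalars D (W0 j)) v"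
  have "\<exists>T0. is_tensor_module D k W0 T0 \<and> (\<exists>\<phi> \<in> lmod_iso (UK D) T0 ?Ngen. \<phi> ?vv \<in> weyl_generators D ?\<omega>gen) \<and>
      bij_betw (lattice_tensor_map k (\<lambda>j. scalars D (W0 j)))
        (carrier (tensor k (\<lambda>j. scalars D (L j)))) (carrier (integral_lattice D T0 ?vv))"
  proof -
    have "\<forall>i<k. \<forall>j<k. i \<noteq> j \<longrightarrow> \<rho> (a i) \<noteq> \<rho> (a j)" using assms(12) by (simp add: a)
    then show ?thesis
      using C2[THEN spec[of _ k], THEN spec[of _ lam], THEN spec[of _ a], THEN spec[of _ v],
          unfolded Let_def, folded W0_def L_def] assms(10) a_unit v by simp
  qed
  then obtain T0 \<phi> where T0: "is_tensor_module D k W0 T0" and \<phi>: "\<phi> \<in> lmod_iso (UK D) T0 ?Ngen"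
    and gen: "\<phi> ?vv \<in> weyl_generators D ?\<omega>gen"
    and bij: "bij_betw (lattice_tensor_map k (\<lambda>j. scalars D (W0 j)))
        (carrier (tensor k (\<lambda>j. scalars D (L j)))) (carrier (integral_lattice D T0 ?vv))" by blast
  define M where "M = integral_lattice D ?Ngen (\<phi> ?vv)"
  have Mm: "lmodule (UK D) M"
    unfolding M_def by (rule integral_lattice_lmodule[OF weyl_lmodule weyl_generator_closed[OF gen]])
  have "\<exists>\<pi>'. reduction D \<rho> M ?N \<pi>'"
  proof -
    have "\<omega> \<in> P_plus_plus"
      unfolding \<omega>_def[abs_def] by (intro prod_P_plus_plus omega_weight_P_plus_plus a_unit) simp
    from reduction[OF this, unfolded \<omega>_emb \<omega>_\<rho>, OF gen] show ?thesis by (simp add: M_def)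
  qed
  then obtain \<pi>' where \<pi>': "reduction D \<rho> M ?N \<pi>'" by blast
  have W0m: "lmodule (UK D) (W0 j)" and v_closed: "v j \<in> carrier (W0 j)" for j
    unfolding W0_def by (rule weyl_lmodule, rule weyl_generator_closed[OF v])
  note data = lattice_tensor_divpow[of k D W0 v T0 ?Ngen \<phi>, folded L_def M_def, OF W0m v_closed T0 weyl_lmodule \<phi> bij]
  have a1: "\<exists>T. is_tensor_module D k W T \<and> lmod_isomorphic (UK D) ?N T"
    by (rule tensor_reduction[OF \<rho> Lm Wm Mm weyl_lmodule \<pi> \<pi>' data])
  then obtain T where T: "is_tensor_module D k W T" and iso: "lmod_isomorphic (UK D) ?N T" by blast
  from iso obtain \<eta> where \<eta>: "\<eta> \<in> lmod_hom (UK D) ?N T" "\<eta> ` carrier ?N = carrier T"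
    by (auto simp: lmod_isomorphic_def lmod_iso_def bij_betw_def)
  \<comment> \<open>A quotient of \<open>T\<close> is one of the Weyl module of the product as well, as the two are isomorphic.\<close>
  have b1: "\<exists>T. is_tensor_module D k Ms T \<and> is_quotient_of (UK D) T ?N"
    if Ms: "\<forall>j<k. lmodule (UK D) (Ms j) \<and> is_quotient_of (UK D) (Ms j) (W j)"
    for Ms :: "nat \<Rightarrow> (('g, 'f) hyp, 'm) module"
  proof -
    obtain T' \<gamma> where T': "is_tensor_module D k Ms T'" and \<gamma>: "\<gamma> \<in> lmod_hom (UK D) T T'" "\<gamma> ` carrier T = carrier T'"
      using tensor_module_quotient[OF T Wm, of Ms] Ms unfolding is_quotient_of_def by blast
    have "(\<lambda>x. \<gamma> (\<eta> x)) ` carrier ?N = carrier T'" using \<eta>(2) \<gamma>(2) by (metis image_image)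
    with lmod_hom_comp[OF \<eta>(1) \<gamma>(1)] T' show ?thesis unfolding is_quotient_of_def by blast
  qed
  show ?thesis
    unfolding Let_def W_def[symmetric] using a1 b1 by blast
qed

end
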